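(* Let $f(z)$ be a transcendental meromorphic function in $\mathbb{C}$ with hyper order $\sigma_2(f)<1$. Let $$F(z,f)=f(z+c_1)^{i_1}f(z+c_2)^{i_2}\cdots f(z+c_m)^{i_m},$$ where $m\ge 1$ is an integer, $i_1,\dots,i_m$ are positive integers, and $c_1,\dots,c_m$ are distinct non-zero complex constants. Let $d_F=i_1+\cdots+i_m$ be the degree of $F(z,f)$ and let $n>d_F$ be an integer. Suppose that all except for finitely many poles $z_i$ and zeros $z_j$ of $f(z)$ satisfy $z_i-z_j\neq c_l$ for $l=1,\dots,m$ (i.e., there are only finitely many pairs consisting of a pole $z_i$ and a zero $z_j$ of $f$ with $z_i-z_j\in\{c_1,\dots,c_m\}$). If $s(z)\not\equiv 0$ is a small meromorphic function of $f(z)$, then $$2\overline{N}\left(r,\frac{1}{f(z)^nF(z,f)-s(z)}\right)\ge (n-1)T(r,f(z))-(2m+1)\overline{N}(r,f(z))+S(r,f).$$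
   Context: Standard notation of Nevanlinna theory is used: $T(r,f)$ is the characteristic function and $\overline{N}(r,f)$ is the integrated counting function of the poles of $f$, each counted once ignoring multiplicity. The hyper order is $\sigma_2(f)=\limsup_{r\to\infty}\frac{\log^+\log^+T(r,f)}{\log r}$. $S(r,f)$ denotes any real function that is $o(T(r,f))$ as $r\to\infty$ outside a possible exceptional set $E$ of finite logarithmic measure ($\int_{E\cap[1,\infty)}dr/r<\infty$); an inequality containing a term $S(r,f)$ asserts that it holds with some such function. A meromorphic function $\alpha$ is a small function of $f$ if $T(r,\alpha)=S(r,f)$. *)

theory Defs
  imports "HOL-Complex_Analysis.Complex_Analysis"
begin

text \<open>
  A meromorphic function is a total function \<open>f :: complex \<Rightarrow> complex\<close> with \<open>f meromorphic_on UNIV\<close>.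
  Its values on a set without limit points (in particular at poles) are arbitrary, so all notions
  below are insensitive to changing \<open>f\<close> on such a set. In particular \<open>f \<equiv> g\<close> is rendered as
  \<open>\<forall>\<^sub>\<approx>z. f z = g z\<close>.
\<close>

definition log_plus :: "real \<Rightarrow> real" where
  "log_plus x = ln (max 1 x)"

definition transcendental_meromorphic :: "(complex \<Rightarrow> complex) \<Rightarrow> bool" where
  "transcendental_meromorphic f \<longleftrightarrow> f meromorphic_on UNIV \<and>
     \<not> (\<exists>p q :: complex poly. q \<noteq> 0 \<and> (\<forall>\<^sub>\<approx>z. f z = poly p z / poly q z))"

definition poles_in_disc :: "(complex \<Rightarrow> complex) \<Rightarrow> real \<Rightarrow> complex set" where
  "poles_in_disc f r = {z \<in> cball 0 r. is_pole f z}"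

definition pole_count :: "(complex \<Rightarrow> complex) \<Rightarrow> real \<Rightarrow> real" where
  "pole_count f r = (\<Sum>z\<in>poles_in_disc f r. real_of_int (- zorder f z))"

definition pole_count_distinct :: "(complex \<Rightarrow> complex) \<Rightarrow> real \<Rightarrow> real" where
  "pole_count_distinct f r = real (card (poles_in_disc f r))"

definition integrated_count :: "(real \<Rightarrow> real) \<Rightarrow> real \<Rightarrow> real" where
  "integrated_count n r = integral {0..r} (\<lambda>t. (n t - n 0) / t) + n 0 * ln r"

definition nev_N :: "real \<Rightarrow> (complex \<Rightarrow> complex) \<Rightarrow> real" where
  "nev_N r f = integrated_count (pole_count f) r"

definition nev_Nbar :: "real \<Rightarrow> (complex \<Rightarrow> complex) \<Rightarrow> real" where
  "nev_Nbar r f = integrated_count (pole_count_distinct f) r"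

definition nev_m :: "real \<Rightarrow> (complex \<Rightarrow> complex) \<Rightarrow> real" where
  "nev_m r f = integral {0..2 * pi} (\<lambda>\<theta>. log_plus (norm (f (rcis r \<theta>)))) / (2 * pi)"

definition nev_T :: "real \<Rightarrow> (complex \<Rightarrow> complex) \<Rightarrow> real" where
  "nev_T r f = nev_m r f + nev_N r f"

definition hyper_order :: "(complex \<Rightarrow> complex) \<Rightarrow> ereal" where
  "hyper_order f = Limsup at_top (\<lambda>r. ereal (log_plus (log_plus (nev_T r f)) / ln r))"

definition finite_log_measure :: "real set \<Rightarrow> bool" where
  "finite_log_measure E \<longleftrightarrow> E \<in> sets lebesgue \<and>
     (\<integral>\<^sup>+ r. ennreal (1 / r) * indicator (E \<inter> {1..}) r \<partial>lebesgue) < \<infinity>"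

text \<open>
  \<open>nev_S f\<close> is the class of all admissible error terms \<open>S(r,f)\<close>; the filter
  \<open>inf at_top (principal (- E))\<close> expresses that \<open>r\<close> tends to infinity outside \<open>E\<close>.
\<close>
definition nev_S :: "(complex \<Rightarrow> complex) \<Rightarrow> (real \<Rightarrow> real) set" where
  "nev_S f = {h. \<exists>E. finite_log_measure E \<and>
     h \<in> o[inf at_top (principal (- E))](\<lambda>r. nev_T r f)}"

definition small_function :: "(complex \<Rightarrow> complex) \<Rightarrow> (complex \<Rightarrow> complex) \<Rightarrow> bool" where
  "small_function f \<alpha> \<longleftrightarrow> \<alpha> meromorphic_on UNIV \<and> (\<lambda>r. nev_T r \<alpha>) \<in> nev_S f"

definition shift_monomial ::
    "nat \<Rightarrow> (nat \<Rightarrow> complex) \<Rightarrow> (nat \<Rightarrow> nat) \<Rightarrow> (complex \<Rightarrow> complex) \<Rightarrow> complex \<Rightarrow> complex" where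
  "shift_monomial m c i f z = (\<Prod>l=1..m. f (z + c l) ^ i l)"

end

theory Submission
  imports Defs
begin

text \<open>
  Put \<open>\<phi> = f\<^sup>n F / s\<close> and \<open>w = \<phi>' / (\<phi> - 1)\<close>. From \<open>1/\<phi> = (w - \<phi>'/\<phi>) / w\<close>, Jensen's
  formula for \<open>w\<close> and the lemma on the logarithmic derivative one gets the second main theorem in
  the form
  \<open>m(r, 1/\<phi>) + N(r, 1/\<phi>) - Nbar(r, 1/\<phi>) \<le> Nbar(r, \<phi>) + Nbar(r, 1/(\<phi> - 1)) + S(r, f)\<close>.
  The left-hand side is at least \<open>(n - 1) T(r, f) + S(r, f)\<close>: since \<open>m(r, f(z + c)/f(z)) = S(r, f)\<close>,
  the proximity function of \<open>1/\<phi>\<close> dominates \<open>n\<close> times that of \<open>1/f\<close>, and up to finitely many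
  exceptions a zero of \<open>f\<close> of order \<open>p\<close> is not a pole of any shift, hence a zero of \<open>\<phi>\<close> of order at
  least \<open>n p\<close> (up to zeros of \<open>s\<close>). As \<open>Nbar(r, f(z + c)) \<le> Nbar(r, f) + S(r, f)\<close>, this yields the
  inequality with the constants \<open>1\<close> and \<open>m + 1\<close> instead of \<open>2\<close> and \<open>2 m + 1\<close>.

  Both logarithmic estimates rest on the factorization of \<open>f\<close> on a disc of radius \<open>R > r\<close> into a
  finite Blaschke product and \<open>exp h\<close>. Since the hyper order is below one, \<open>T(r + r powr \<delta>, f)\<close> is
  at most a constant times \<open>T(r, f)\<close> outside a set of finite logarithmic measure for some \<open>\<delta> > 0\<close>,
  so the gap \<open>R - r\<close> can be taken much larger than \<open>ln r\<close>, which makes these estimates \<open>o(T(r, f))\<close>.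
  The countably many radii whose circles meet a zero, a pole or another exceptional point of one of
  the functions involved are put into the exceptional set.
\<close>

subsection \<open>Circle means and the Poisson formula\<close>

text \<open>The weight \<open>n - 1\<close> comes from the zeros: truncation by \<open>Nbar\<close>
  leaves \<open>n p - 1 >= (n - 1) p\<close> of a zero of order \<open>p\<close>. The proximity part
  carries the larger weight \<open>n + d_F\<close>, since every shift can be traded for
  \<open>f\<close> at the cost of \<open>m(r, f(z + c)/f(z))\<close>, but only \<open>n - 1\<close>
  of it can be combined with the counting part into \<open>T(r, f)\<close>. The finitely many
  zero-pole pairs cost \<open>O(ln r)\<close>, which is \<open>o(T)\<close> because \<open>f\<close>
  is transcendental.

  Two obstacles shape the rest. First, smallness of \<open>s\<close> is known only off an
  exceptional set, whereas the two-radius estimates evaluate \<open>T(R, s)\<close> at larger radii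
  that may lie in that set. Therefore the growth argument is run on
  \<open>T(r, f) + T(r, s)\<close>, and monotonicity transports bounds across the exceptional set.
  Second, the logarithmic derivative estimate for \<phi> at \<open>r\<close> uses the characteristic
  of \<phi> at radii beyond \<open>r\<close>, so this characteristic must be bounded by
  \<open>T(r, f)\<close> in a whole window to the right of \<open>r\<close>. This is why domination
  in a window is tracked separately from smallness at \<open>r\<close>.\<close>

definition circle_mean :: "real \<Rightarrow> (complex \<Rightarrow> real) \<Rightarrow> real" where
  "circle_mean r u = integral {0..2 * pi} (\<lambda>\<theta>. u (rcis r \<theta>)) / (2 * pi)"

lemma continuous_on_circle:
  assumes "r \<ge> 0" "continuous_on (sphere 0 r) u"
  shows "continuous_on A (\<lambda>\<theta>. u (rcis r \<theta>))"
proof -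
  have "continuous_on A (\<lambda>\<theta>. rcis r \<theta>)"
    unfolding rcis_def cis_conv_exp by (intro continuous_intros)
  then show ?thesis
    by (rule continuous_on_compose2[OF assms(2)]) (use assms in auto)
qed

lemma circle_integrable:
  fixes u :: "complex \<Rightarrow> real"
  assumes "r \<ge> 0" "continuous_on (sphere 0 r) u"
  shows "(\<lambda>\<theta>. u (rcis r \<theta>)) integrable_on {a..b}"
  by (intro integrable_continuous_real continuous_on_circle assms)

lemma circle_mean_cong:
  assumes "r \<ge> 0" "\<And>z. norm z = r \<Longrightarrow> u z = v z"
  shows "circle_mean r u = circle_mean r v"
  unfolding circle_mean_def using assms by (simp)

lemma circle_mean_const [simp]: "circle_mean r (\<lambda>_. k) = k"
  by (simp add: circle_mean_def)

lemma circle_mean_add: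
  assumes "r \<ge> 0" "continuous_on (sphere 0 r) u" "continuous_on (sphere 0 r) v"
  shows "circle_mean r (\<lambda>z. u z + v z) = circle_mean r u + circle_mean r v"
  unfolding circle_mean_def
  by (simp add: integral_add[OF circle_integrable circle_integrable] assms add_divide_distrib)

lemma circle_mean_diff:
  assumes "r \<ge> 0" "continuous_on (sphere 0 r) u" "continuous_on (sphere 0 r) v"
  shows "circle_mean r (\<lambda>z. u z - v z) = circle_mean r u - circle_mean r v"
  unfolding circle_mean_def
  by (simp add: integral_diff[OF circle_integrable circle_integrable] assms diff_divide_distrib)

lemma circle_mean_cmult: "circle_mean r (\<lambda>z. k * u z) = k * circle_mean r u"
  by (simp add: circle_mean_def)

lemma circle_mean_sum:
  assumes "r \<ge> 0" "finite A" "\<And>a. a \<in> A \<Longrightarrow> continuous_on (sphere 0 r) (u a)"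
  shows "circle_mean r (\<lambda>z. \<Sum>a\<in>A. u a z) = (\<Sum>a\<in>A. circle_mean r (u a))"
  using assms(2,3)
proof (induction A rule: finite_induct)
  case (insert x F)
  then show ?case
    by (simp add: circle_mean_add[OF assms(1)] continuous_on_sum)
qed simp

lemma circle_mean_mono:
  assumes "r \<ge> 0" "continuous_on (sphere 0 r) u" "continuous_on (sphere 0 r) v"
    and "\<And>z. norm z = r \<Longrightarrow> u z \<le> v z"
  shows "circle_mean r u \<le> circle_mean r v"
  unfolding circle_mean_def
  by (intro divide_right_mono integral_le circle_integrable assms) (use assms in auto)

lemma circle_mean_nonneg:
  assumes "r \<ge> 0" "\<And>z. norm z = r \<Longrightarrow> u z \<ge> 0"
  shows "circle_mean r u \<ge> 0"
  unfolding circle_mean_def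
  \<comment> \<open>For a non-integrable integrand the integral is 0 by convention, hence the case
    split.\<close>
  by (cases "(\<lambda>\<theta>. u (rcis r \<theta>)) integrable_on {0..2*pi}")
     (use assms in \<open>auto intro!: divide_nonneg_nonneg integral_nonneg simp: not_integrable_integral\<close>)

text \<open>Stating the mean value property for real parts keeps all circle means real-valued.\<close>
lemma circle_mean_Re_holomorphic:
  assumes "F holomorphic_on ball 0 R'" "0 < R" "R < R'"
  shows "circle_mean R (\<lambda>z. Re (F z)) = Re (F 0)"
proof -
  have "((\<lambda>z. F z / (z - 0)) has_contour_integral (2 * of_real pi * \<i> * F 0)) (circlepath 0 R)"
    using assms by (intro Cauchy_integral_circlepath_simple holomorphic_on_subset[OF assms(1)]) auto
  then have "((\<lambda>t. F (0 + R * cis t) / (0 + R * cis t - 0) * R * \<i> * cis t) has_integral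
      (2 * of_real pi * \<i> * F 0)) {0..2 * pi}"
    unfolding circlepath_def by (subst (asm) has_contour_integral_part_circlepath_iff) auto
  also have "(\<lambda>t. F (0 + R * cis t) / (0 + R * cis t - 0) * R * \<i> * cis t) = (\<lambda>t. \<i> * F (rcis R t))"
    using assms(2) by (auto simp: fun_eq_iff rcis_def)
  finally have "((\<lambda>t. \<i> * F (rcis R t)) has_integral (2 * of_real pi * \<i> * F 0)) {0..2 * pi}" .
  from has_integral_mult_right[OF this, of "-\<i>"]
  have "((\<lambda>t. F (rcis R t)) has_integral (2 * of_real pi * F 0)) {0..2 * pi}"
    by (simp add: algebra_simps)
  from has_integral_Re[OF this] have "((\<lambda>t. Re (F (rcis R t))) has_integral (2 * pi * Re (F 0))) {0..2 * pi}"
    by simp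
  then show ?thesis
    by (simp add: circle_mean_def integral_unique)
qed

section \<open>Poisson kernel and Poisson integrals on a disc\<close>

definition poisson_kernel :: "complex \<Rightarrow> complex \<Rightarrow> real" where
  "poisson_kernel \<zeta> z = Re ((\<zeta> + z) / (\<zeta> - z))"

definition poisson :: "real \<Rightarrow> (complex \<Rightarrow> real) \<Rightarrow> complex \<Rightarrow> real" where
  "poisson R u z = circle_mean R (\<lambda>\<zeta>. u \<zeta> * poisson_kernel \<zeta> z)"

lemma poisson_kernel_eq:
  assumes "\<zeta> \<noteq> z"
  shows "poisson_kernel \<zeta> z = (norm \<zeta> ^ 2 - norm z ^ 2) / norm (\<zeta> - z) ^ 2"
proof -
  have "Re ((\<zeta> + z) / (\<zeta> - z)) = Re ((\<zeta> + z) * cnj (\<zeta> - z)) / norm (\<zeta> - z) ^ 2"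
    by (simp add: Re_complex_div_eq_0 complex_div_cnj[of "\<zeta> + z"] flip: of_real_power)
  also have "Re ((\<zeta> + z) * cnj (\<zeta> - z)) = norm \<zeta> ^ 2 - norm z ^ 2"
    unfolding cmod_power2 by (simp add: algebra_simps power2_eq_square)
  finally show ?thesis by (simp add: poisson_kernel_def)
qed

lemma poisson_kernel_nonneg: "norm z \<le> norm \<zeta> \<Longrightarrow> poisson_kernel \<zeta> z \<ge> 0"
  by (cases "\<zeta> = z") (simp_all add: poisson_kernel_eq, simp add: poisson_kernel_def)

lemma continuous_on_poisson_kernel:
  assumes "norm z < R"
  shows "continuous_on (sphere 0 R) (\<lambda>\<zeta>. poisson_kernel \<zeta> z)"
  unfolding poisson_kernel_def by (intro continuous_intros) (use assms in auto)

text \<open>The kernel is the real part of a function holomorphic in \<open>z\<close> with value 1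
  at the centre. This mean over \<open>z\<close> is the one that appears after the order of
  integration is exchanged.\<close>

lemma circle_mean_poisson_kernel:
  assumes "norm \<zeta> = R" "0 < r" "r < R"
  shows "circle_mean r (\<lambda>z. poisson_kernel \<zeta> z) = 1"
proof -
  have "(\<lambda>z. (\<zeta> + z) / (\<zeta> - z)) holomorphic_on ball 0 R"
    by (intro holomorphic_intros) (use assms in auto)
  from circle_mean_Re_holomorphic[OF this assms(2,3)] show ?thesis
    using assms by (auto simp: poisson_kernel_def)
qed

lemma conj_on_circle: "norm \<zeta> = R \<Longrightarrow> R > 0 \<Longrightarrow> cnj \<zeta> = of_real (R^2) / \<zeta>"
  using complex_norm_square[of \<zeta>] by (auto simp: field_simps)

text \<open>In the variable \<zeta> the kernel is singular at \<open>z\<close>, but on the circle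
  \<open>cnj \<zeta> = R^2 / \<zeta>\<close>, and conjugation turns it into the real part of
  \<open>(R^2 + cnj z \<zeta>) / (R^2 - cnj z \<zeta>)\<close>, whose only pole
  \<open>R^2 / cnj z\<close> lies outside the closed disc.\<close>

lemma circle_mean_poisson_kernel1:
  assumes "norm z < R"
  shows "circle_mean R (\<lambda>\<zeta>. poisson_kernel \<zeta> z) = 1"
proof -
  have R: "R > 0" using assms norm_ge_zero[of z] by linarith
  obtain R' where R': "R < R'" "norm z * R' < R^2"
  proof (cases "z = 0")
    case True
    then show ?thesis using that[of "R+1"] R by auto
  next
    case False
    then have "R < R^2 / norm z" using assms R
      by (simp add: field_simps power2_eq_square)
    then obtain R' where "R < R'" "R' < R^2 / norm z" using dense by blast
    then show ?thesis using that[of R'] False by (simp add: field_simps)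
  qed
  have nz: "of_real (R^2) - cnj z * \<zeta> \<noteq> 0" if "norm \<zeta> < R'" for \<zeta>
  proof
    assume "of_real (R^2) - cnj z * \<zeta> = 0"
    then have "norm (cnj z * \<zeta>) = R^2" by (metis eq_iff_diff_eq_0 norm_of_real abs_of_nonneg zero_le_power2)
    moreover have "norm (cnj z * \<zeta>) \<le> norm z * R'"
      using that by (simp add: norm_mult mult_left_mono)
    ultimately show False using R' by simp
  qed
  have "(\<lambda>\<zeta>. (of_real (R^2) + cnj z * \<zeta>) / (of_real (R^2) - cnj z * \<zeta>)) holomorphic_on ball 0 R'"
    by (intro holomorphic_intros) (use nz in auto)
  from circle_mean_Re_holomorphic[OF this R R'(1)]
  have "circle_mean R (\<lambda>\<zeta>. Re ((of_real (R^2) + cnj z * \<zeta>) / (of_real (R^2) - cnj z * \<zeta>))) = 1"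
    using R by simp
  moreover have "Re ((of_real (R^2) + cnj z * \<zeta>) / (of_real (R^2) - cnj z * \<zeta>)) = poisson_kernel \<zeta> z" if "norm \<zeta> = R" for \<zeta>
  proof -
    have z0: "\<zeta> \<noteq> 0" using that R by auto
    have "poisson_kernel \<zeta> z = Re (cnj ((\<zeta> + z) / (\<zeta> - z)))" by (simp only: poisson_kernel_def complex_cnj_cnj cnj.sel)
    also have "cnj ((\<zeta> + z) / (\<zeta> - z)) = (of_real (R^2) / \<zeta> + cnj z) / (of_real (R^2) / \<zeta> - cnj z)"
      by (simp add: conj_on_circle[OF that R])
    also have "of_real (R^2) / \<zeta> + cnj z = (of_real (R^2) + cnj z * \<zeta>) / \<zeta>"
      using z0 by (simp add: field_simps)
    also have "of_real (R^2) / \<zeta> - cnj z = (of_real (R^2) - cnj z * \<zeta>) / \<zeta>"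
      using z0 by (simp add: field_simps)
    finally show ?thesis using z0 by simp
  qed
  ultimately show ?thesis
    using circle_mean_cong[of R] R by (metis (no_types, lifting) less_imp_le)
qed

text \<open>The kernel splits as \<open>\<zeta>/(\<zeta>-z) + cnj z \<zeta>/(R\<^sup>2 - cnj z \<zeta>)\<close> on the circle, so after subtracting
  \<open>h z\<close> both parts are holomorphic and vanish at the centre.\<close>
lemma poisson_formula:
  assumes h: "h holomorphic_on ball 0 R'" and "R < R'" "norm z < R"
  shows "poisson R (\<lambda>\<zeta>. Re (h \<zeta>)) z = Re (h z)"
proof -
  have R: "R > 0" using assms norm_ge_zero[of z] by linarith
  \<comment> \<open>\<open>R1\<close> stays inside the domain of \<open>h\<close> and below
    \<open>R^2 / norm z\<close>, the modulus of the zero of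
    \<open>R^2 - cnj z * \<zeta>\<close>.\<close>
  obtain R1 where R1: "R < R1" "R1 < R'" "norm z * R1 < R^2"
  proof (cases "z = 0")
    case True
    obtain R1 where "R < R1" "R1 < R'" using dense assms(2) by blast
    then show ?thesis using that[of R1] R True by auto
  next
    case False
    then have "R < min R' (R^2 / norm z)" using assms R
      by (simp add: field_simps power2_eq_square)
    then obtain R1 where "R < R1" "R1 < min R' (R^2 / norm z)" using dense by blast
    then show ?thesis using that[of R1] False by (auto simp: field_simps)
  qed
  have hol: "h holomorphic_on ball 0 R1" using h by (rule holomorphic_on_subset) (use R1 in auto)
  have nz: "of_real (R^2) - cnj z * \<zeta> \<noteq> 0" if "norm \<zeta> < R1" for \<zeta>
  proof
    assume "of_real (R^2) - cnj z * \<zeta> = 0"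
    then have "norm (cnj z * \<zeta>) = R^2" by (metis eq_iff_diff_eq_0 norm_of_real abs_of_nonneg zero_le_power2)
    moreover have "norm (cnj z * \<zeta>) \<le> norm z * R1"
      using that by (simp add: norm_mult mult_left_mono)
    ultimately show False using R1 by simp
  qed
  \<comment> \<open>The difference quotient is holomorphic across \<open>z\<close>, with the
    derivative as its value there.\<close>
  define q where "q = (\<lambda>\<zeta>. if \<zeta> = z then deriv h z else (h \<zeta> - h z) / (\<zeta> - z))"
  have q: "q holomorphic_on ball 0 R1"
    unfolding q_def by (rule pole_lemma_open[OF hol]) auto
  have "(\<lambda>\<zeta>. q \<zeta> * \<zeta> + (h \<zeta> - h z) * (cnj z * \<zeta> / (of_real (R^2) - cnj z * \<zeta>))) holomorphic_on ball 0 R1"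
    by (intro holomorphic_intros q hol) (use nz in auto)
  from circle_mean_Re_holomorphic[OF this R R1(1)]
  have "circle_mean R (\<lambda>\<zeta>. Re (q \<zeta> * \<zeta> + (h \<zeta> - h z) * (cnj z * \<zeta> / (of_real (R^2) - cnj z * \<zeta>)))) = 0"
    by simp
  moreover have "Re (q \<zeta> * \<zeta> + (h \<zeta> - h z) * (cnj z * \<zeta> / (of_real (R^2) - cnj z * \<zeta>)))
      = (Re (h \<zeta>) - Re (h z)) * poisson_kernel \<zeta> z" if "norm \<zeta> = R" for \<zeta>
  proof -
    have z0: "\<zeta> \<noteq> 0" "\<zeta> \<noteq> z" using that R assms by auto
    have 1: "q \<zeta> * \<zeta> + (h \<zeta> - h z) * (cnj z * \<zeta> / (of_real (R^2) - cnj z * \<zeta>))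
       = (h \<zeta> - h z) * (\<zeta> / (\<zeta> - z) + cnj z * \<zeta> / (of_real (R^2) - cnj z * \<zeta>))"
      using z0 by (simp add: q_def algebra_simps)
    have 2: "cnj z * \<zeta> / (of_real (R^2) - cnj z * \<zeta>) = cnj (z / (\<zeta> - z))"
    proof -
      have "of_real (R^2) = \<zeta> * cnj \<zeta>" using that complex_norm_square[of \<zeta>] by simp
      then have "cnj z * \<zeta> / (of_real (R^2) - cnj z * \<zeta>) = (\<zeta> * cnj z) / (\<zeta> * (cnj \<zeta> - cnj z))"
        by (simp add: algebra_simps)
      also have "\<dots> = cnj z / (cnj \<zeta> - cnj z)" using z0 by simp
      finally show ?thesis by simp
    qed
    have 3: "\<zeta> / (\<zeta> - z) + cnj (z / (\<zeta> - z)) = of_real (poisson_kernel \<zeta> z)"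
    proof (rule complex_eqI)
      have a: "\<zeta> / (\<zeta> - z) = z / (\<zeta> - z) + 1" using z0 by (simp add: field_simps)
      have b: "(\<zeta> + z) / (\<zeta> - z) = \<zeta> / (\<zeta> - z) + z / (\<zeta> - z)" by (simp add: add_divide_distrib)
      show "Re (\<zeta> / (\<zeta> - z) + cnj (z / (\<zeta> - z))) = Re (of_real (poisson_kernel \<zeta> z))"
        unfolding poisson_kernel_def b by (simp del: complex_cnj_divide complex_cnj_diff)
      show "Im (\<zeta> / (\<zeta> - z) + cnj (z / (\<zeta> - z))) = Im (of_real (poisson_kernel \<zeta> z))"
        unfolding a by (simp del: complex_cnj_divide complex_cnj_diff)
    qed
    have "q \<zeta> * \<zeta> + (h \<zeta> - h z) * (cnj z * \<zeta> / (of_real (R^2) - cnj z * \<zeta>))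
       = (h \<zeta> - h z) * of_real (poisson_kernel \<zeta> z)"
      by (subst 1, subst 2, subst 3, rule refl)
    then show ?thesis by (simp only:) simp
  qed
  ultimately have 0: "circle_mean R (\<lambda>\<zeta>. (Re (h \<zeta>) - Re (h z)) * poisson_kernel \<zeta> z) = 0"
    using circle_mean_cong[of R] R by (metis (no_types, lifting) less_imp_le)
  have ch: "continuous_on (sphere 0 R) (\<lambda>\<zeta>. Re (h \<zeta>) * poisson_kernel \<zeta> z)"
    by (intro continuous_intros continuous_on_poisson_kernel assms holomorphic_on_imp_continuous_on holomorphic_on_subset[OF hol])
       (use R1 in auto)
  have "circle_mean R (\<lambda>\<zeta>. (Re (h \<zeta>) - Re (h z)) * poisson_kernel \<zeta> z)
      = circle_mean R (\<lambda>\<zeta>. Re (h \<zeta>) * poisson_kernel \<zeta> z) - circle_mean R (\<lambda>\<zeta>. Re (h z) * poisson_kernel \<zeta> z)"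
    unfolding left_diff_distrib using R
    by (intro circle_mean_diff ch continuous_intros continuous_on_poisson_kernel assms) auto
  also have "circle_mean R (\<lambda>\<zeta>. Re (h z) * poisson_kernel \<zeta> z) = Re (h z)"
    by (simp add: circle_mean_cmult circle_mean_poisson_kernel1 assms)
  finally show ?thesis using 0 by (simp add: poisson_def)
qed

lemma poisson_nonneg:
  assumes "R > 0" "norm z < R" "\<And>\<zeta>. norm \<zeta> = R \<Longrightarrow> u \<zeta> \<ge> 0"
  shows "poisson R u z \<ge> 0"
  unfolding poisson_def using assms by (intro circle_mean_nonneg mult_nonneg_nonneg poisson_kernel_nonneg) auto

lemma poisson_mono:
  assumes "R > 0" "norm z < R" "continuous_on (sphere 0 R) u" "continuous_on (sphere 0 R) v"
    "\<And>\<zeta>. norm \<zeta> = R \<Longrightarrow> u \<zeta> \<le> v \<zeta>"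
  shows "poisson R u z \<le> poisson R v z"
  unfolding poisson_def using assms
  by (intro circle_mean_mono mult_right_mono poisson_kernel_nonneg continuous_intros continuous_on_poisson_kernel) auto

lemma continuous_on_circle2:
  assumes "0 < r" "r < R" "continuous_on (sphere 0 R) u"
  shows "continuous_on (cbox (a, c) (b, d)) (\<lambda>(\<theta>, t). u (rcis R t) * poisson_kernel (rcis R t) (rcis r \<theta>))"
proof -
  have c: "continuous_on S (\<lambda>x. rcis q (g x))" if "continuous_on S g" for q :: real and S and g :: "real \<times> real \<Rightarrow> real"
    unfolding rcis_def cis_conv_exp by (intro continuous_intros that)
  have u: "continuous_on (cbox (a, c) (b, d)) (\<lambda>x. u (rcis R (snd x)))"
    by (rule continuous_on_compose2[OF assms(3) c]) (use assms in \<open>auto intro!: continuous_intros\<close>)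
  have "rcis R (snd x) - rcis r (fst x) \<noteq> 0" for x
  proof
    assume "rcis R (snd x) - rcis r (fst x) = 0"
    then have "norm (rcis R (snd x)) = norm (rcis r (fst x))" by simp
    then show False using assms by simp
  qed
  then show ?thesis
    unfolding case_prod_beta poisson_kernel_def by (intro continuous_intros c u) auto
qed

text \<open>Exchange the integrals and use that the kernel has mean one in \<open>z\<close>. This
  turns pointwise bounds by Poisson integrals on \<open>|z| = r\<close> into means over the circle
  of radius \<open>R\<close>.\<close>

lemma circle_mean_poisson:
  assumes "0 < r" "r < R" "continuous_on (sphere 0 R) u"
  shows "circle_mean r (poisson R u) = circle_mean R u"
proof -
  have "integral (cbox 0 (2*pi)) (\<lambda>\<theta>. integral (cbox 0 (2*pi)) (\<lambda>t. u (rcis R t) * poisson_kernel (rcis R t) (rcis r \<theta>)))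
      = integral (cbox 0 (2*pi)) (\<lambda>t. integral (cbox 0 (2*pi)) (\<lambda>\<theta>. u (rcis R t) * poisson_kernel (rcis R t) (rcis r \<theta>)))"
    by (intro integral_swap_continuous continuous_on_circle2 assms)
  also have "(\<lambda>t. integral (cbox 0 (2*pi)) (\<lambda>\<theta>. u (rcis R t) * poisson_kernel (rcis R t) (rcis r \<theta>))) 
      = (\<lambda>t. 2 * pi * u (rcis R t))"
  proof
    fix t
    have "circle_mean r (\<lambda>z. poisson_kernel (rcis R t) z) = 1" by (rule circle_mean_poisson_kernel) (use assms in auto)
    then show "integral (cbox 0 (2*pi)) (\<lambda>\<theta>. u (rcis R t) * poisson_kernel (rcis R t) (rcis r \<theta>)) = 2 * pi * u (rcis R t)"
      by (simp add: circle_mean_def)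
  qed
  finally show ?thesis
    by (simp add: circle_mean_def poisson_def)
qed

lemma abs_circle_mean_le:
  assumes "r \<ge> 0" "continuous_on (sphere 0 r) u"
  shows "\<bar>circle_mean r u\<bar> \<le> circle_mean r (\<lambda>z. \<bar>u z\<bar>)"
proof -
  have "circle_mean r u \<le> circle_mean r (\<lambda>z. \<bar>u z\<bar>)"
    by (intro circle_mean_mono continuous_intros assms) auto
  moreover have "circle_mean r (\<lambda>z. (-1) * u z) \<le> circle_mean r (\<lambda>z. \<bar>u z\<bar>)"
    by (intro circle_mean_mono continuous_intros assms) auto
  ultimately show ?thesis unfolding circle_mean_cmult by linarith
qed

text \<open>A Harnack-type bound: the difference is measured against the kernel itself rather than a
  constant, so averaging over \<open>z\<close> afterwards costs only the factor
  \<open>4 |c| / (R - r)\<close>. The kernels are real parts of quotients whose difference is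
  \<open>2 c \<zeta> / ((\<zeta> - z) (\<zeta> - z - c))\<close>.\<close>

lemma poisson_kernel_diff_le:
  assumes "norm z < norm \<zeta>" "2 * norm c \<le> norm \<zeta> - norm z"
  shows "\<bar>poisson_kernel \<zeta> (z + c) - poisson_kernel \<zeta> z\<bar> \<le> 4 * norm c / (norm \<zeta> - norm z) * poisson_kernel \<zeta> z"
proof -
  define R r where "R = norm \<zeta>" and "r = norm z"
  have Rr: "r < R" "0 \<le> r" using assms by (auto simp: R_def r_def)
  have d1: "norm (\<zeta> - z) \<ge> R - r" using norm_triangle_ineq2[of \<zeta> z] by (simp add: R_def r_def)
  have d0: "norm (\<zeta> - z) > 0" using d1 Rr by linarith
  \<comment> \<open>\<open>2 |c| <= R - r <= |\<zeta> - z|\<close>, so the shift at most halves the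
    distance.\<close>
  have d2: "norm (\<zeta> - (z + c)) \<ge> norm (\<zeta> - z) / 2"
    using norm_triangle_ineq2[of "\<zeta> - z" c] d1 assms(2) by (simp add: R_def r_def diff_diff_eq)
  have nz: "\<zeta> - z \<noteq> 0" "\<zeta> - (z + c) \<noteq> 0" using d0 d2 by auto
  have "poisson_kernel \<zeta> (z + c) - poisson_kernel \<zeta> z = Re ((\<zeta> + (z + c)) / (\<zeta> - (z + c)) - (\<zeta> + z) / (\<zeta> - z))"
    by (simp add: poisson_kernel_def)
  also have "(\<zeta> + (z + c)) / (\<zeta> - (z + c)) - (\<zeta> + z) / (\<zeta> - z) = 2 * c * \<zeta> / ((\<zeta> - z) * (\<zeta> - (z + c)))"
    using nz by (simp add: divide_simps) (simp add: algebra_simps)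
  finally have "\<bar>poisson_kernel \<zeta> (z + c) - poisson_kernel \<zeta> z\<bar> \<le> norm (2 * c * \<zeta> / ((\<zeta> - z) * (\<zeta> - (z + c))))"
    using abs_Re_le_cmod by metis
  also have "\<dots> = 2 * norm c * R / (norm (\<zeta> - z) * norm (\<zeta> - (z + c)))"
    by (simp add: norm_divide norm_mult R_def)
  also have "\<dots> \<le> 2 * norm c * R / (norm (\<zeta> - z) * (norm (\<zeta> - z) / 2))"
    using d0 d2 Rr by (intro divide_left_mono mult_left_mono mult_nonneg_nonneg mult_pos_pos) auto
  also have "\<dots> = 4 * norm c * R / norm (\<zeta> - z) ^ 2"
    by (simp add: power2_eq_square)
  also have "\<dots> \<le> 4 * norm c / (R - r) * ((R^2 - r^2) / norm (\<zeta> - z) ^ 2)"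
  proof -
    \<comment> \<open>Trades the numerator \<open>R\<close> for \<open>R^2 - r^2\<close>, the
      numerator of the Poisson kernel, at the price of \<open>1 / (R - r)\<close>.\<close>
    have "R * (R - r) \<le> R^2 - r^2"
      using Rr mult_right_mono[of r R r] by (simp add: algebra_simps power2_eq_square)
    then have "R \<le> (R^2 - r^2) / (R - r)" using Rr by (simp add: field_simps)
    then have "(4 * norm c / norm (\<zeta> - z) ^ 2) * R \<le> (4 * norm c / norm (\<zeta> - z) ^ 2) * ((R^2 - r^2) / (R - r))"
      by (intro mult_left_mono) auto
    then show ?thesis by (simp add: mult_ac)
  qed
  also have "(R^2 - r^2) / norm (\<zeta> - z) ^ 2 = poisson_kernel \<zeta> z"
    using nz by (subst poisson_kernel_eq) (auto simp: R_def r_def)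
  finally show ?thesis by (simp add: R_def r_def)
qed

lemma Re_diff_le_poisson:
  assumes h: "h holomorphic_on ball 0 R'" and "R < R'" "norm z < R" "2 * norm c \<le> R - norm z"
  shows "\<bar>Re (h (z + c)) - Re (h z)\<bar> \<le> 4 * norm c / (R - norm z) * poisson R (\<lambda>\<zeta>. \<bar>Re (h \<zeta>)\<bar>) z"
proof -
  have R: "R > 0" using assms norm_ge_zero[of z] by linarith
  have zc: "norm (z + c) < R" using assms norm_triangle_ineq[of z c] norm_ge_zero[of c]
    by (smt (verit))
  have ch: "continuous_on (sphere 0 R) h"
    by (intro holomorphic_on_imp_continuous_on holomorphic_on_subset[OF h]) (use assms in auto)
  have "Re (h (z + c)) - Re (h z) = circle_mean R (\<lambda>\<zeta>. Re (h \<zeta>) * poisson_kernel \<zeta> (z + c) - Re (h \<zeta>) * poisson_kernel \<zeta> z)"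
    using R poisson_formula[OF h assms(2) zc] poisson_formula[OF h assms(2,3)]
    by (subst circle_mean_diff)
      (simp_all add: poisson_def continuous_on_mult continuous_on_poisson_kernel zc assms ch continuous_on_Re)
  also have "\<bar>\<dots>\<bar> \<le> circle_mean R (\<lambda>\<zeta>. \<bar>Re (h \<zeta>) * poisson_kernel \<zeta> (z + c) - Re (h \<zeta>) * poisson_kernel \<zeta> z\<bar>)"
    using R by (intro abs_circle_mean_le continuous_intros ch continuous_on_poisson_kernel zc assms) auto
  also have "\<dots> \<le> circle_mean R (\<lambda>\<zeta>. 4 * norm c / (R - norm z) * (\<bar>Re (h \<zeta>)\<bar> * poisson_kernel \<zeta> z))"
  proof (rule circle_mean_mono)
    fix \<zeta> :: complex assume z: "norm \<zeta> = R"
    have "\<bar>Re (h \<zeta>)\<bar> * \<bar>poisson_kernel \<zeta> (z + c) - poisson_kernel \<zeta> z\<bar> \<le> \<bar>Re (h \<zeta>)\<bar> * (4 * norm c / (norm \<zeta> - norm z) * poisson_kernel \<zeta> z)"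
      by (intro mult_left_mono poisson_kernel_diff_le) (use z assms in auto)
    then show "\<bar>Re (h \<zeta>) * poisson_kernel \<zeta> (z + c) - Re (h \<zeta>) * poisson_kernel \<zeta> z\<bar> \<le> 4 * norm c / (R - norm z) * (\<bar>Re (h \<zeta>)\<bar> * poisson_kernel \<zeta> z)"
      using z by (simp add: abs_mult mult_ac flip: right_diff_distrib)
  qed (use R assms(3) in \<open>auto intro!: continuous_intros ch continuous_on_poisson_kernel zc\<close>)
  finally show ?thesis by (simp only: circle_mean_cmult poisson_def)
qed

text \<open>Let the shift in \<open>Re_diff_le_poisson\<close> tend to 0 along the direction in
  which \<open>Re h\<close> grows at the rate \<open>|h'|\<close>.\<close>

lemma norm_deriv_le_poisson:
  assumes h: "h holomorphic_on ball 0 R'" and "R < R'" "norm z < R"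
  shows "norm (deriv h z) \<le> 4 / (R - norm z) * poisson R (\<lambda>\<zeta>. \<bar>Re (h \<zeta>)\<bar>) z"
proof (cases "deriv h z = 0")
  case True
  have "R > 0" using assms norm_ge_zero[of z] by linarith
  then show ?thesis using True assms
    by (auto intro!: mult_nonneg_nonneg poisson_nonneg divide_nonneg_nonneg)
next
  case False
  define d where "d = deriv h z"
  \<comment> \<open>The unit vector with \<open>d * e = |d|\<close>.\<close>
  define e where "e = cnj d / of_real (norm d)"
  have e: "norm e = 1" "d * e = of_real (norm d)"
    using False complex_norm_square[of d] by (auto simp: e_def d_def norm_divide power2_eq_square field_simps)
  have "(h has_field_derivative d) (at z)"
    unfolding d_def by (rule holomorphic_derivI[OF h]) (use assms in auto)
  then have "(h has_field_derivative d) (at (z + of_real 0 * e))" by simp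
  then have "((\<lambda>t::real. h (z + of_real t * e)) has_vector_derivative (e * d)) (at 0)"
    by (rule field_vector_diff_chain_at[rotated, unfolded o_def])
       (auto intro!: derivative_eq_intros simp: has_vector_derivative_def scaleR_conv_of_real)
  then have "((\<lambda>t::real. Re (h (z + of_real t * e))) has_real_derivative Re (e * d)) (at 0)"
    by (metis has_vector_derivative_complex_iff)
  then have "(\<lambda>t. (Re (h (z + of_real t * e)) - Re (h z)) / t) \<midarrow>0\<rightarrow> norm d"
    using e(2) by (simp add: DERIV_def mult.commute)
  then have lim: "((\<lambda>t. (Re (h (z + of_real t * e)) - Re (h z)) / t) \<longlongrightarrow> norm d) (at_right 0)"
    by (rule filterlim_mono) (auto simp: at_within_le_at at_le)
  have "eventually (\<lambda>t. t \<in> {0<..<(R - norm z) / 2}) (at_right (0::real))"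
    by (intro eventually_at_right_real) (use assms in auto)
  then have "eventually (\<lambda>t. (Re (h (z + of_real t * e)) - Re (h z)) / t
      \<le> 4 / (R - norm z) * poisson R (\<lambda>\<zeta>. \<bar>Re (h \<zeta>)\<bar>) z) (at_right 0)"
  proof eventually_elim
    case (elim t)
    have "\<bar>Re (h (z + of_real t * e)) - Re (h z)\<bar> \<le> 4 * norm (of_real t * e) / (R - norm z) * poisson R (\<lambda>\<zeta>. \<bar>Re (h \<zeta>)\<bar>) z"
      by (rule Re_diff_le_poisson[OF h]) (use assms elim e in \<open>auto simp: norm_mult\<close>)
    also have "\<dots> = t * (4 / (R - norm z) * poisson R (\<lambda>\<zeta>. \<bar>Re (h \<zeta>)\<bar>) z)"
      using elim e by (simp add: norm_mult)
    finally have "Re (h (z + of_real t * e)) - Re (h z) \<le> t * (4 / (R - norm z) * poisson R (\<lambda>\<zeta>. \<bar>Re (h \<zeta>)\<bar>) z)"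
      by linarith
    then show ?case using elim by (simp only: pos_divide_le_eq greaterThanLessThan_iff mult.commute)
  qed
  then have "norm d \<le> 4 / (R - norm z) * poisson R (\<lambda>\<zeta>. \<bar>Re (h \<zeta>)\<bar>) z"
    by (rule tendsto_upperbound[OF lim]) auto
  then show ?thesis by (simp add: d_def)
qed

section \<open>Means of logarithmic kernels over a circle\<close>

lemma integral_periodic_shift:
  fixes u :: "real \<Rightarrow> real"
  assumes "continuous_on UNIV u" "\<And>x. u (x + p) = u x" "0 \<le> a" "a \<le> p"
  shows "integral {a - p..a} u = integral {0..p} u"
proof -
  have i: "u integrable_on {x..y}" for x y
    by (intro integrable_continuous_real continuous_on_subset[OF assms(1)]) auto
  have "integral {a - p..a} u = integral {a - p..0} u + integral {0..a} u"
    by (rule Henstock_Kurzweil_Integration.integral_combine[symmetric]) (use assms i in auto)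
  also have "integral {a - p..0} u = integral {a..p} (\<lambda>x. u (x - p))"
    using integral_shift_real_ivl[of "a - p" "-p" 0 u] by (simp add: algebra_simps)
  also have "(\<lambda>x. u (x - p)) = u" using assms(2)[of "x - p" for x] by (auto simp: fun_eq_iff)
  also have "integral {a..p} u + integral {0..a} u = integral {0..p} u"
    using Henstock_Kurzweil_Integration.integral_combine[of 0 a p u] assms i by simp
  finally show ?thesis .
qed

text \<open>The antiderivative \<open>(t + K) ln (t + K) - t ln t\<close> is continuous at 0
  although the integrand is unbounded near 0, so the fundamental theorem is applied with derivatives
  on the open interval only.\<close>

lemma has_integral_ln_one_plus:
  fixes K b :: real
  assumes "K > 0" "b > 0"
  shows "((\<lambda>t. ln (1 + K / t)) has_integral (b * ln (1 + K / b) + K * ln (1 + b / K))) {0..b}"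
proof -
  define G where "G = (\<lambda>t::real. (t + K) * ln (t + K) - t * ln t)"
  have "((\<lambda>t::real. t * ln t) \<longlongrightarrow> 0) (at_right 0)"
    by real_asymp
  then have "continuous (at_right 0) (\<lambda>t::real. t * ln t)"
    by (simp add: continuous_within)
  then have "continuous (at 0 within {0..b}) (\<lambda>t::real. t * ln t)"
    using assms by (simp add: at_within_Icc_at_right)
  moreover have "continuous (at x within {0..b}) (\<lambda>t::real. t * ln t)" if "x > 0" for x
    using that by (intro continuous_intros) auto
  ultimately have "continuous_on {0..b} (\<lambda>t::real. t * ln t)"
    unfolding continuous_on_eq_continuous_within by (metis atLeastAtMost_iff le_less)
  moreover have "continuous_on {0..b} (\<lambda>t::real. (t + K) * ln (t + K))"
    by (intro continuous_intros) (use assms in auto)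
  ultimately have c: "continuous_on {0..b} G"
    unfolding G_def by (intro continuous_on_diff)
  have "((\<lambda>t. ln (1 + K / t)) has_integral (G b - G 0)) {0..b}"
  proof (rule fundamental_theorem_of_calculus_interior[OF _ c])
    fix x assume x: "x \<in> {0<..<b}"
    have "(G has_real_derivative (ln (x + K) - ln x)) (at x)"
    proof -
      have "((\<lambda>t. (t + K) * ln (t + K)) has_real_derivative (ln (x + K) + 1)) (at x)"
        using x assms by (auto intro!: derivative_eq_intros)
      moreover have "((\<lambda>t. t * ln t) has_real_derivative (ln x + 1)) (at x)"
        using x assms by (auto intro!: derivative_eq_intros)
      ultimately have "(G has_real_derivative ((ln (x + K) + 1) - (ln x + 1))) (at x)"
        unfolding G_def by (rule DERIV_diff)
      then show ?thesis by simp
    qed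
    also have "ln (x + K) - ln x = ln (1 + K / x)"
      using ln_div[of "x + K" x] x assms by (simp add: add_divide_distrib)
    finally show "(G has_vector_derivative ln (1 + K / x)) (at x)"
      by (simp add: has_real_derivative_iff_has_vector_derivative)
  qed (use assms in auto)
  also have "G b - G 0 = b * (ln (b + K) - ln b) + K * (ln (b + K) - ln K)"
    by (simp add: G_def algebra_simps)
  also have "ln (b + K) - ln b = ln (1 + K / b)"
    using ln_div[of "b + K" b] assms by (simp add: add_divide_distrib)
  also have "ln (b + K) - ln K = ln (1 + b / K)"
    using ln_div[of "b + K" K] assms by (simp add: add_divide_distrib add.commute)
  finally show ?thesis .
qed

text \<open>The chord of the concave sine gives even \<open>2 t / pi\<close>; the factor is given up
  so that one linear bound serves both cases of \<open>dist_circle_ge\<close>.\<close>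

lemma sin_ge_linear:
  assumes "0 \<le> t" "t \<le> pi / 2"
  shows "t / pi \<le> sin t"
proof -
  have "concave_on {0..pi} sin"
    by (rule f''_le0_imp_concave[where f' = cos and f'' = "\<lambda>x. - sin x"])
       (auto intro!: derivative_eq_intros sin_ge_zero)
  then have "sin ((1 - 2 * t / pi) *\<^sub>R 0 + (2 * t / pi) *\<^sub>R (pi/2)) \<ge> (1 - 2 * t / pi) * sin 0 + (2 * t / pi) * sin (pi/2)"
    by (rule concave_onD) (use assms pi_gt_zero in \<open>auto simp: field_simps\<close>)
  then have "2 * t / pi \<le> sin t" by simp
  moreover have "t / pi \<le> 2 * t / pi" using assms by (simp add: divide_right_mono)
  ultimately show ?thesis by linarith
qed

text \<open>For angles up to \<open>pi / 2\<close> the imaginary part \<open>r sin t\<close> already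
  gives the bound. Beyond that \<open>cos t <= 0\<close>, so the point is at distance at least
  \<open>r\<close> from the nonnegative axis.\<close>

lemma dist_circle_ge:
  assumes "\<rho> \<ge> 0" "r > 0" "\<bar>t\<bar> \<le> pi"
  shows "r * \<bar>t\<bar> / pi \<le> norm (rcis r t - of_real \<rho>)"
proof (cases "\<bar>t\<bar> \<le> pi / 2")
  case True
  have "\<bar>t\<bar> / pi \<le> sin \<bar>t\<bar>" by (rule sin_ge_linear) (use True in auto)
  also have "\<dots> \<le> \<bar>sin t\<bar>" by (auto simp: abs_if)
  finally have "r * (\<bar>t\<bar> / pi) \<le> r * \<bar>sin t\<bar>"
    using assms by (intro mult_left_mono) auto
  also have "\<dots> = \<bar>Im (rcis r t - of_real \<rho>)\<bar>" using assms by (simp add: abs_mult)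
  also have "\<dots> \<le> norm (rcis r t - of_real \<rho>)" by (rule abs_Im_le_cmod)
  finally show ?thesis by simp
next
  case False
  have "cos t \<le> 0"
  proof -
    have "cos \<bar>t\<bar> \<le> cos (pi/2)" using False assms by (intro cos_monotone_0_pi_le) auto
    then show ?thesis by (simp add: abs_if split: if_splits)
  qed
  then have "2 * r * \<rho> * cos t \<le> 0"
    using assms(1,2) by (intro mult_nonneg_nonpos) auto
  then have "r^2 \<le> r^2 - 2 * r * \<rho> * cos t + \<rho>^2"
    using zero_le_power2[of \<rho>] by linarith
  also have "\<dots> = (r * cos t - \<rho>)^2 + (r * sin t)^2"
    using sin_cos_squared_add[of t] by algebra
  also have "\<dots> = norm (rcis r t - of_real \<rho>) ^ 2"
    by (simp add: cmod_power2)
  finally have "r^2 \<le> norm (rcis r t - of_real \<rho>) ^ 2" .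
  then have "r \<le> norm (rcis r t - of_real \<rho>)" by (rule power2_le_imp_le) simp
  moreover have "r * \<bar>t\<bar> / pi \<le> r" using assms by (simp add: field_simps)
  ultimately show ?thesis by linarith
qed

text \<open>The bound is uniform in \<open>w\<close>: rotating \<open>w\<close> to the nonnegative
  axis and using \<open>dist_circle_ge\<close> replaces \<open>|z - w|\<close> by
  \<open>r |t| / pi\<close>, and the resulting integral is explicit. The factor \<open>1 / r\<close>
  is essential, because the number of kernels to be summed is only known to be
  \<open>O(r T / gap)\<close>.\<close>

lemma circle_mean_ln_kernel_le:
  assumes "r > 0" "k > 0" "norm w \<noteq> r"
  shows "circle_mean r (\<lambda>z. ln (1 + k / norm (z - w))) \<le> k / r * (1 + ln (1 + r / k))"
proof -
  define u where "u = (\<lambda>\<theta>. ln (1 + k / norm (rcis r \<theta> - w)))"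
  define a where "a = Arg w"
  \<comment> \<open>With this \<open>K\<close> the integrand is at most
    \<open>ln (1 + K / |t|)\<close> at angle \<open>t\<close> from \<open>w\<close>.\<close>
  define K where "K = k * pi / r"
  have K: "K > 0" using assms by (simp add: K_def)
  have a: "- pi < a" "a \<le> pi" using Arg_bounded[of w] by (auto simp: a_def)
  have w: "w = rcis (norm w) a" by (simp add: a_def rcis_cmod_Arg)
  have ne: "norm (rcis r \<theta> - w) > 0" for \<theta>
    using assms complex_mod_rcis[of r \<theta>] by (auto simp del: complex_mod_rcis)
  have crcis: "continuous_on UNIV (\<lambda>\<theta>. rcis r \<theta>)"
    unfolding rcis_def cis_conv_exp by (intro continuous_intros)
  have arg: "1 + k / norm (rcis r \<theta> - w) > 0" for \<theta>
    using ne[of \<theta>] assms by (intro add_pos_nonneg) auto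
  have cu: "continuous_on UNIV u"
    unfolding u_def using ne arg by (intro continuous_intros crcis) (auto simp: less_imp_neq[THEN not_sym])
  have per: "u (x + 2 * pi) = u x" for x
    by (simp add: u_def rcis_def cis.ctr)
  have ui: "u integrable_on {x..y}" for x y
    by (intro integrable_continuous_real continuous_on_subset[OF cu]) auto
  define v where "v = (\<lambda>t. u (t + a))"
  have vi: "v integrable_on {x..y}" for x y
    unfolding v_def by (intro integrable_continuous_real continuous_on_compose2[OF cu] continuous_intros) auto
  have "integral {0..2*pi} u = integral {(a + pi) - 2 * pi..a + pi} u"
    by (rule integral_periodic_shift[symmetric]) (use cu per a in auto)
  also have "\<dots> = integral {-pi..pi} v"
    using integral_shift_real_ivl[of "a - pi" "a" "a + pi" u] by (simp add: v_def algebra_simps)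
  also have "\<dots> = integral {-pi..0} v + integral {0..pi} v"
    by (rule Henstock_Kurzweil_Integration.integral_combine[symmetric]) (use vi in auto)
  finally have split: "integral {0..2*pi} u = integral {-pi..0} v + integral {0..pi} v" .
  define I where "I = pi * ln (1 + K / pi) + K * ln (1 + pi / K)"
  have vb: "v t \<le> ln (1 + K / \<bar>t\<bar>)" if "\<bar>t\<bar> \<le> pi" "t \<noteq> 0" for t
  proof -
    have "rcis r (t + a) - w = cis a * (rcis r t - of_real (norm w))"
      by (subst w) (simp add: rcis_def algebra_simps flip: cis_mult)
    then have "norm (rcis r (t + a) - w) = norm (rcis r t - of_real (norm w))"
      by (simp add: norm_mult)
    then have "norm (rcis r (t + a) - w) \<ge> r * \<bar>t\<bar> / pi"
      using dist_circle_ge[of "norm w" r t] assms that by simp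
    then have "k / norm (rcis r (t + a) - w) \<le> k / (r * \<bar>t\<bar> / pi)"
      using that assms ne[of "t + a"] by (intro divide_left_mono mult_pos_pos) auto
    also have "\<dots> = K / \<bar>t\<bar>" by (simp add: K_def mult_ac)
    finally show ?thesis unfolding v_def u_def using arg[of "t + a"] by (intro ln_mono) auto
  qed
  \<comment> \<open>At \<open>t = 0\<close> division by zero turns the majorant into
    \<open>ln 1 = 0\<close>, so its value there is replaced; one point does not change the
    integral.\<close>
  have int0: "((\<lambda>t. if t = 0 then v 0 else ln (1 + K / t)) has_integral I) {0..pi}"
    unfolding I_def
    by (rule has_integral_spike_finite[OF _ _ has_integral_ln_one_plus[OF K pi_gt_zero], of "{0}"]) auto
  have "integral {0..pi} v \<le> I"
  proof (rule has_integral_le[OF integrable_integral[OF vi] int0])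
    show "v x \<le> (if x = 0 then v 0 else ln (1 + K / x))" if "x \<in> {0..pi}" for x
      using vb[of x] that by auto
  qed
  moreover have "integral {-pi..0} v \<le> I"
  proof -
    have "integral {-pi..0} v = integral {0..pi} (\<lambda>t. v (- t))"
      using Henstock_Kurzweil_Integration.integral_reflect_real[of pi 0 "\<lambda>t. v (-t)"] by simp
    also have "\<dots> \<le> I"
    proof (rule has_integral_le[OF integrable_integral int0])
      show "(\<lambda>t. v (- t)) integrable_on {0..pi}"
        unfolding v_def by (intro integrable_continuous_real continuous_on_compose2[OF cu] continuous_intros) auto
      show "v (- x) \<le> (if x = 0 then v 0 else ln (1 + K / x))" if "x \<in> {0..pi}" for x
        using vb[of "-x"] that by auto
    qed
    finally show ?thesis .
  qed
  ultimately have "integral {0..2*pi} u \<le> 2 * I" using split by linarith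
  moreover have "I \<le> K * (1 + ln (1 + pi / K))"
  proof -
    have "ln (1 + K / pi) \<le> K / pi" using K by (intro ln_add_one_self_le_self) auto
    then have "pi * ln (1 + K / pi) \<le> K" by (simp add: field_simps)
    then show ?thesis by (simp add: I_def algebra_simps)
  qed
  ultimately have "integral {0..2*pi} u / (2 * pi) \<le> 2 * (K * (1 + ln (1 + pi / K))) / (2 * pi)"
    by (intro divide_right_mono) auto
  also have "\<dots> = k / r * (1 + ln (1 + r / k))"
    using assms by (simp add: K_def field_simps)
  finally show ?thesis by (simp add: circle_mean_def u_def)
qed

subsection \<open>Meromorphic functions up to sparse sets\<close>

text \<open>On this class \<open>zorder\<close> is additive under products and quotients, and its
  sign detects poles and zeros.\<close>

definition nonzero_mero :: "(complex \<Rightarrow> complex) \<Rightarrow> bool" where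
  "nonzero_mero f \<longleftrightarrow> f meromorphic_on UNIV \<and> (\<forall>\<^sub>\<approx>z. f z \<noteq> 0)"

text \<open>Analyticity is required at the point itself, not up to a removable singularity, because
  values at exceptional points are arbitrary.\<close>

definition regular_at :: "(complex \<Rightarrow> complex) \<Rightarrow> complex \<Rightarrow> bool" where
  "regular_at f z \<longleftrightarrow> f analytic_on {z} \<and> f z \<noteq> 0"

definition circle_regular :: "(complex \<Rightarrow> complex) \<Rightarrow> real \<Rightarrow> bool" where
  "circle_regular f r \<longleftrightarrow> (\<forall>z. norm z = r \<longrightarrow> regular_at f z)"

lemma nonzero_mero_mero: "nonzero_mero f \<Longrightarrow> f meromorphic_on A"
  by (auto simp: nonzero_mero_def intro: meromorphic_on_subset)

lemma nonzero_mero_ev: "nonzero_mero f \<Longrightarrow> eventually (\<lambda>z. f z \<noteq> 0) (at a)"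
  unfolding nonzero_mero_def using eventually_cosparse_imp_eventually_at by blast

lemma nonzero_mero_fr: "nonzero_mero f \<Longrightarrow> frequently (\<lambda>z. f z \<noteq> 0) (at (a::complex))"
  by (simp add: eventually_frequently nonzero_mero_ev)

lemma nonzero_meroI: "f meromorphic_on UNIV \<Longrightarrow> \<not> (\<forall>\<^sub>\<approx>z. f z = 0) \<Longrightarrow> nonzero_mero f"
  using meromorphic_imp_constant_or_avoid[of f UNIV 0] by (auto simp: nonzero_mero_def)

lemma nonzero_mero_const: "k \<noteq> 0 \<Longrightarrow> nonzero_mero (\<lambda>_. k)"
  by (auto simp: nonzero_mero_def)

lemma nonzero_mero_mult: "nonzero_mero f \<Longrightarrow> nonzero_mero g \<Longrightarrow> nonzero_mero (\<lambda>z. f z * g z)"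
  unfolding nonzero_mero_def by (auto intro!: meromorphic_intros elim: eventually_elim2)

lemma nonzero_mero_inverse: "nonzero_mero f \<Longrightarrow> nonzero_mero (\<lambda>z. inverse (f z))"
  unfolding nonzero_mero_def by (auto intro!: meromorphic_intros)

lemma nonzero_mero_divide: "nonzero_mero f \<Longrightarrow> nonzero_mero g \<Longrightarrow> nonzero_mero (\<lambda>z. f z / g z)"
  unfolding divide_inverse by (intro nonzero_mero_mult nonzero_mero_inverse)

lemma nonzero_mero_powi: "nonzero_mero f \<Longrightarrow> nonzero_mero (\<lambda>z. f z powi k)"
  unfolding nonzero_mero_def by (intro conjI meromorphic_intros; elim conjE eventually_mono) auto

lemma nonzero_mero_power: "nonzero_mero f \<Longrightarrow> nonzero_mero (\<lambda>z. f z ^ k)"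
  using nonzero_mero_powi[of f "int k"] by simp

lemma nonzero_mero_prod: "(\<And>x. x \<in> A \<Longrightarrow> nonzero_mero (f x)) \<Longrightarrow> nonzero_mero (\<lambda>z. \<Prod>x\<in>A. f x z)"
  by (induction A rule: infinite_finite_induct) (auto intro: nonzero_mero_mult nonzero_mero_const)

lemma eventually_cosparse_shift:
  assumes "\<forall>\<^sub>\<approx>z::complex. P z"
  shows "\<forall>\<^sub>\<approx>z. P (z + c)"
proof -
  have *: "eventually P (at z)" for z
    using assms eventually_cosparse_imp_eventually_at by blast
  have "eventually (\<lambda>z. P (z + c)) (at z)" for z
    using *[of "z + c"] by (subst at_to_0, subst (asm) at_to_0) (simp add: eventually_filtermap add_ac)
  then show ?thesis
    by (simp add: eventually_cosparse_open_eq)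
qed

lemma nonzero_mero_shift: "nonzero_mero f \<Longrightarrow> nonzero_mero (\<lambda>z. f (z + c))"
  unfolding nonzero_mero_def
  by (auto intro!: eventually_cosparse_shift meromorphic_on_compose[of f UNIV] analytic_intros)

lemma zorder_shift_add: "zorder (\<lambda>z. f (z + c)) a = zorder f (a + c)"
  by (subst (1 2) zorder_shift) (simp add: add_ac)

lemma regular_at_zorder: "regular_at f a \<Longrightarrow> zorder f a = 0"
  unfolding regular_at_def by (auto intro: zorder_eq_0I)

lemma regular_at_cosparse: "nonzero_mero f \<Longrightarrow> \<forall>\<^sub>\<approx>z. regular_at f z"
  unfolding regular_at_def
  by (intro eventually_conj meromorphic_on_imp_analytic_cosparse) (auto simp: nonzero_mero_def)

lemma sparse_not_regular_at: "nonzero_mero f \<Longrightarrow> {z. \<not> regular_at f z} sparse_in UNIV"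
  using regular_at_cosparse[of f] by (simp add: eventually_cosparse)

lemma finite_not_regular_at: "nonzero_mero f \<Longrightarrow> finite (cball 0 R \<inter> {z. \<not> regular_at f z})"
  by (intro sparse_in_compact_finite sparse_in_subset[OF sparse_not_regular_at]) auto

text \<open>Exceptional points are sparse, so there are only countably many of them and of their
  moduli. Regular radii therefore exist in every interval.\<close>

lemma countable_bad_radii: "nonzero_mero f \<Longrightarrow> countable {r. \<not> circle_regular f r}"
proof -
  assume "nonzero_mero f"
  then have "countable (UNIV \<inter> {z. \<not> regular_at f z})"
    by (intro sparse_imp_countable sparse_not_regular_at) auto
  then have "countable (norm ` {z. \<not> regular_at f z})" by simp
  moreover have "{r. \<not> circle_regular f r} = norm ` {z. \<not> regular_at f z}" by (auto simp: circle_regular_def)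
  ultimately show ?thesis by simp
qed

lemma finite_zorder: "nonzero_mero f \<Longrightarrow> finite {a \<in> cball 0 R. zorder f a \<noteq> 0}"
  by (rule finite_subset[OF _ finite_not_regular_at[of f R]]) (auto simp: regular_at_zorder)

lemma is_pole_iff_zorder: "nonzero_mero f \<Longrightarrow> is_pole f a \<longleftrightarrow> zorder f a < 0"
  using isolated_pole_imp_neg_zorder[of f a] zorder_neg_imp_is_pole[of f a] nonzero_mero_ev[of f a]
    meromorphic_on_isolated_singularity[OF nonzero_mero_mero[of f "{a}"]] nonzero_mero_mero[of f "{a}"] by auto

lemma isolated_zero_iff_zorder: "nonzero_mero f \<Longrightarrow> isolated_zero f a \<longleftrightarrow> zorder f a > 0"
  using zorder_isolated_zero_pos'[of f a] zorder_pos_imp_isolated_zero[of f a] nonzero_mero_ev[of f a]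
    meromorphic_on_isolated_singularity[OF nonzero_mero_mero[of f "{a}"]] nonzero_mero_mero[of f "{a}"] by auto

lemma nonzero_mero_zorder_mult: "nonzero_mero f \<Longrightarrow> nonzero_mero g \<Longrightarrow> zorder (\<lambda>z. f z * g z) a = zorder f a + zorder g a"
  by (intro zorder_mult nonzero_mero_mero nonzero_mero_fr)

lemma nonzero_mero_zorder_divide: "nonzero_mero f \<Longrightarrow> nonzero_mero g \<Longrightarrow> zorder (\<lambda>z. f z / g z) a = zorder f a - zorder g a"
  by (intro zorder_divide nonzero_mero_mero nonzero_mero_fr)

lemma nonzero_mero_zorder_inverse: "nonzero_mero f \<Longrightarrow> zorder (\<lambda>z. inverse (f z)) a = - zorder f a"
  using nonzero_mero_zorder_divide[OF nonzero_mero_const[of 1], of f a] by (simp add: divide_inverse)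

lemma nonzero_mero_zorder_powi: "nonzero_mero f \<Longrightarrow> zorder (\<lambda>z. f z powi k) a = k * zorder f a"
  by (intro zorder_power_int nonzero_mero_mero nonzero_mero_fr)

lemma nonzero_mero_zorder_power: "nonzero_mero f \<Longrightarrow> zorder (\<lambda>z. f z ^ k) a = int k * zorder f a"
  by (intro zorder_power nonzero_mero_mero nonzero_mero_fr)

lemma nonzero_mero_zorder_prod:
  assumes "\<And>x. x \<in> A \<Longrightarrow> nonzero_mero (f x)"
  shows "zorder (\<lambda>z. \<Prod>x\<in>A. f x z) a = (\<Sum>x\<in>A. zorder (f x) a)"
  by (intro zorder_prod nonzero_mero_mero nonzero_mero_ev nonzero_mero_prod assms)

lemma circle_regular_mult: "circle_regular f r \<Longrightarrow> circle_regular g r \<Longrightarrow> circle_regular (\<lambda>z. f z * g z) r"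
  by (auto simp: circle_regular_def regular_at_def intro!: analytic_intros)

lemma circle_regular_inverse: "circle_regular f r \<Longrightarrow> circle_regular (\<lambda>z. inverse (f z)) r"
  by (auto simp: circle_regular_def regular_at_def intro!: analytic_intros)

lemma continuous_circle_regular: "circle_regular f r \<Longrightarrow> continuous_on (sphere 0 r) f"
  unfolding circle_regular_def regular_at_def
  by (intro continuous_at_imp_continuous_on ballI analytic_at_imp_isCont) auto

lemma continuous_ln_circle_regular: "circle_regular f r \<Longrightarrow> continuous_on (sphere 0 r) (\<lambda>z. ln (norm (f z)))"
  by (intro continuous_intros continuous_circle_regular) (auto simp: circle_regular_def regular_at_def)

section \<open>The truncated logarithm\<close>

lemma continuous_log_plus: "continuous_on A g \<Longrightarrow> continuous_on A (\<lambda>z. log_plus (g z))"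
  unfolding log_plus_def by (intro continuous_intros) auto

lemma continuous_log_plus_circle_regular: "circle_regular f r \<Longrightarrow> continuous_on (sphere 0 r) (\<lambda>z. log_plus (norm (f z)))"
  by (intro continuous_intros continuous_log_plus continuous_circle_regular)

lemma log_plus_nonneg: "log_plus x \<ge> 0"
  by (simp add: log_plus_def)

lemma log_plus_eq: "x > 0 \<Longrightarrow> log_plus x = max 0 (ln x)"
  by (auto simp: log_plus_def max_def)

lemma ln_le_log_plus: "x > 0 \<Longrightarrow> ln x \<le> log_plus x"
  by (simp add: log_plus_eq)

lemma log_plus_mono: "x \<le> y \<Longrightarrow> log_plus x \<le> log_plus y"
  unfolding log_plus_def by (intro ln_mono) auto

lemma log_plus_diff_inverse: "x > 0 \<Longrightarrow> log_plus x - log_plus (inverse x) = ln x"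
  by (auto simp: log_plus_eq ln_inverse)

lemma log_plus_sum_inverse: "x > 0 \<Longrightarrow> log_plus x + log_plus (inverse x) = \<bar>ln x\<bar>"
  by (auto simp: log_plus_eq ln_inverse)

lemma log_plus_mult_le:
  assumes "x \<ge> 0" "y \<ge> 0"
  shows "log_plus (x * y) \<le> log_plus x + log_plus y"
proof -
  have "max 1 (x * y) \<le> max 1 x * max 1 y"
  proof -
    have "1 * 1 \<le> max 1 x * max 1 y" by (intro mult_mono) auto
    moreover have "x * y \<le> max 1 x * max 1 y" using assms by (intro mult_mono) auto
    ultimately show ?thesis by simp
  qed
  then have "ln (max 1 (x * y)) \<le> ln (max 1 x * max 1 y)" by (intro ln_mono) auto
  also have "\<dots> = ln (max 1 x) + ln (max 1 y)" by (intro ln_mult_pos) auto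
  finally show ?thesis by (simp add: log_plus_def)
qed

lemma log_plus_power: "x \<ge> 0 \<Longrightarrow> log_plus (x ^ k) = real k * log_plus x"
proof -
  assume x: "x \<ge> 0"
  have "max 1 (x ^ k) = max 1 x ^ k"
  proof (cases "x \<le> 1")
    case True
    then show ?thesis using power_le_one[of x k] x by (simp add: max_def)
  next
    case False
    then show ?thesis using one_le_power[of x k] by (simp add: max_def)
  qed
  then show ?thesis by (simp add: log_plus_def ln_realpow)
qed

lemma log_plus_prod_le:
  "(\<And>a. a \<in> A \<Longrightarrow> x a \<ge> 0) \<Longrightarrow> log_plus (\<Prod>a\<in>A. x a) \<le> (\<Sum>a\<in>A. log_plus (x a))"
proof (induction A rule: infinite_finite_induct)
  case (insert a A)
  have "log_plus (x a * (\<Prod>a\<in>A. x a)) \<le> log_plus (x a) + log_plus (\<Prod>a\<in>A. x a)"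
    by (intro log_plus_mult_le prod_nonneg) (use insert in auto)
  then show ?case using insert by fastforce
qed (auto simp: log_plus_def)

lemma log_plus_le_ln_one_plus: "x \<ge> 0 \<Longrightarrow> log_plus x \<le> ln (1 + x)"
  unfolding log_plus_def by (intro ln_mono) auto

text \<open>On nonnegative arguments \<open>ln (1 + x)\<close> is subadditive without an additive
  constant, unlike \<open>log_plus\<close>; this matters because the number of summands is
  unbounded.\<close>

lemma ln_one_plus_sum_le:
  "finite A \<Longrightarrow> (\<And>a. a \<in> A \<Longrightarrow> x a \<ge> 0) \<Longrightarrow> ln (1 + (\<Sum>a\<in>A. x a)) \<le> (\<Sum>a\<in>A. ln (1 + x a :: real))"
proof (induction A rule: finite_induct)
  case (insert a A)
  have s: "(\<Sum>a\<in>A. x a) \<ge> 0" using insert by (intro sum_nonneg) auto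
  have "1 + (x a + (\<Sum>a\<in>A. x a)) \<le> (1 + x a) * (1 + (\<Sum>a\<in>A. x a))"
    using insert.prems[of a] s by (simp add: algebra_simps)
  then have "ln (1 + (x a + (\<Sum>a\<in>A. x a))) \<le> ln ((1 + x a) * (1 + (\<Sum>a\<in>A. x a)))"
    using insert.prems[of a] s by (intro ln_mono) auto
  also have "\<dots> = ln (1 + x a) + ln (1 + (\<Sum>a\<in>A. x a))"
    using insert.prems[of a] s by (intro ln_mult_pos) auto
  finally show ?case using insert by fastforce
qed auto

lemma log_plus_add_le:
  assumes "x \<ge> 0" "y \<ge> 0"
  shows "log_plus (x + y) \<le> log_plus x + log_plus y + ln 2"
proof -
  have "log_plus (x + y) \<le> log_plus (2 * (max x y))" using assms by (intro log_plus_mono) auto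
  also have "\<dots> \<le> log_plus 2 + log_plus (max x y)" by (intro log_plus_mult_le) (use assms in auto)
  also have "log_plus (max x y) \<le> log_plus x + log_plus y"
    using log_plus_nonneg[of x] log_plus_nonneg[of y] by (cases "x \<le> y") (auto simp: max_def)
  finally show ?thesis by (simp add: log_plus_def)
qed

subsection \<open>Counting functions and Blaschke factorization\<close>

text \<open>\<open>ln (r / 0) = ln 0\<close> would be junk, hence the case distinction: a point at the origin is
  counted with \<open>ln r\<close>, as in \<^const>\<open>integrated_count\<close>.\<close>
definition log_weight :: "real \<Rightarrow> complex \<Rightarrow> real" where
  "log_weight r a = (if a = 0 then ln r else max 0 (ln (r / norm a)))"

definition supp_in :: "(complex \<Rightarrow> real) \<Rightarrow> real \<Rightarrow> complex set" where
  "supp_in D r = {a \<in> cball 0 r. D a \<noteq> 0}"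

text \<open>Integrated counting function of a divisor with real weights, with
  \<open>n(t) / t\<close> integrated term by term. It is linear and, for radii from 1 on, monotone
  in \<open>D\<close>, so inequalities between counting functions reduce to pointwise inequalities
  between divisors.\<close>

definition log_count :: "(complex \<Rightarrow> real) \<Rightarrow> real \<Rightarrow> real" where
  "log_count D r = (\<Sum>a\<in>supp_in D r. D a * log_weight r a)"

definition locally_finite_supp :: "(complex \<Rightarrow> real) \<Rightarrow> bool" where
  "locally_finite_supp D \<longleftrightarrow> (\<forall>r. finite (supp_in D r))"

lemma log_weight_nonneg: "r \<ge> 1 \<Longrightarrow> log_weight r a \<ge> 0"
  by (auto simp: log_weight_def)

lemma log_weight_outside: "r > 0 \<Longrightarrow> norm a \<ge> r \<Longrightarrow> log_weight r a = 0"
  by (auto simp: log_weight_def)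

lemma log_weight_le_ln:
  assumes "r \<ge> 1"
  shows "log_weight r a \<le> (1 + \<bar>ln (norm a)\<bar>) * (1 + ln r)"
proof (cases "a = 0")
  case False
  have lr: "ln r \<ge> 0" using assms by simp
  have "log_weight r a \<le> ln r + \<bar>ln (norm a)\<bar>" using False assms lr by (auto simp: log_weight_def ln_div)
  also have "\<dots> \<le> (1 + \<bar>ln (norm a)\<bar>) * (1 + ln r)"
    using lr by (simp add: algebra_simps)
  finally show ?thesis .
qed (use assms in \<open>simp add: log_weight_def\<close>)

lemma log_weight_mono: "0 < r \<Longrightarrow> r \<le> r' \<Longrightarrow> log_weight r a \<le> log_weight r' a"
  by (auto simp: log_weight_def intro!: divide_right_mono max.coboundedI2)

text \<open>Points outside the disc have weight zero, so counting functions of different divisors or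
  at different radii can be summed over one index set.\<close>

lemma log_count_superset:
  assumes "r > 0" "finite X" "supp_in D r \<subseteq> X"
  shows "log_count D r = (\<Sum>a\<in>X. D a * log_weight r a)"
  unfolding log_count_def using assms
  by (intro sum.mono_neutral_left) (auto simp: supp_in_def, meson linear log_weight_outside)

lemma locally_finite_supp_add: "locally_finite_supp D \<Longrightarrow> locally_finite_supp D' \<Longrightarrow> locally_finite_supp (\<lambda>a. D a + D' a)"
  unfolding locally_finite_supp_def
  by (intro allI, rule finite_subset[of _ "supp_in D r \<union> supp_in D' r" for r]) (auto simp: supp_in_def)

lemma locally_finite_supp_subset: "locally_finite_supp D \<Longrightarrow> (\<And>a. D a = 0 \<Longrightarrow> D' a = 0) \<Longrightarrow> locally_finite_supp D'"
  unfolding locally_finite_supp_def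
  by (intro allI, rule finite_subset[of _ "supp_in D r" for r]) (auto simp: supp_in_def)

lemma locally_finite_supp_cmult: "locally_finite_supp D \<Longrightarrow> locally_finite_supp (\<lambda>a. k * D a)"
  by (erule locally_finite_supp_subset) auto

lemma locally_finite_supp_sum: "finite A \<Longrightarrow> (\<And>x. x \<in> A \<Longrightarrow> locally_finite_supp (D x)) \<Longrightarrow> locally_finite_supp (\<lambda>a. \<Sum>x\<in>A. D x a)"
proof (induction A rule: finite_induct)
  case empty
  then show ?case by (auto simp: locally_finite_supp_def supp_in_def)
next
  case (insert x A)
  then show ?case using locally_finite_supp_add[of "D x" "\<lambda>a. \<Sum>x\<in>A. D x a"] by auto
qed

lemma locally_finite_supp_zorder: "nonzero_mero f \<Longrightarrow> locally_finite_supp (\<lambda>a. real_of_int (zorder f a))"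
  using finite_zorder[of f] by (auto simp: locally_finite_supp_def supp_in_def)

lemma log_count_add:
  assumes "r > 0" "locally_finite_supp D" "locally_finite_supp D'"
  shows "log_count (\<lambda>a. D a + D' a) r = log_count D r + log_count D' r"
proof -
  let ?X = "supp_in D r \<union> supp_in D' r"
  have X: "finite ?X" using assms by (auto simp: locally_finite_supp_def)
  have "log_count (\<lambda>a. D a + D' a) r = (\<Sum>a\<in>?X. (D a + D' a) * log_weight r a)"
    by (rule log_count_superset[OF assms(1) X]) (auto simp: supp_in_def)
  also have "\<dots> = (\<Sum>a\<in>?X. D a * log_weight r a) + (\<Sum>a\<in>?X. D' a * log_weight r a)"
    by (simp add: algebra_simps sum.distrib)
  also have "\<dots> = log_count D r + log_count D' r"
    using log_count_superset[OF assms(1) X, of D] log_count_superset[OF assms(1) X, of D'] by simp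
  finally show ?thesis .
qed

lemma log_count_cmult: "r > 0 \<Longrightarrow> locally_finite_supp D \<Longrightarrow> log_count (\<lambda>a. k * D a) r = k * log_count D r"
  using log_count_superset[of r "supp_in D r" "\<lambda>a. k * D a"]
  by (auto simp: log_count_def sum_distrib_left mult_ac supp_in_def locally_finite_supp_def)

lemma log_count_sum:
  assumes "r > 0" "finite A" "\<And>x. x \<in> A \<Longrightarrow> locally_finite_supp (D x)"
  shows "log_count (\<lambda>a. \<Sum>x\<in>A. D x a) r = (\<Sum>x\<in>A. log_count (D x) r)"
  using assms(2,3)
proof (induction A rule: finite_induct)
  case empty
  then show ?case by (simp add: log_count_def)
next
  case (insert x A)
  then show ?case
    using log_count_add[OF assms(1), of "D x" "\<lambda>a. \<Sum>x\<in>A. D x a"] locally_finite_supp_sum[of A D] by auto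
qed

text \<open>The radius is at least 1 because a point at the origin has weight \<open>ln r\<close>,
  which is negative below 1.\<close>

lemma log_count_mono:
  assumes "r \<ge> 1" "locally_finite_supp D" "locally_finite_supp D'" "\<And>a. D a \<le> D' a"
  shows "log_count D r \<le> log_count D' r"
proof -
  let ?X = "supp_in D r \<union> supp_in D' r"
  have X: "finite ?X" using assms by (auto simp: locally_finite_supp_def)
  have "log_count D r = (\<Sum>a\<in>?X. D a * log_weight r a)" by (rule log_count_superset[OF _ X]) (use assms in auto)
  also have "\<dots> \<le> (\<Sum>a\<in>?X. D' a * log_weight r a)"
    by (intro sum_mono mult_right_mono assms log_weight_nonneg)
  also have "\<dots> = log_count D' r" by (rule log_count_superset[OF _ X, symmetric]) (use assms in auto)
  finally show ?thesis .
qed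

lemma log_count_nonneg: "r \<ge> 1 \<Longrightarrow> (\<And>a. D a \<ge> 0) \<Longrightarrow> log_count D r \<ge> 0"
  unfolding log_count_def by (intro sum_nonneg mult_nonneg_nonneg log_weight_nonneg) auto

lemma has_integral_step_over_id:
  fixes p r :: real
  assumes "0 < p" "0 < r"
  shows "((\<lambda>t. (if p \<le> t then 1 else 0) / t) has_integral max 0 (ln (r / p))) {0..r}"
proof (cases "p \<le> r")
  case False
  then have "max 0 (ln (r / p)) = 0" using assms by (simp add: max_def)
  moreover have "((\<lambda>t. (if p \<le> t then 1 else 0) / t) has_integral 0) {0..r}"
    by (rule has_integral_is_0) (use False assms in auto)
  ultimately show ?thesis by simp
next
  case True
  have "((\<lambda>t. 1 / t) has_integral (ln r - ln p)) {p..r}"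
  proof (rule fundamental_theorem_of_calculus[OF True])
    fix x assume "x \<in> {p..r}"
    then have "(ln has_real_derivative 1 / x) (at x within {p..r})"
      using assms by (intro DERIV_subset[OF DERIV_ln_divide]) auto
    then show "(ln has_vector_derivative 1 / x) (at x within {p..r})"
      by (simp add: has_real_derivative_iff_has_vector_derivative)
  qed
  then have "((\<lambda>t. if t \<in> {p..r} then 1 / t else 0) has_integral (ln r - ln p)) {0..r}"
    by (subst has_integral_restrict) (use assms in auto)
  moreover have "ln r - ln p = max 0 (ln (r / p))"
    using True assms by (simp add: ln_div)
  ultimately show ?thesis
    by (auto elim: has_integral_eq[rotated])
qed

text \<open>Each point \<open>a\<close> other than the origin contributes a step of
  \<open>n(t)\<close> at \<open>t = |a|\<close>, whose integral against \<open>1 / t\<close> is its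
  weight; the origin is what \<open>n(0)\<close> counts.\<close>

lemma integrated_count_eq_log_count:
  assumes "r > 0" "locally_finite_supp D"
  shows "integrated_count (\<lambda>t. \<Sum>a\<in>supp_in D t. D a) r = log_count D r"
proof -
  let ?S = "supp_in D r"
  have fin: "finite ?S" using assms by (simp add: locally_finite_supp_def)
  have n0: "(\<Sum>a\<in>supp_in D 0. D a) = D 0" 
    by (cases "D 0 = 0") (auto simp: supp_in_def intro!: sum.neutral, subst sum.cong[of _ "{0}"], auto)
  have "((\<lambda>t. \<Sum>a\<in>?S - {0}. D a * ((if norm a \<le> t then 1 else 0) / t)) has_integral
      (\<Sum>a\<in>?S - {0}. D a * max 0 (ln (r / norm a)))) {0..r}"
    by (intro has_integral_sum has_integral_mult_right has_integral_step_over_id) (use fin assms in auto)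
  moreover have "(\<Sum>a\<in>?S - {0}. D a * ((if norm a \<le> t then 1 else 0) / t)) = ((\<Sum>a\<in>supp_in D t. D a) - D 0) / t"
    if t: "t \<in> {0..r}" for t
  proof -
    have fint: "finite (supp_in D t)" using assms by (simp add: locally_finite_supp_def)
    have "(\<Sum>a\<in>supp_in D t. D a) = (\<Sum>a\<in>insert 0 (supp_in D t). D a)"
      using fint by (intro sum.mono_neutral_left) (use t in \<open>auto simp: supp_in_def\<close>)
    also have "\<dots> = D 0 + (\<Sum>a\<in>supp_in D t - {0}. D a)"
      using fint by (subst sum.insert_remove) auto
    also have "(\<Sum>a\<in>supp_in D t - {0}. D a) = (\<Sum>a\<in>?S - {0}. if norm a \<le> t then D a else 0)"
      by (subst sum.inter_filter[symmetric]) (use fin t in \<open>auto simp: supp_in_def intro!: sum.cong\<close>)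
    finally have "((\<Sum>a\<in>supp_in D t. D a) - D 0) / t = (\<Sum>a\<in>?S - {0}. (if norm a \<le> t then D a else 0) / t)"
      by (simp add: sum_divide_distrib)
    also have "\<dots> = (\<Sum>a\<in>?S - {0}. D a * ((if norm a \<le> t then 1 else 0) / t))"
      by (intro sum.cong) auto
    finally show ?thesis by simp
  qed
  ultimately have "((\<lambda>t. ((\<Sum>a\<in>supp_in D t. D a) - D 0) / t) has_integral
      (\<Sum>a\<in>?S - {0}. D a * max 0 (ln (r / norm a)))) {0..r}"
    by (metis (no_types, lifting) has_integral_cong)
  then have "integrated_count (\<lambda>t. \<Sum>a\<in>supp_in D t. D a) r
      = (\<Sum>a\<in>?S - {0}. D a * max 0 (ln (r / norm a))) + D 0 * ln r"
    unfolding integrated_count_def n0 by (simp add: integral_unique)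
  also have "\<dots> = (\<Sum>a\<in>insert 0 ?S. D a * log_weight r a)"
    using fin by (subst sum.insert_remove) (auto simp: log_weight_def intro!: sum.cong)
  also have "\<dots> = log_count D r"
    by (rule log_count_superset[symmetric]) (use assms fin in auto)
  finally show ?thesis .
qed

section \<open>Divisors of zeros and poles and the Nevanlinna functions\<close>

definition pole_ord :: "(complex \<Rightarrow> complex) \<Rightarrow> complex \<Rightarrow> real" where
  "pole_ord f a = max 0 (- real_of_int (zorder f a))"

definition zero_ord :: "(complex \<Rightarrow> complex) \<Rightarrow> complex \<Rightarrow> real" where
  "zero_ord f a = max 0 (real_of_int (zorder f a))"

definition pole_ind :: "(complex \<Rightarrow> complex) \<Rightarrow> complex \<Rightarrow> real" where
  "pole_ind f a = (if zorder f a < 0 then 1 else 0)"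

lemma locally_finite_supp_pole_ord: "nonzero_mero f \<Longrightarrow> locally_finite_supp (pole_ord f)"
  by (rule locally_finite_supp_subset[OF locally_finite_supp_zorder]) (auto simp: pole_ord_def)

lemma locally_finite_supp_zero_ord: "nonzero_mero f \<Longrightarrow> locally_finite_supp (zero_ord f)"
  by (rule locally_finite_supp_subset[OF locally_finite_supp_zorder]) (auto simp: zero_ord_def)

lemma locally_finite_supp_pole_ind: "nonzero_mero f \<Longrightarrow> locally_finite_supp (pole_ind f)"
  by (rule locally_finite_supp_subset[OF locally_finite_supp_zorder]) (auto simp: pole_ind_def)

lemma pole_ind_le_pole_ord: "pole_ind f a \<le> pole_ord f a"
  by (auto simp: pole_ind_def pole_ord_def)

lemma pole_ord_inverse: "nonzero_mero f \<Longrightarrow> pole_ord (\<lambda>z. inverse (f z)) = zero_ord f"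
  by (auto simp: fun_eq_iff pole_ord_def zero_ord_def nonzero_mero_zorder_inverse)

lemma nev_N_eq:
  assumes "nonzero_mero f" "r > 0"
  shows "nev_N r f = log_count (pole_ord f) r"
proof -
  have "pole_count f = (\<lambda>t. \<Sum>a\<in>supp_in (pole_ord f) t. pole_ord f a)"
    unfolding pole_count_def
    by (intro ext sum.cong)
       (auto simp: poles_in_disc_def supp_in_def pole_ord_def is_pole_iff_zorder[OF assms(1)])
  then show ?thesis
    unfolding nev_N_def using integrated_count_eq_log_count[OF assms(2) locally_finite_supp_pole_ord[OF assms(1)]] by simp
qed

lemma nev_Nbar_eq:
  assumes "nonzero_mero f" "r > 0"
  shows "nev_Nbar r f = log_count (pole_ind f) r"
proof -
  have "pole_count_distinct f = (\<lambda>t. \<Sum>a\<in>supp_in (pole_ind f) t. pole_ind f a)"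
  proof
    fix t
    have "poles_in_disc f t = supp_in (pole_ind f) t"
      by (auto simp: poles_in_disc_def supp_in_def pole_ind_def is_pole_iff_zorder[OF assms(1)])
    moreover have "(\<Sum>a\<in>supp_in (pole_ind f) t. pole_ind f a) = (\<Sum>a\<in>supp_in (pole_ind f) t. 1)"
      by (intro sum.cong) (auto simp: supp_in_def pole_ind_def split: if_splits)
    ultimately show "pole_count_distinct f t = (\<Sum>a\<in>supp_in (pole_ind f) t. pole_ind f a)"
      by (simp add: pole_count_distinct_def)
  qed
  then show ?thesis
    unfolding nev_Nbar_def using integrated_count_eq_log_count[OF assms(2) locally_finite_supp_pole_ind[OF assms(1)]] by simp
qed

lemma nev_m_eq: "nev_m r f = circle_mean r (\<lambda>z. log_plus (norm (f z)))"
  by (simp add: nev_m_def circle_mean_def)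

lemma nev_m_nonneg: "r \<ge> 0 \<Longrightarrow> nev_m r f \<ge> 0"
  unfolding nev_m_eq by (intro circle_mean_nonneg log_plus_nonneg)

text \<open>Unimodular on the circle of radius \<open>R\<close>, with a simple zero at
  \<open>a\<close> and, for nonzero \<open>a\<close>, a pole only at the reflected point
  \<open>R^2 / cnj a\<close> outside the disc.\<close>

definition blaschke_factor :: "real \<Rightarrow> complex \<Rightarrow> complex \<Rightarrow> complex" where
  "blaschke_factor R a z = of_real R * (z - a) / (of_real (R^2) - cnj a * z)"

lemma blaschke_factor_denom:
  assumes "norm a * norm z < R^2"
  shows "of_real (R^2) - cnj a * z \<noteq> 0"
proof
  assume "of_real (R^2) - cnj a * z = 0"
  then have "norm (cnj a * z) = norm (of_real (R^2) :: complex)" by simp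
  also have "\<dots> = R^2" by (simp add: norm_power)
  finally show False using assms by (simp add: norm_mult)
qed

lemma nonzero_mero_blaschke_factor:
  assumes "R > 0" "norm a < R"
  shows "nonzero_mero (blaschke_factor R a)"
proof (rule nonzero_meroI)
  show m: "blaschke_factor R a meromorphic_on UNIV" unfolding blaschke_factor_def by (intro meromorphic_intros)
  show "\<not> (\<forall>\<^sub>\<approx>z. blaschke_factor R a z = 0)"
  proof
    assume "\<forall>\<^sub>\<approx>z. blaschke_factor R a z = 0"
    then have "eventually (\<lambda>z. blaschke_factor R a z = 0) (at a)"
      using eventually_cosparse_imp_eventually_at by blast
    moreover have "eventually (\<lambda>z. z \<in> ball 0 R - {a}) (at a)"
      by (rule eventually_at_in_open) (use assms in auto)
    ultimately have "eventually (\<lambda>z. False) (at a)"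
    proof eventually_elim
      case (elim z)
      have "norm a * norm z < R^2" unfolding power2_eq_square
        by (rule mult_strict_mono) (use elim assms in auto)
      then show ?case using elim blaschke_factor_denom[of a z R] assms by (auto simp: blaschke_factor_def)
    qed
    then show False by simp
  qed
qed

lemma blaschke_factor_analytic: "norm a * norm z < R^2 \<Longrightarrow> blaschke_factor R a analytic_on {z}"
  unfolding blaschke_factor_def using blaschke_factor_denom by (intro analytic_intros) auto

lemma blaschke_factor_nz: "R > 0 \<Longrightarrow> norm a * norm z < R^2 \<Longrightarrow> z \<noteq> a \<Longrightarrow> blaschke_factor R a z \<noteq> 0"
  using blaschke_factor_denom[of a z R] by (simp add: blaschke_factor_def)

lemma blaschke_factor_prod_less: "norm a < R \<Longrightarrow> norm z \<le> R \<Longrightarrow> norm a * norm z < R^2"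
proof -
  assume "norm a < R" "norm z \<le> R"
  then have "norm a * norm z \<le> norm a * R" "norm a * R < R * R"
    using norm_ge_zero[of a] by (auto intro: mult_left_mono simp del: norm_ge_zero)
  then show ?thesis by (simp add: power2_eq_square)
qed

lemma zorder_blaschke_factor:
  assumes "R > 0" "norm a < R" "norm b \<le> R"
  shows "zorder (blaschke_factor R a) b = (if b = a then 1 else 0)"
proof (cases "b = a")
  case False
  then show ?thesis
    using blaschke_factor_prod_less[OF assms(2,3)] blaschke_factor_analytic[of a b R] blaschke_factor_nz[of R a b] assms
    by (auto intro!: zorder_eq_0I)
next
  case True
  have *: "of_real (R^2) - cnj a * z \<noteq> 0" if "norm z < R" for z
    using blaschke_factor_prod_less[of a R z] that assms blaschke_factor_denom[of a z R] by auto
  have "zorder (blaschke_factor R a) a = 1"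
  proof (rule zorder_eqI[of "ball 0 R" a "\<lambda>z. of_real R / (of_real (R^2) - cnj a * z)"])
    show "(\<lambda>z. of_real R / (of_real (R^2) - cnj a * z)) holomorphic_on ball 0 R"
      using * by (intro holomorphic_intros) auto
  qed (use assms *[of a] in \<open>auto simp: blaschke_factor_def\<close>)
  then show ?thesis using True by simp
qed

lemma norm_blaschke_factor_circle:
  assumes "norm z = R" "norm a < R"
  shows "norm (blaschke_factor R a z) = 1"
proof -
  have R: "R > 0" using assms norm_ge_zero[of a] by linarith
  have "of_real (R^2) - cnj a * z = z * cnj (z - a)"
    using assms complex_norm_square[of z] by (simp add: algebra_simps)
  then have "norm (of_real (R^2) - cnj a * z) = R * norm (z - a)"
    using assms by (metis complex_mod_cnj norm_mult)
  then show ?thesis using assms R by (auto simp: blaschke_factor_def norm_divide norm_mult)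
qed

definition zeros_poles_in :: "(complex \<Rightarrow> complex) \<Rightarrow> real \<Rightarrow> complex set" where
  "zeros_poles_in f R = {a \<in> cball 0 R. zorder f a \<noteq> 0}"

lemma finite_zeros_poles: "nonzero_mero f \<Longrightarrow> finite (zeros_poles_in f R)"
  unfolding zeros_poles_in_def by (rule finite_zorder)

lemma zeros_poles_in_less: "circle_regular f R \<Longrightarrow> a \<in> zeros_poles_in f R \<Longrightarrow> norm a < R"
  using regular_at_zorder[of f a] by (force simp: zeros_poles_in_def circle_regular_def)

text \<open>After removable singularities are filled in, \<open>F\<close> is holomorphic and
  zero-free, hence an exponential on a convex set. The identity is claimed only where
  \<open>F\<close> itself is analytic, since its values elsewhere may differ from the filled-in
  ones.\<close>

lemma zorder_free_exp:
  assumes F: "nonzero_mero F" and S: "open S" "convex S" and z: "\<And>b. b \<in> S \<Longrightarrow> zorder F b = 0"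
  obtains h where "h holomorphic_on S" "\<And>z. z \<in> S \<Longrightarrow> F analytic_on {z} \<Longrightarrow> F z = exp (h z)"
proof -
  let ?G = "remove_sings F"
  have G: "?G analytic_on {b} \<and> ?G b \<noteq> 0" if b: "b \<in> S" for b
  proof -
    have m: "F meromorphic_on {b}" using F by (rule nonzero_mero_mero)
    have np: "\<not> is_pole F b" "\<not> isolated_zero F b"
      using is_pole_iff_zorder[OF F] isolated_zero_iff_zorder[OF F] z[OF b] by auto
    then obtain c where c: "F \<midarrow>b\<rightarrow> c"
      using m unfolding meromorphic_at_iff not_essential_def by auto
    then have an: "?G analytic_on {b}"
      using remove_sings_analytic_at m unfolding meromorphic_at_iff by blast
    moreover have "c \<noteq> 0" using np c nonzero_mero_ev[OF F, of b] by (auto simp: isolated_zero_def)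
    moreover have "?G b = c" using c by (rule remove_sings_eqI)
    ultimately show ?thesis by simp
  qed
  have "?G holomorphic_on S"
    by (rule analytic_imp_holomorphic, subst analytic_on_analytic_at) (use G in auto)
  moreover have "contractible S" by (rule convex_imp_contractible) fact
  moreover have "\<And>z. z \<in> S \<Longrightarrow> ?G z \<noteq> 0" using G by auto
  ultimately obtain h where h: "h holomorphic_on S" "\<And>z. z \<in> S \<Longrightarrow> ?G z = exp (h z)"
    using contractible_imp_holomorphic_log by (metis (no_types, lifting))
  show thesis by (rule that[OF h(1)]) (use h(2) remove_sings_at_analytic in force)
qed

text \<open>Dividing by the Blaschke product removes all zeros and poles in the closed disc. A
  slightly larger disc remains free of them, so \<open>h\<close> is holomorphic across the circle
  and the Poisson formula can be used with boundary values on it.\<close>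

theorem blaschke_factorization:
  assumes f: "nonzero_mero f" and R: "R > 0" and g: "circle_regular f R"
  obtains h R' where "R < R'" "h holomorphic_on ball 0 R'"
    "\<And>z. norm z \<le> R \<Longrightarrow> regular_at f z \<Longrightarrow> f z = exp (h z) * (\<Prod>a\<in>zeros_poles_in f R. blaschke_factor R a z powi zorder f a)"
proof -
  let ?Z = "zeros_poles_in f R"
  define B where "B = (\<lambda>z. \<Prod>a\<in>?Z. blaschke_factor R a z powi zorder f a)"
  have fin: "finite ?Z" by (rule finite_zeros_poles[OF f])
  have nb: "nonzero_mero (blaschke_factor R a)" if "a \<in> ?Z" for a
    by (rule nonzero_mero_blaschke_factor[OF R zeros_poles_in_less[OF g that]])
  have nB: "nonzero_mero B" unfolding B_def by (intro nonzero_mero_prod nonzero_mero_powi nb)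
  define F where "F = (\<lambda>z. f z / B z)"
  have nF: "nonzero_mero F" unfolding F_def by (intro nonzero_mero_divide f nB)
  have zB: "zorder B b = zorder f b" if b: "norm b \<le> R" for b
  proof -
    have "zorder B b = (\<Sum>a\<in>?Z. zorder f a * zorder (blaschke_factor R a) b)"
      unfolding B_def by (subst nonzero_mero_zorder_prod) (auto intro!: nonzero_mero_powi nb sum.cong simp: nonzero_mero_zorder_powi nb)
    also have "\<dots> = (\<Sum>a\<in>?Z. if b = a then zorder f a else 0)"
      by (intro sum.cong refl) (simp add: zorder_blaschke_factor[OF R zeros_poles_in_less[OF g] b])
    also have "\<dots> = zorder f b"
      using fin b by (auto simp: zeros_poles_in_def)
    finally show ?thesis .
  qed
  have zF: "zorder F b = 0" if "norm b \<le> R" for b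
    unfolding F_def using zB[OF that] by (simp add: nonzero_mero_zorder_divide f nB)
  \<comment> \<open>Zeros and poles of the quotient in a larger disc: finitely many, all of modulus
    above \<open>R\<close>, so their smallest modulus leaves room for \<open>R'\<close>.\<close>
  define X where "X = {a \<in> cball 0 (R + 1). zorder F a \<noteq> 0}"
  have finX: "finite X" unfolding X_def by (rule finite_zorder[OF nF])
  define R' where "R' = Min (insert (R + 1) (norm ` X))"
  have XR: "norm a > R" if "a \<in> X" for a using zF[of a] that by (force simp: X_def)
  have R': "R < R'" "R' \<le> R + 1" unfolding R'_def using finX XR by auto
  have zF': "zorder F b = 0" if "norm b < R'" for b
  proof (rule ccontr)
    assume "zorder F b \<noteq> 0"
    then have "b \<in> X" using that R' by (auto simp: X_def)
    then have "R' \<le> norm b" unfolding R'_def using finX by auto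
    then show False using that by simp
  qed
  obtain h where h: "h holomorphic_on ball 0 R'" "\<And>z. z \<in> ball 0 R' \<Longrightarrow> F analytic_on {z} \<Longrightarrow> F z = exp (h z)"
    using zorder_free_exp[OF nF, of "ball 0 R'"] zF' by auto
  show thesis
  proof (rule that[OF R'(1) h(1)])
    fix z assume z: "norm z \<le> R" "regular_at f z"
    have "blaschke_factor R a z \<noteq> 0 \<and> blaschke_factor R a analytic_on {z}" if a: "a \<in> ?Z" for a
      using blaschke_factor_prod_less[OF zeros_poles_in_less[OF g a] z(1)] blaschke_factor_analytic[of a z R] blaschke_factor_nz[of R a z] R a z
        regular_at_zorder[OF z(2)] by (auto simp: zeros_poles_in_def)
    then have "B z \<noteq> 0" "B analytic_on {z}"
      unfolding B_def using fin by (auto intro!: analytic_intros)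
    then have "F analytic_on {z}" unfolding F_def using z(2) by (auto simp: regular_at_def intro!: analytic_intros)
    then have "F z = exp (h z)" using h(2)[of z] z R'(1) by simp
    then show "f z = exp (h z) * (\<Prod>a\<in>?Z. blaschke_factor R a z powi zorder f a)"
      using \<open>B z \<noteq> 0\<close> by (simp add: F_def B_def field_simps)
  qed
qed

subsection \<open>Jensen's formula and monotonicity of the characteristic\<close>

lemma continuous_on_poisson_sphere:
  assumes "r < R" "continuous_on (sphere 0 R) u"
  shows "continuous_on (sphere 0 r) (poisson R u)"
proof (cases "r < 0")
  case False
  then have R: "R > 0" using assms by auto
  have c: "continuous_on S (\<lambda>x. rcis R (g x))" if "continuous_on S g" for S and g :: "complex \<times> real \<Rightarrow> real"
    unfolding rcis_def cis_conv_exp by (intro continuous_intros that)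
  have u: "continuous_on (sphere 0 r \<times> cbox 0 (2 * pi)) (\<lambda>x. u (rcis R (snd x)))"
    using R by (intro continuous_on_compose2[OF assms(2), of _ "\<lambda>x. rcis R (snd x)"] c continuous_intros) auto
  have "rcis R (snd x) - fst x \<noteq> 0" if "x \<in> sphere 0 r \<times> cbox 0 (2 * pi)" for x :: "complex \<times> real"
  proof
    assume "rcis R (snd x) - fst x = 0"
    then have "norm (rcis R (snd x)) = norm (fst x)" by simp
    then show False using assms that R by (auto simp: mem_Times_iff)
  qed
  then have "continuous_on (sphere 0 r \<times> cbox 0 (2 * pi)) (\<lambda>(z, t). u (rcis R t) * poisson_kernel (rcis R t) z)"
    unfolding case_prod_beta poisson_kernel_def by (intro continuous_intros c u) auto
  from integral_continuous_on_param[OF this] show ?thesis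
    unfolding poisson_def circle_mean_def by (intro continuous_intros) auto
qed auto

lemma ln_power_int:
  fixes x :: real
  assumes "x > 0"
  shows "ln (x powi k) = real_of_int k * ln x"
  using assms by (simp add: powr_real_of_int'[symmetric] ln_powr)

lemma circle_mean_ln_holomorphic:
  assumes F: "F holomorphic_on ball 0 R" "\<And>z. norm z < R \<Longrightarrow> F z \<noteq> 0" and r: "0 < r" "r < R"
  shows "circle_mean r (\<lambda>z. ln (norm (F z))) = ln (norm (F 0))"
proof -
  have "contractible (ball (0::complex) R)" by (rule convex_imp_contractible) auto
  moreover have "\<And>z. z \<in> ball 0 R \<Longrightarrow> F z \<noteq> 0" using F by auto
  ultimately obtain h where h: "h holomorphic_on ball 0 R" "\<And>z. z \<in> ball 0 R \<Longrightarrow> F z = exp (h z)"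
    using contractible_imp_holomorphic_log F(1) by (metis (no_types, lifting))
  have *: "ln (norm (F z)) = Re (h z)" if "norm z < R" for z
    using h(2)[of z] that by simp
  have "circle_mean r (\<lambda>z. ln (norm (F z))) = circle_mean r (\<lambda>z. Re (h z))"
    by (rule circle_mean_cong) (use r * in auto)
  also have "\<dots> = Re (h 0)" by (rule circle_mean_Re_holomorphic[OF h(1) r])
  finally show ?thesis using *[of 0] r by simp
qed

text \<open>For \<open>a\<close> inside the disc the Blaschke factor is unimodular on the circle, so
  \<open>|z - a|\<close> may be replaced there by \<open>|r^2 - cnj a z| / r\<close>, which is
  zero-free in the disc.\<close>

lemma circle_mean_ln_dist:
  assumes "r > 0" "norm a \<noteq> r"
  shows "circle_mean r (\<lambda>z. ln (norm (z - a))) = ln (max r (norm a))"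
proof (cases "norm a > r")
  case True
  have "circle_mean r (\<lambda>z. ln (norm (z - a))) = ln (norm (0 - a))"
    by (rule circle_mean_ln_holomorphic[of _ "norm a"]) (use True assms in \<open>auto intro!: holomorphic_intros\<close>)
  then show ?thesis using True by simp
next
  case False
  then have a: "norm a < r" using assms by simp
  have eq: "norm (z - a) = norm (blaschke_factor r a z * (of_real (r^2) - cnj a * z) / of_real r)" if "norm z = r" for z
    using blaschke_factor_denom[of a z r] blaschke_factor_prod_less[OF a, of z] that assms by (simp add: blaschke_factor_def norm_divide norm_mult)
  have "circle_mean r (\<lambda>z. ln (norm (z - a))) = circle_mean r (\<lambda>z. ln (norm ((of_real (r^2) - cnj a * z) / of_real r)))"
    by (rule circle_mean_cong) (use assms eq norm_blaschke_factor_circle[OF _ a] in \<open>auto simp: norm_mult norm_divide\<close>)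
  also have "\<dots> = ln (norm ((of_real (r^2) - cnj a * 0) / of_real r))"
  proof -
    \<comment> \<open>A radius up to which \<open>r^2 - cnj a * z\<close> has no zero; for
      \<open>a = 0\<close> any radius above \<open>r\<close> will do.\<close>
    define q where "q = (if a = 0 then r + 1 else r^2 / norm a)"
    have q: "r < q" using a assms by (auto simp: q_def field_simps power2_eq_square)
    have "norm a * norm z < r^2" if "norm z < q" for z
      using that assms a by (auto simp: q_def field_simps split: if_splits)
    then show ?thesis using blaschke_factor_denom[of a _ r] assms q
      by (intro circle_mean_ln_holomorphic[of _ q] holomorphic_intros) auto
  qed
  also have "\<dots> = ln r" using assms by (simp add: norm_divide norm_power power2_eq_square)
  finally show ?thesis using False by simp
qed

lemma norm_blaschke_factor_le:
  assumes "norm a < R" "norm z \<le> R"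
  shows "norm (blaschke_factor R a z) \<le> 1"
proof -
  have R: "R > 0" using assms norm_ge_zero[of a] by linarith
  have "norm (of_real (R^2) - cnj a * z) ^ 2 - norm (of_real R * (z - a)) ^ 2 = (R^2 - norm a ^ 2) * (R^2 - norm z ^ 2)"
    unfolding cmod_power2 by (simp add: power2_eq_square algebra_simps)
  also have "\<dots> \<ge> 0" using assms by (intro mult_nonneg_nonneg) (auto intro!: power_mono simp: abs_le_square_iff[symmetric])
  finally have "norm (of_real R * (z - a)) ^ 2 \<le> norm (of_real (R^2) - cnj a * z) ^ 2" by simp
  then have "norm (of_real R * (z - a)) \<le> norm (of_real (R^2) - cnj a * z)"
    by (rule power2_le_imp_le) simp
  moreover have "norm (of_real (R^2) - cnj a * z) > 0"
    using blaschke_factor_denom[OF blaschke_factor_prod_less[OF assms]] by simp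
  ultimately show ?thesis unfolding blaschke_factor_def norm_divide by (subst divide_le_eq_1_pos) auto
qed

lemma ln_norm_factorization:
  assumes "f z = exp (h z) * (\<Prod>a\<in>zeros_poles_in f R. blaschke_factor R a z powi zorder f a)"
    and "circle_regular f R" "R > 0" "norm z \<le> R" "regular_at f z" "nonzero_mero f"
  shows "ln (norm (f z)) = Re (h z) + (\<Sum>a\<in>zeros_poles_in f R. real_of_int (zorder f a) * ln (norm (blaschke_factor R a z)))"
proof -
  have nz: "blaschke_factor R a z \<noteq> 0" if a: "a \<in> zeros_poles_in f R" for a
    using blaschke_factor_prod_less[OF zeros_poles_in_less[OF assms(2) a] assms(4)] blaschke_factor_nz[of R a z] assms a
        regular_at_zorder[OF assms(5)] by (auto simp: zeros_poles_in_def)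
  have "ln (norm (f z)) = ln (exp (Re (h z)) * (\<Prod>a\<in>zeros_poles_in f R. norm (blaschke_factor R a z) powi zorder f a))"
    unfolding assms(1) norm_mult by (simp add: prod_norm[symmetric] norm_power_int)
  also have "\<dots> = Re (h z) + ln (\<Prod>a\<in>zeros_poles_in f R. norm (blaschke_factor R a z) powi zorder f a)"
    using nz by (subst ln_mult_pos) (auto intro!: prod_pos zero_less_power_int)
  also have "ln (\<Prod>a\<in>zeros_poles_in f R. norm (blaschke_factor R a z) powi zorder f a) = (\<Sum>a\<in>zeros_poles_in f R. ln (norm (blaschke_factor R a z) powi zorder f a))"
    using nz by (intro ln_prod) (auto intro!: zero_less_power_int simp: finite_zeros_poles assms)
  also have "\<dots> = (\<Sum>a\<in>zeros_poles_in f R. real_of_int (zorder f a) * ln (norm (blaschke_factor R a z)))"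
    using nz by (intro sum.cong refl ln_power_int) auto
  finally show ?thesis .
qed

lemma ln_norm_factorization_circle:
  assumes "f z = exp (h z) * (\<Prod>a\<in>zeros_poles_in f R. blaschke_factor R a z powi zorder f a)"
    and "circle_regular f R" "R > 0" "norm z = R" "nonzero_mero f"
  shows "ln (norm (f z)) = Re (h z)"
proof -
  have "regular_at f z" using assms by (auto simp: circle_regular_def)
  then have "ln (norm (f z)) = Re (h z) + (\<Sum>a\<in>zeros_poles_in f R. real_of_int (zorder f a) * ln (norm (blaschke_factor R a z)))"
    using assms by (intro ln_norm_factorization) auto
  also have "(\<Sum>a\<in>zeros_poles_in f R. real_of_int (zorder f a) * ln (norm (blaschke_factor R a z))) = 0"
    by (intro sum.neutral ballI) (use assms norm_blaschke_factor_circle zeros_poles_in_less in auto)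
  finally show ?thesis by simp
qed

text \<open>The mean equals \<open>Re (h 0)\<close> for the zero-free part, and \<open>h 0\<close>
  is compared with the leading Laurent coefficient of \<open>f\<close> at the origin, the logarithm
  of whose modulus is \<open>C\<close>. It is important that \<open>C\<close> depends on
  \<open>f\<close> alone and not on \<open>R\<close>.\<close>

theorem jensen:
  assumes f: "nonzero_mero f"
  obtains C where "\<And>R. R \<ge> 1 \<Longrightarrow> circle_regular f R \<Longrightarrow>
    circle_mean R (\<lambda>z. ln (norm (f z))) = C + log_count (\<lambda>a. real_of_int (zorder f a)) R"
proof -
  define g where "g = zor_poly f 0"
  define k where "k = zorder f 0"
  have iso: "isolated_singularity_at f 0" "not_essential f 0"
    using nonzero_mero_mero[OF f, of "{0}"] by (auto simp: meromorphic_at_iff)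
  from zorder_exist[OF iso nonzero_mero_fr[OF f], folded g_def k_def]
  obtain q where q: "g 0 \<noteq> 0" "q > 0" "g holomorphic_on cball 0 q"
     "\<And>w. w \<in> cball 0 q - {0} \<Longrightarrow> f w = g w * w powi k \<and> g w \<noteq> 0" by auto
  have cg: "isCont g 0" using holomorphic_on_imp_continuous_on[OF q(3)] q(2)
    by (intro continuous_on_interior[of "cball 0 q"]) auto
  show thesis
  proof (rule that[of "ln (norm (g 0))"])
    fix R :: real assume R1: "R \<ge> 1" and gd: "circle_regular f R"
    then have R: "R > 0" by simp
    from blaschke_factorization[OF f R gd]
    obtain h R' where h: "R < R'" "h holomorphic_on ball 0 R'"
      "\<And>z. norm z \<le> R \<Longrightarrow> regular_at f z \<Longrightarrow> f z = exp (h z) * (\<Prod>a\<in>zeros_poles_in f R. blaschke_factor R a z powi zorder f a)"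
      by metis
    have ch: "isCont h 0" using holomorphic_on_imp_continuous_on[OF h(2)] h(1) R
      by (intro continuous_on_interior[of "ball 0 R'"]) auto
    let ?Z = "zeros_poles_in f R"
    have fin: "finite ?Z" by (rule finite_zeros_poles[OF f])
    have "circle_mean R (\<lambda>z. ln (norm (f z))) = circle_mean R (\<lambda>z. Re (h z))"
    proof (rule circle_mean_cong)
      fix z :: complex assume z: "norm z = R"
      then have "regular_at f z" using gd by (auto simp: circle_regular_def)
      then show "ln (norm (f z)) = Re (h z)"
        using z h(3)[of z] by (intro ln_norm_factorization_circle[OF _ gd R z f]) auto
    qed (use R in auto)
    also have "\<dots> = Re (h 0)" by (rule circle_mean_Re_holomorphic[OF h(2) R h(1)])
    also have "Re (h 0) = ln (norm (g 0)) + log_count (\<lambda>a. real_of_int (zorder f a)) R"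
    proof -
      \<comment> \<open>Both expansions of \<open>ln |f z|\<close> contain \<open>k ln |z|\<close>;
        after it is cancelled both sides are continuous at 0, so the identity passes to the limit
        although \<open>f 0\<close> may be meaningless.\<close>
      have ev: "eventually (\<lambda>z. ln (norm (g z)) = Re (h z) - k * ln R + (\<Sum>a\<in>?Z - {0}. zorder f a * ln (norm (blaschke_factor R a z)))) (at 0)"
      proof -
        have "eventually (\<lambda>z. regular_at f z) (at 0)"
          using regular_at_cosparse[OF f] eventually_cosparse_imp_eventually_at by blast
        moreover have "eventually (\<lambda>z. z \<in> ball 0 (min q R) - {0}) (at (0::complex))"
          by (rule eventually_at_in_open) (use q R in auto)
        ultimately show ?thesis
        proof eventually_elim
          case (elim z)
          have 1: "ln (norm (f z)) = ln (norm (g z)) + k * ln (norm z)"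
            using q(4)[of z] elim by (simp add: norm_mult norm_power_int ln_mult ln_power_int)
          have 2: "ln (norm (f z)) = Re (h z) + (\<Sum>a\<in>?Z. zorder f a * ln (norm (blaschke_factor R a z)))"
            by (rule ln_norm_factorization) (use elim h gd f R in auto)
          \<comment> \<open>Adding 0 to the index set, possibly with order 0, avoids a case
            distinction on the behaviour at the origin.\<close>
          have "(\<Sum>a\<in>?Z. zorder f a * ln (norm (blaschke_factor R a z))) = (\<Sum>a\<in>insert 0 ?Z. zorder f a * ln (norm (blaschke_factor R a z)))"
            using fin R by (intro sum.mono_neutral_left) (auto simp: zeros_poles_in_def)
          also have "\<dots> = k * ln (norm (blaschke_factor R 0 z)) + (\<Sum>a\<in>?Z - {0}. zorder f a * ln (norm (blaschke_factor R a z)))"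
            using fin by (simp add: sum.insert_remove k_def)
          also have "norm (blaschke_factor R 0 z) = norm z / R" using R by (simp add: blaschke_factor_def norm_divide norm_mult norm_power power2_eq_square)
          also have "ln (norm z / R) = ln (norm z) - ln R" using elim R by (auto simp: ln_div)
          finally show ?case using 1 2 by (simp add: algebra_simps)
        qed
      qed
      have "((\<lambda>z. Re (h z) - k * ln R + (\<Sum>a\<in>?Z - {0}. zorder f a * ln (norm (blaschke_factor R a z)))) \<longlongrightarrow>
         Re (h 0) - k * ln R + (\<Sum>a\<in>?Z - {0}. zorder f a * ln (norm (blaschke_factor R a 0)))) (at 0)"
      proof (intro tendsto_intros)
        show "(h \<longlongrightarrow> h 0) (at 0)" using ch by (simp add: isCont_def)
        fix a assume a: "a \<in> ?Z - {0}"
        have "norm a * norm (0::complex) < R^2" using R by simp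
        from blaschke_factor_analytic[OF this] have "isCont (blaschke_factor R a) 0" by (rule analytic_at_imp_isCont)
        then show "((\<lambda>z. blaschke_factor R a z) \<longlongrightarrow> blaschke_factor R a 0) (at 0)" by (simp add: isCont_def)
        show "norm (blaschke_factor R a 0) \<noteq> 0" using blaschke_factor_nz[of R a 0] R a by simp
      qed
      moreover have "((\<lambda>z. ln (norm (g z))) \<longlongrightarrow> ln (norm (g 0))) (at 0)"
        using cg q(1) by (intro tendsto_intros) (auto simp: isCont_def)
      then have "((\<lambda>z. Re (h z) - k * ln R + (\<Sum>a\<in>?Z - {0}. zorder f a * ln (norm (blaschke_factor R a z)))) \<longlongrightarrow> ln (norm (g 0))) (at 0)"
        by (rule Lim_transform_eventually[OF _ ev])
      ultimately have "ln (norm (g 0)) = Re (h 0) - k * ln R + (\<Sum>a\<in>?Z - {0}. zorder f a * ln (norm (blaschke_factor R a 0)))"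
        using tendsto_unique at_neq_bot by blast
      also have "(\<Sum>a\<in>?Z - {0}. zorder f a * ln (norm (blaschke_factor R a 0))) = (\<Sum>a\<in>?Z - {0}. - (zorder f a * log_weight R a))"
      proof (intro sum.cong refl)
        fix a assume a: "a \<in> ?Z - {0}"
        have "norm a < R" using zeros_poles_in_less[OF gd] a by auto
        moreover have "norm (blaschke_factor R a 0) = norm a / R" using R by (simp add: blaschke_factor_def norm_divide norm_mult norm_power power2_eq_square)
        ultimately show "zorder f a * ln (norm (blaschke_factor R a 0)) = - (zorder f a * log_weight R a)"
          using a R by (simp add: log_weight_def ln_div algebra_simps)
      qed
      finally have "Re (h 0) = ln (norm (g 0)) + (k * ln R + (\<Sum>a\<in>?Z - {0}. zorder f a * log_weight R a))"
        by (simp add: sum_negf)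
      also have "k * ln R + (\<Sum>a\<in>?Z - {0}. zorder f a * log_weight R a) = (\<Sum>a\<in>insert 0 ?Z. zorder f a * log_weight R a)"
        using fin by (simp add: sum.insert_remove k_def log_weight_def)
      also have "\<dots> = log_count (\<lambda>a. real_of_int (zorder f a)) R"
        by (rule log_count_superset[symmetric]) (use R fin in \<open>auto simp: supp_in_def zeros_poles_in_def\<close>)
      finally show ?thesis .
    qed
    finally show "circle_mean R (\<lambda>z. ln (norm (f z))) = ln (norm (g 0)) + log_count (\<lambda>a. real_of_int (zorder f a)) R" .
  qed
qed

lemma circle_regular_pos: "circle_regular f r \<Longrightarrow> norm z = r \<Longrightarrow> norm (f z) > 0"
  by (auto simp: circle_regular_def regular_at_def)

lemma circle_mean_ln_eq_m:
  assumes "circle_regular f R" "R > 0"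
  shows "circle_mean R (\<lambda>z. ln (norm (f z))) = nev_m R f - nev_m R (\<lambda>z. inverse (f z))"
proof -
  have "circle_mean R (\<lambda>z. ln (norm (f z))) = circle_mean R (\<lambda>z. log_plus (norm (f z)) - log_plus (norm (inverse (f z))))"
    by (rule circle_mean_cong) (use assms circle_regular_pos[OF assms(1)] in \<open>auto simp: log_plus_diff_inverse norm_inverse\<close>)
  also have "\<dots> = nev_m R f - nev_m R (\<lambda>z. inverse (f z))"
    unfolding nev_m_eq using assms
    by (intro circle_mean_diff continuous_log_plus_circle_regular circle_regular_inverse) auto
  finally show ?thesis .
qed

lemma circle_mean_abs_ln_eq_m:
  assumes "circle_regular f R" "R > 0"
  shows "circle_mean R (\<lambda>z. \<bar>ln (norm (f z))\<bar>) = nev_m R f + nev_m R (\<lambda>z. inverse (f z))"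
proof -
  have "circle_mean R (\<lambda>z. \<bar>ln (norm (f z))\<bar>) = circle_mean R (\<lambda>z. log_plus (norm (f z)) + log_plus (norm (inverse (f z))))"
    by (rule circle_mean_cong) (use assms circle_regular_pos[OF assms(1)] in \<open>auto simp: log_plus_sum_inverse norm_inverse\<close>)
  also have "\<dots> = nev_m R f + nev_m R (\<lambda>z. inverse (f z))"
    unfolding nev_m_eq using assms
    by (intro circle_mean_add continuous_log_plus_circle_regular circle_regular_inverse) auto
  finally show ?thesis .
qed

text \<open>Jensen's formula, with the logarithm split into \<open>log_plus\<close> terms and
  \<open>zorder\<close> into \<open>zero_ord - pole_ord\<close>.\<close>

theorem first_main_theorem:
  assumes f: "nonzero_mero f"
  obtains C where "\<And>R. R \<ge> 1 \<Longrightarrow> circle_regular f R \<Longrightarrow> nev_T R f = nev_T R (\<lambda>z. inverse (f z)) + C"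
proof -
  from jensen[OF f] obtain C where C: "\<And>R. R \<ge> 1 \<Longrightarrow> circle_regular f R \<Longrightarrow>
    circle_mean R (\<lambda>z. ln (norm (f z))) = C + log_count (\<lambda>a. real_of_int (zorder f a)) R" by blast
  show thesis
  proof (rule that)
    fix R :: real assume R: "R \<ge> 1" "circle_regular f R"
    then have R0: "R > 0" by simp
    have "nev_N R f + log_count (\<lambda>a. real_of_int (zorder f a)) R = log_count (\<lambda>a. pole_ord f a + real_of_int (zorder f a)) R"
      using R0 f by (simp add: nev_N_eq log_count_add locally_finite_supp_pole_ord locally_finite_supp_zorder)
    also have "(\<lambda>a. pole_ord f a + real_of_int (zorder f a)) = zero_ord f"
      by (auto simp: fun_eq_iff pole_ord_def zero_ord_def)
    also have "log_count (zero_ord f) R = nev_N R (\<lambda>z. inverse (f z))"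
      using R0 f by (simp add: nev_N_eq nonzero_mero_inverse pole_ord_inverse)
    finally show "nev_T R f = nev_T R (\<lambda>z. inverse (f z)) + C"
      using C[OF R] circle_mean_ln_eq_m[OF R(2) R0] by (simp add: nev_T_def)
  qed
qed

lemma nev_N_nonneg: "nonzero_mero f \<Longrightarrow> r \<ge> 1 \<Longrightarrow> nev_N r f \<ge> 0"
  by (auto simp: nev_N_eq pole_ord_def intro!: log_count_nonneg)

lemma nev_T_nonneg: "nonzero_mero f \<Longrightarrow> r \<ge> 1 \<Longrightarrow> nev_T r f \<ge> 0"
  unfolding nev_T_def
  by (intro add_nonneg_nonneg nev_m_nonneg) (auto simp: nev_N_eq pole_ord_def intro!: log_count_nonneg)

text \<open>Poisson-Jensen: on the inner circle \<open>log_plus |f|\<close> is at most the Poisson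
  integral of its boundary values plus contributions of the poles. After averaging over the inner
  circle, the Poisson term becomes \<open>m(R, f)\<close>, and each pole contributes exactly the
  increase of its weight from \<open>r\<close> to \<open>R\<close>.\<close>

theorem nev_T_mono:
  assumes f: "nonzero_mero f" and rR: "1 \<le> r" "r < R" and g: "circle_regular f r" "circle_regular f R"
  shows "nev_T r f \<le> nev_T R f"
proof -
  have R: "R > 0" and r: "r > 0" using rR by auto
  from blaschke_factorization[OF f R g(2)]
  obtain h R' where h: "R < R'" "h holomorphic_on ball 0 R'"
    "\<And>z. norm z \<le> R \<Longrightarrow> regular_at f z \<Longrightarrow> f z = exp (h z) * (\<Prod>a\<in>zeros_poles_in f R. blaschke_factor R a z powi zorder f a)"
    by metis
  let ?Z = "zeros_poles_in f R" and ?u = "\<lambda>z. log_plus (norm (f z))"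
  have fin: "finite ?Z" by (rule finite_zeros_poles[OF f])
  have cu: "continuous_on (sphere 0 R) ?u" by (rule continuous_log_plus_circle_regular[OF g(2)])
  have ra: "norm a \<noteq> r" if "a \<in> ?Z" for a
    using that g(1) regular_at_zorder[of f a] by (auto simp: zeros_poles_in_def circle_regular_def)
  have aR: "norm a < R" if "a \<in> ?Z" for a using zeros_poles_in_less[OF g(2) that] .
  have pw: "?u z \<le> poisson R ?u z + (\<Sum>a\<in>?Z. pole_ord f a * (ln (norm (of_real (R^2) - cnj a * z)) - ln R - ln (norm (z - a))))"
    if z: "norm z = r" for z
  proof -
    have blaschke_factor: "ln (norm (of_real (R^2) - cnj a * z)) - ln R - ln (norm (z - a)) = - ln (norm (blaschke_factor R a z))" if a: "a \<in> ?Z" for a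
    proof -
      have "of_real (R^2) - cnj a * z \<noteq> 0" using blaschke_factor_denom[OF blaschke_factor_prod_less[OF aR[OF a], of z]] z rR by auto
      moreover have "z \<noteq> a" using ra[OF a] z by auto
      ultimately show ?thesis using R unfolding blaschke_factor_def
        by (simp add: norm_divide norm_mult ln_div ln_mult)
    qed
    have neg: "ln (norm (blaschke_factor R a z)) \<le> 0" if a: "a \<in> ?Z" for a
    proof -
      have "norm (blaschke_factor R a z) > 0" using blaschke_factor_nz[OF R blaschke_factor_prod_less[OF aR[OF a], of z]] ra[OF a] z rR by auto
      then show ?thesis using norm_blaschke_factor_le[OF aR[OF a], of z] z rR by simp
    qed
    have reg: "regular_at f z" using g(1) z by (auto simp: circle_regular_def)
    have "ln (norm (f z)) = Re (h z) + (\<Sum>a\<in>?Z. zorder f a * ln (norm (blaschke_factor R a z)))"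
      by (rule ln_norm_factorization) (use z rR g f R h reg in auto)
    also have "Re (h z) = poisson R (\<lambda>z. Re (h z)) z"
      by (rule poisson_formula[symmetric, OF h(2,1)]) (use z rR in auto)
    also have "\<dots> \<le> poisson R ?u z"
    proof (rule poisson_mono[OF R])
      show "continuous_on (sphere 0 R) (\<lambda>z. Re (h z))"
        by (intro continuous_intros holomorphic_on_imp_continuous_on holomorphic_on_subset[OF h(2)]) (use h in auto)
      fix w :: complex assume w: "norm w = R"
      have "Re (h w) = ln (norm (f w))"
        by (rule ln_norm_factorization_circle[symmetric]) (use w g f R h in \<open>auto simp: circle_regular_def\<close>)
      then show "Re (h w) \<le> ?u w" using circle_regular_pos[OF g(2) w] by (simp add: ln_le_log_plus)
    qed (use z rR cu in auto)
    \<comment> \<open>Zeros contribute nonpositive terms, since a Blaschke factor has modulus at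
      most 1 in the disc.\<close>
    also have "(\<Sum>a\<in>?Z. zorder f a * ln (norm (blaschke_factor R a z))) \<le> (\<Sum>a\<in>?Z. pole_ord f a * (- ln (norm (blaschke_factor R a z))))"
    proof (intro sum_mono)
      fix a assume a: "a \<in> ?Z"
      have "- real_of_int (zorder f a) * (- ln (norm (blaschke_factor R a z))) \<le> pole_ord f a * (- ln (norm (blaschke_factor R a z)))"
        using neg[OF a] by (intro mult_right_mono) (auto simp: pole_ord_def)
      then show "zorder f a * ln (norm (blaschke_factor R a z)) \<le> pole_ord f a * (- ln (norm (blaschke_factor R a z)))" by simp
    qed
    finally have "ln (norm (f z)) \<le> poisson R ?u z + (\<Sum>a\<in>?Z. pole_ord f a * (- ln (norm (blaschke_factor R a z))))" by simp
    moreover have "poisson R ?u z \<ge> 0"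
      by (rule poisson_nonneg[OF R]) (use z rR log_plus_nonneg in auto)
    moreover have "(\<Sum>a\<in>?Z. pole_ord f a * (- ln (norm (blaschke_factor R a z)))) \<ge> 0"
      using neg by (intro sum_nonneg mult_nonneg_nonneg) (auto simp: pole_ord_def)
    \<comment> \<open>The majorant is nonnegative, so it also bounds
      \<open>max 0 (ln |f|)\<close>.\<close>
    ultimately have "?u z \<le> poisson R ?u z + (\<Sum>a\<in>?Z. pole_ord f a * (- ln (norm (blaschke_factor R a z))))"
      using circle_regular_pos[OF g(1) z] by (simp add: log_plus_eq)
    also have "(\<Sum>a\<in>?Z. pole_ord f a * (- ln (norm (blaschke_factor R a z)))) =
      (\<Sum>a\<in>?Z. pole_ord f a * (ln (norm (of_real (R^2) - cnj a * z)) - ln R - ln (norm (z - a))))"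
      by (intro sum.cong refl) (simp only: blaschke_factor)
    finally show ?thesis .
  qed
  have cd: "continuous_on (sphere 0 r) (\<lambda>z. ln (norm (z - a)))" if "a \<in> ?Z" for a
    using ra[OF that] by (intro continuous_intros) auto
  have dn: "of_real (R^2) - cnj a * z \<noteq> 0" if "a \<in> ?Z" "norm z < R" for a z
    using blaschke_factor_denom[OF blaschke_factor_prod_less[OF aR[OF that(1)], of z]] that by auto
  have cb: "continuous_on (sphere 0 r) (\<lambda>z. ln (norm (of_real (R^2) - cnj a * z)))" if "a \<in> ?Z" for a
    using dn[OF that] rR by (intro continuous_intros) auto
  have cp: "continuous_on (sphere 0 r) (poisson R ?u)"
    by (rule continuous_on_poisson_sphere[OF rR(2) cu])
  have "nev_m r f \<le> circle_mean r (\<lambda>z. poisson R ?u z + (\<Sum>a\<in>?Z. pole_ord f a * (ln (norm (of_real (R^2) - cnj a * z)) - ln R - ln (norm (z - a)))))"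
    unfolding nev_m_eq using r pw cb cd cp
    by (intro circle_mean_mono continuous_log_plus_circle_regular g continuous_on_add continuous_on_sum continuous_on_mult
         continuous_on_const continuous_on_diff) auto
  also have "\<dots> = circle_mean r (poisson R ?u) + circle_mean r (\<lambda>z. \<Sum>a\<in>?Z. pole_ord f a * (ln (norm (of_real (R^2) - cnj a * z)) - ln R - ln (norm (z - a))))"
    using r cb cd cp
    by (intro circle_mean_add continuous_on_sum continuous_on_mult continuous_on_const continuous_on_diff) auto
  also have "circle_mean r (poisson R ?u) = nev_m R f"
    unfolding nev_m_eq by (rule circle_mean_poisson[OF r rR(2) cu])
  also have "circle_mean r (\<lambda>z. \<Sum>a\<in>?Z. pole_ord f a * (ln (norm (of_real (R^2) - cnj a * z)) - ln R - ln (norm (z - a))))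
    = (\<Sum>a\<in>?Z. circle_mean r (\<lambda>z. pole_ord f a * (ln (norm (of_real (R^2) - cnj a * z)) - ln R - ln (norm (z - a)))))"
    using r cb cd fin
    by (intro circle_mean_sum continuous_on_mult continuous_on_const continuous_on_diff) auto
  also have "\<dots> = (\<Sum>a\<in>?Z. pole_ord f a * (log_weight R a - log_weight r a))"
  proof (intro sum.cong refl)
    fix a assume a: "a \<in> ?Z"
    have "circle_mean r (\<lambda>z. ln (norm (of_real (R^2) - cnj a * z)) - ln R - ln (norm (z - a)))
       = circle_mean r (\<lambda>z. ln (norm (of_real (R^2) - cnj a * z))) - ln R - circle_mean r (\<lambda>z. ln (norm (z - a)))"
      using r cb[OF a] cd[OF a] by (simp add: circle_mean_diff continuous_on_diff)
    also have "circle_mean r (\<lambda>z. ln (norm (of_real (R^2) - cnj a * z))) = ln (norm (of_real (R^2) - cnj a * 0))"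
      by (rule circle_mean_ln_holomorphic[of _ R]) (use dn[OF a] r rR in \<open>auto intro!: holomorphic_intros\<close>)
    also have "\<dots> = 2 * ln R" using R by (simp add: norm_power ln_realpow)
    also have "circle_mean r (\<lambda>z. ln (norm (z - a))) = ln (max r (norm a))"
      by (rule circle_mean_ln_dist[OF r ra[OF a]])
    also have "2 * ln R - ln R - ln (max r (norm a)) = log_weight R a - log_weight r a"
      using ra[OF a] aR[OF a] r R by (auto simp: log_weight_def max_def ln_div field_simps)
    finally show "circle_mean r (\<lambda>z. pole_ord f a * (ln (norm (of_real (R^2) - cnj a * z)) - ln R - ln (norm (z - a))))
      = pole_ord f a * (log_weight R a - log_weight r a)" by (simp only: circle_mean_cmult)
  qed
  also have "\<dots> = nev_N R f - nev_N r f"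
  proof -
    have "log_count (pole_ord f) R = (\<Sum>a\<in>?Z. pole_ord f a * log_weight R a)"
      by (rule log_count_superset[OF R fin]) (auto simp: supp_in_def zeros_poles_in_def pole_ord_def)
    moreover have "log_count (pole_ord f) r = (\<Sum>a\<in>?Z. pole_ord f a * log_weight r a)"
      by (rule log_count_superset[OF r fin]) (use rR in \<open>auto simp: supp_in_def zeros_poles_in_def pole_ord_def\<close>)
    ultimately show ?thesis using f R r by (simp add: nev_N_eq algebra_simps sum_subtractf)
  qed
  finally show ?thesis by (simp add: nev_T_def)
qed

subsection \<open>Logarithmic derivatives and logarithmic differences\<close>

text \<open>\<open>n(R, f) + n(R, 1/f)\<close>, with multiplicities, in classical notation.\<close>

definition total_order :: "(complex \<Rightarrow> complex) \<Rightarrow> real \<Rightarrow> real" where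
  "total_order f R = (\<Sum>a\<in>zeros_poles_in f R. \<bar>real_of_int (zorder f a)\<bar>)"

lemma ln_one_plus_le_add:
  fixes x y z :: real
  assumes "z \<ge> 0" "z \<le> x + y" "x \<ge> 0" "y \<ge> 0"
  shows "ln (1 + z) \<le> ln (1 + x) + ln (1 + y)"
proof -
  have "x * y \<ge> 0" using assms by simp
  then have "1 + z \<le> 1 + x + y + x * y" using assms(2) by linarith
  then have "1 + z \<le> (1 + x) * (1 + y)" by (simp add: algebra_simps)
  then have "ln (1 + z) \<le> ln ((1 + x) * (1 + y))" using assms by (intro ln_mono) auto
  also have "\<dots> = ln (1 + x) + ln (1 + y)" using assms by (intro ln_mult_pos) auto
  finally show ?thesis .
qed

text \<open>Bernoulli's inequality; it lets a zero of multiplicity \<open>k\<close> be treated as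
  \<open>k\<close> simple kernels.\<close>

lemma ln_one_plus_mult_le:
  assumes "x \<ge> 0"
  shows "ln (1 + real k * x) \<le> real k * ln (1 + x)"
proof -
  have "1 + real k * x \<le> (1 + x) ^ k" using Bernoulli_inequality[of x k] assms by simp
  then have "ln (1 + real k * x) \<le> ln ((1 + x) ^ k)" using assms by (intro ln_mono) (auto intro: add_pos_nonneg)
  then show ?thesis using assms by (simp add: ln_realpow)
qed

lemma ln_one_plus_zorder:
  assumes "x \<ge> 0" "y \<ge> 0"
  shows "ln (1 + \<bar>real_of_int k\<bar> * (x + y)) \<le> \<bar>real_of_int k\<bar> * (ln (1 + x) + ln (1 + y))"
proof -
  have "ln (1 + \<bar>real_of_int k\<bar> * (x + y)) = ln (1 + real (nat \<bar>k\<bar>) * (x + y))" by simp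
  also have "\<dots> \<le> real (nat \<bar>k\<bar>) * ln (1 + (x + y))" by (rule ln_one_plus_mult_le) (use assms in auto)
  also have "\<dots> = \<bar>real_of_int k\<bar> * ln (1 + (x + y))" by simp
  also have "ln (1 + (x + y)) \<le> ln ((1 + x) * (1 + y))"
    using assms by (intro ln_mono) (auto simp: algebra_simps)
  also have "ln ((1 + x) * (1 + y)) = ln (1 + x) + ln (1 + y)"
    using assms by (intro ln_mult_pos) auto
  finally show ?thesis by (simp add: mult_left_mono)
qed

lemma continuous_on_ln_kernel:
  assumes "norm w \<noteq> r" "k \<ge> 0"
  shows "continuous_on (sphere 0 r) (\<lambda>z. ln (1 + k / norm (z - w)))"
proof -
  have "1 + k / norm (z - w) > 0" for z using assms by (intro add_pos_nonneg) auto
  then show ?thesis using assms by (intro continuous_intros) (auto simp: less_imp_neq[THEN not_sym])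
qed

text \<open>Common core of the logarithmic derivative and the logarithmic difference estimate:
  the zeros and poles only enter through kernels \<open>ln (1 + k / |z - w|)\<close>, whose circle means are
  \<open>O(ln r / r)\<close>, and the zero-free part only through a Poisson integral.\<close>
lemma m_le_of_pointwise:
  assumes f: "nonzero_mero f" and r: "0 < r" "r < R" and g: "circle_regular f R" and k: "k > 0"
    and cv: "continuous_on (sphere 0 r) v"
    and pw: "\<And>z. norm z = r \<Longrightarrow> v z \<le> A * poisson R (\<lambda>\<zeta>. \<bar>ln (norm (f \<zeta>))\<bar>) z
       + (\<Sum>a\<in>zeros_poles_in f R. \<bar>real_of_int (zorder f a)\<bar> * (ln (1 + k / norm (z - p a)) + \<epsilon> a * ln (1 + k / norm (z - q a))))"
    and pq: "\<And>a. a \<in> zeros_poles_in f R \<Longrightarrow> norm (p a) \<noteq> r" "\<And>a. a \<in> zeros_poles_in f R \<Longrightarrow> norm (q a) \<noteq> r"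
    and eps: "\<And>a. 0 \<le> \<epsilon> a" "\<And>a. \<epsilon> a \<le> 1"
  shows "circle_mean r v \<le> A * (nev_m R f + nev_m R (\<lambda>z. inverse (f z))) + 2 * (k / r * (1 + ln (1 + r / k))) * total_order f R"
proof -
  let ?Z = "zeros_poles_in f R" and ?L = "k / r * (1 + ln (1 + r / k))"
  let ?K = "\<lambda>a z. \<bar>real_of_int (zorder f a)\<bar> * (ln (1 + k / norm (z - p a)) + \<epsilon> a * ln (1 + k / norm (z - q a)))"
  have fin: "finite ?Z" by (rule finite_zeros_poles[OF f])
  have R: "R > 0" using r by simp
  have cl: "continuous_on (sphere 0 R) (\<lambda>\<zeta>. \<bar>ln (norm (f \<zeta>))\<bar>)"
    by (intro continuous_on_rabs continuous_ln_circle_regular g)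
  have cp: "continuous_on (sphere 0 r) (poisson R (\<lambda>\<zeta>. \<bar>ln (norm (f \<zeta>))\<bar>))"
    by (rule continuous_on_poisson_sphere[OF r(2) cl])
  have cP: "continuous_on (sphere 0 r) (\<lambda>z. A * poisson R (\<lambda>\<zeta>. \<bar>ln (norm (f \<zeta>))\<bar>) z)"
    by (intro continuous_on_mult continuous_on_const cp)
  have cK: "continuous_on (sphere 0 r) (?K a)" if "a \<in> ?Z" for a
    using k pq[OF that] by (intro continuous_on_mult continuous_on_const continuous_on_add continuous_on_ln_kernel) auto
  have cS: "continuous_on (sphere 0 r) (\<lambda>z. \<Sum>a\<in>?Z. ?K a z)" by (intro continuous_on_sum cK)
  have L0: "?L \<ge> 0" using r k by (intro mult_nonneg_nonneg add_nonneg_nonneg ln_ge_zero) auto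
  have "circle_mean r v \<le> circle_mean r (\<lambda>z. A * poisson R (\<lambda>\<zeta>. \<bar>ln (norm (f \<zeta>))\<bar>) z + (\<Sum>a\<in>?Z. ?K a z))"
    using r pw by (intro circle_mean_mono cv continuous_on_add cP cS) auto
  also have "\<dots> = circle_mean r (\<lambda>z. A * poisson R (\<lambda>\<zeta>. \<bar>ln (norm (f \<zeta>))\<bar>) z) + (\<Sum>a\<in>?Z. circle_mean r (?K a))"
    using r fin cK by (simp add: circle_mean_add[OF _ cP cS] circle_mean_sum)
  also have "circle_mean r (\<lambda>z. A * poisson R (\<lambda>\<zeta>. \<bar>ln (norm (f \<zeta>))\<bar>) z) = A * (nev_m R f + nev_m R (\<lambda>z. inverse (f z)))"
    using r g R cl by (simp add: circle_mean_cmult circle_mean_poisson circle_mean_abs_ln_eq_m)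
  also have "(\<Sum>a\<in>?Z. circle_mean r (?K a)) \<le> (\<Sum>a\<in>?Z. \<bar>real_of_int (zorder f a)\<bar> * (2 * ?L))"
  proof (intro sum_mono)
    fix a assume a: "a \<in> ?Z"
    have c1: "continuous_on (sphere 0 r) (\<lambda>z. ln (1 + k / norm (z - p a)))"
      "continuous_on (sphere 0 r) (\<lambda>z. \<epsilon> a * ln (1 + k / norm (z - q a)))"
      using k pq[OF a] by (intro continuous_on_ln_kernel continuous_on_mult continuous_on_const; simp)+
    have "circle_mean r (?K a) = \<bar>real_of_int (zorder f a)\<bar> *
        (circle_mean r (\<lambda>z. ln (1 + k / norm (z - p a))) + \<epsilon> a * circle_mean r (\<lambda>z. ln (1 + k / norm (z - q a))))"
      using r by (simp only: circle_mean_cmult circle_mean_add[OF _ c1] less_imp_le)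
    \<comment> \<open>Each zero or pole brings one kernel for itself and at most one for its
      reflected point, hence the factor 2.\<close>
    also have "\<dots> \<le> \<bar>real_of_int (zorder f a)\<bar> * (?L + 1 * ?L)"
      using eps by (intro mult_left_mono add_mono mult_mono circle_mean_ln_kernel_le r k pq a L0)
         (auto intro!: circle_mean_nonneg ln_ge_zero simp: r k less_imp_le)
    finally show "circle_mean r (?K a) \<le> \<bar>real_of_int (zorder f a)\<bar> * (2 * ?L)" by simp
  qed
  also have "\<dots> = 2 * ?L * total_order f R" by (simp only: total_order_def sum_distrib_right[symmetric] mult.commute)
  finally show ?thesis by simp
qed

lemma poisson_Re_eq_ln:
  assumes "circle_regular f R" "R > 0" "nonzero_mero f"
   "\<And>z. norm z \<le> R \<Longrightarrow> regular_at f z \<Longrightarrow> f z = exp (h z) * (\<Prod>a\<in>zeros_poles_in f R. blaschke_factor R a z powi zorder f a)"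
  shows "poisson R (\<lambda>\<zeta>. \<bar>Re (h \<zeta>)\<bar>) z = poisson R (\<lambda>\<zeta>. \<bar>ln (norm (f \<zeta>))\<bar>) z"
  unfolding poisson_def
proof (rule circle_mean_cong)
  fix w :: complex assume w: "norm w = R"
  then have "regular_at f w" using assms by (auto simp: circle_regular_def)
  then have "ln (norm (f w)) = Re (h w)"
    using w assms(4)[of w] by (intro ln_norm_factorization_circle[OF _ assms(1,2) w assms(3)]) auto
  then show "\<bar>Re (h w)\<bar> * poisson_kernel w z = \<bar>ln (norm (f w))\<bar> * poisson_kernel w z" by simp
qed (use assms in auto)

lemma log_deriv_prod:
  assumes "finite A" "\<And>a. a \<in> A \<Longrightarrow> (g a has_field_derivative (d a * g a z)) (at z)"
  shows "((\<lambda>z. \<Prod>a\<in>A. g a z) has_field_derivative ((\<Sum>a\<in>A. d a) * (\<Prod>a\<in>A. g a z))) (at z)"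
  using assms
proof (induction A rule: finite_induct)
  case (insert x A)
  have "((\<lambda>z. g x z * (\<Prod>a\<in>A. g a z)) has_field_derivative
     (d x * g x z) * (\<Prod>a\<in>A. g a z) + ((\<Sum>a\<in>A. d a) * (\<Prod>a\<in>A. g a z)) * g x z) (at z)"
    using insert by (intro DERIV_mult) auto
  then show ?case using insert by (simp add: algebra_simps)
qed auto

lemma blaschke_factor_deriv:
  assumes "R > 0" "norm a * norm z < R^2" "z \<noteq> a"
  shows "(blaschke_factor R a has_field_derivative ((1 / (z - a) + cnj a / (of_real (R^2) - cnj a * z)) * blaschke_factor R a z)) (at z)"
proof -
  have nz: "of_real (R^2) - cnj a * z \<noteq> 0" by (rule blaschke_factor_denom[OF assms(2)])
  have "((\<lambda>z. of_real R * (z - a) / (of_real (R^2) - cnj a * z)) has_field_derivative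
     ((of_real R * (of_real (R^2) - cnj a * z) - of_real R * (z - a) * (- cnj a)) /
      ((of_real (R^2) - cnj a * z) * (of_real (R^2) - cnj a * z)))) (at z)"
    by (rule DERIV_divide) (use nz in \<open>auto intro!: derivative_eq_intros\<close>)
  also have "(of_real R * (of_real (R^2) - cnj a * z) - of_real R * (z - a) * (- cnj a)) /
      ((of_real (R^2) - cnj a * z) * (of_real (R^2) - cnj a * z))
      = (1 / (z - a) + cnj a / (of_real (R^2) - cnj a * z)) * blaschke_factor R a z"
  proof -
    define D where "D = of_real (R^2) - cnj a * z"
    have "D \<noteq> 0" "z - a \<noteq> 0" using nz assms by (auto simp: D_def)
    then have "(of_real R * D - of_real R * (z - a) * (- cnj a)) / (D * D) = (1 / (z - a) + cnj a / D) * (of_real R * (z - a) / D)"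
      by (simp add: field_simps)
    then show ?thesis by (simp only: D_def blaschke_factor_def)
  qed
  finally show ?thesis unfolding blaschke_factor_def[abs_def] .
qed

lemma regular_at_nhds: "regular_at f z \<Longrightarrow> eventually (regular_at f) (nhds z)"
proof -
  assume z: "regular_at f z"
  then obtain S where S: "open S" "z \<in> S" "f holomorphic_on S" unfolding regular_at_def analytic_at by auto
  then have an: "f analytic_on {w}" if "w \<in> S" for w using that analytic_at by blast
  have "open {w \<in> S. f w \<noteq> 0}"
    using continuous_open_preimage[OF holomorphic_on_imp_continuous_on[OF S(3)] S(1), of "-{0}"]
    by (simp add: vimage_def Int_def open_Compl)
  then have "eventually (\<lambda>w. w \<in> {w \<in> S. f w \<noteq> 0}) (nhds z)"
    using S z by (intro eventually_nhds_in_open) (auto simp: regular_at_def)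
  then show ?thesis by eventually_elim (use an in \<open>auto simp: regular_at_def\<close>)
qed

text \<open>In the Blaschke factorization \<open>f'/f\<close> is \<open>h'\<close> plus, for each
  zero or pole, a simple fraction at the point and one at its reflection in the circle.
  \<open>norm_deriv_le_poisson\<close> controls \<open>h'\<close>, and the fractions produce kernels
  of width \<open>k = 1\<close>.\<close>

theorem log_derivative_estimate:
  assumes f: "nonzero_mero f" and r: "0 < r" "r < R" and g: "circle_regular f r" "circle_regular f R"
  shows "nev_m r (\<lambda>z. deriv f z / f z) \<le>
    4 / (R - r) * (nev_m R f + nev_m R (\<lambda>z. inverse (f z))) + 2 * (1 / r * (1 + ln (1 + r))) * total_order f R"
proof -
  have R: "R > 0" using r by simp
  from blaschke_factorization[OF f R g(2)]
  obtain h R' where h: "R < R'" "h holomorphic_on ball 0 R'"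
    "\<And>z. norm z \<le> R \<Longrightarrow> regular_at f z \<Longrightarrow> f z = exp (h z) * (\<Prod>a\<in>zeros_poles_in f R. blaschke_factor R a z powi zorder f a)"
    by metis
  let ?Z = "zeros_poles_in f R"
  have fin: "finite ?Z" by (rule finite_zeros_poles[OF f])
  have ra: "norm a \<noteq> r" if "a \<in> ?Z" for a
    using that g(1) regular_at_zorder[of f a] by (auto simp: zeros_poles_in_def circle_regular_def)
  have aR: "norm a < R" if "a \<in> ?Z" for a using zeros_poles_in_less[OF g(2) that] .
  \<comment> \<open>The reflected point. For \<open>a = 0\<close> it lies at infinity; division by
    zero puts \<open>q 0 = 0\<close>, and \<epsilon> switches that kernel off.\<close>
  define q where "q = (\<lambda>a. of_real (R^2) / cnj a)"
  define \<epsilon> :: "complex \<Rightarrow> real" where "\<epsilon> = (\<lambda>a. if a = 0 then 0 else 1)"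
  have q: "norm (q a) \<noteq> r" if a: "a \<in> ?Z" for a
  proof (cases "a = 0")
    case False
    then have "norm (q a) > R" using aR[OF a] R by (simp add: q_def norm_divide norm_power pos_less_divide_eq, simp add: power2_eq_square)
    then show ?thesis using r by simp
  qed (use r in \<open>auto simp: q_def\<close>)
  have reg: "regular_at f z" if "norm z = r" for z using g(1) that by (auto simp: circle_regular_def)
  have pw: "log_plus (norm (deriv f z / f z)) \<le> 4 / (R - r) * poisson R (\<lambda>\<zeta>. \<bar>ln (norm (f \<zeta>))\<bar>) z
       + (\<Sum>a\<in>?Z. \<bar>real_of_int (zorder f a)\<bar> * (ln (1 + 1 / norm (z - a)) + \<epsilon> a * ln (1 + 1 / norm (z - q a))))"
    if z: "norm z = r" for z
  proof -
    have lt: "norm a * norm z < R^2" if "a \<in> ?Z" for a using blaschke_factor_prod_less[OF aR[OF that], of z] z r by simp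
    have za: "z \<noteq> a" if "a \<in> ?Z" for a using ra[OF that] z by auto
    define B where "B = (\<lambda>z. \<Prod>a\<in>?Z. blaschke_factor R a z powi zorder f a)"
    define e where "e = (\<lambda>a. of_int (zorder f a) * (1 / (z - a) + cnj a / (of_real (R^2) - cnj a * z)))"
    have "((\<lambda>z. blaschke_factor R a z powi zorder f a) has_field_derivative e a * blaschke_factor R a z powi zorder f a) (at z)" if a: "a \<in> ?Z" for a
    proof -
      have nz: "blaschke_factor R a z \<noteq> 0" using blaschke_factor_nz[OF R lt[OF a] za[OF a]] .
      have "((\<lambda>z. blaschke_factor R a z powi zorder f a) has_field_derivative
        of_int (zorder f a) * blaschke_factor R a z powi (zorder f a - 1) * ((1 / (z - a) + cnj a / (of_real (R^2) - cnj a * z)) * blaschke_factor R a z)) (at z)"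
        by (rule DERIV_power_int[OF blaschke_factor_deriv[OF R lt[OF a] za[OF a]] disjI2[OF nz]])
      then show ?thesis using nz by (simp add: e_def power_int_diff mult_ac)
    qed
    then have dB: "(B has_field_derivative (\<Sum>a\<in>?Z. e a) * B z) (at z)"
      unfolding B_def by (intro log_deriv_prod fin)
    have dh: "(h has_field_derivative deriv h z) (at z)"
      by (rule holomorphic_derivI[OF h(2)]) (use z r h in auto)
    have dF: "((\<lambda>z. exp (h z) * B z) has_field_derivative ((deriv h z + (\<Sum>a\<in>?Z. e a)) * (exp (h z) * B z))) (at z)"
      by (rule derivative_eq_intros dh dB refl)+ (simp add: algebra_simps)
    \<comment> \<open>The factorization holds near \<open>z\<close> and not only at
      \<open>z\<close>, so it may be differentiated.\<close>
    have ev: "eventually (\<lambda>w. exp (h w) * B w = f w) (nhds z)"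
    proof -
      have "eventually (\<lambda>w. w \<in> ball 0 R) (nhds z)" by (rule eventually_nhds_in_open) (use z r in auto)
      with regular_at_nhds[OF reg[OF z]] show ?thesis
        by eventually_elim (use h(3) in \<open>auto simp: B_def\<close>)
    qed
    have "(f has_field_derivative ((deriv h z + (\<Sum>a\<in>?Z. e a)) * (exp (h z) * B z))) (at z)"
      by (rule DERIV_cong_ev[OF refl ev refl, THEN iffD1, OF dF])
    then have "deriv f z = (deriv h z + (\<Sum>a\<in>?Z. e a)) * f z"
      using h(3)[of z] reg[OF z] z r by (simp add: DERIV_imp_deriv B_def)
    then have "deriv f z / f z = deriv h z + (\<Sum>a\<in>?Z. e a)"
      using reg[OF z] by (simp add: regular_at_def)
    then have "norm (deriv f z / f z) \<le> norm (deriv h z) + (\<Sum>a\<in>?Z. norm (e a))"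
      using norm_triangle_ineq[of "deriv h z" "\<Sum>a\<in>?Z. e a"] norm_sum[of e ?Z] by simp
    also have "(\<Sum>a\<in>?Z. norm (e a)) \<le> (\<Sum>a\<in>?Z. \<bar>real_of_int (zorder f a)\<bar> * (1 / norm (z - a) + \<epsilon> a * (1 / norm (z - q a))))"
    proof (intro sum_mono)
      fix a assume a: "a \<in> ?Z"
      have "norm (cnj a / (of_real (R^2) - cnj a * z)) = \<epsilon> a * (1 / norm (z - q a))"
      proof (cases "a = 0")
        case False
        then have "of_real (R^2) - cnj a * z = cnj a * (q a - z)" by (simp add: q_def algebra_simps)
        then show ?thesis using False by (simp add: \<epsilon>_def norm_divide norm_mult norm_minus_commute)
      qed (simp add: \<epsilon>_def)
      then have "norm (1 / (z - a) + cnj a / (of_real (R^2) - cnj a * z)) \<le> 1 / norm (z - a) + \<epsilon> a * (1 / norm (z - q a))"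
        using norm_triangle_ineq[of "1 / (z - a)" "cnj a / (of_real (R^2) - cnj a * z)"] by (simp add: norm_divide)
      then show "norm (e a) \<le> \<bar>real_of_int (zorder f a)\<bar> * (1 / norm (z - a) + \<epsilon> a * (1 / norm (z - q a)))"
        unfolding e_def norm_mult by (simp add: mult_left_mono)
    qed
    finally have b: "norm (deriv f z / f z) \<le> norm (deriv h z) + (\<Sum>a\<in>?Z. \<bar>real_of_int (zorder f a)\<bar> * (1 / norm (z - a) + \<epsilon> a * (1 / norm (z - q a))))" (is "_ \<le> ?H + ?S") by simp
    have S0: "?S \<ge> 0" by (intro sum_nonneg mult_nonneg_nonneg add_nonneg_nonneg) (auto simp: \<epsilon>_def)
    have "log_plus (norm (deriv f z / f z)) \<le> ln (1 + norm (deriv f z / f z))" by (rule log_plus_le_ln_one_plus) auto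
    also have "\<dots> \<le> ln (1 + ?H) + ln (1 + ?S)" by (rule ln_one_plus_le_add[OF _ b]) (use S0 in auto)
    also have "ln (1 + ?H) \<le> ?H" by (rule ln_add_one_self_le_self) auto
    also have "?H \<le> 4 / (R - norm z) * poisson R (\<lambda>\<zeta>. \<bar>Re (h \<zeta>)\<bar>) z"
      by (rule norm_deriv_le_poisson[OF h(2,1)]) (use z r in auto)
    also have "poisson R (\<lambda>\<zeta>. \<bar>Re (h \<zeta>)\<bar>) z = poisson R (\<lambda>\<zeta>. \<bar>ln (norm (f \<zeta>))\<bar>) z"
      by (rule poisson_Re_eq_ln[OF g(2) R f h(3)])
    also have "ln (1 + ?S) \<le> (\<Sum>a\<in>?Z. ln (1 + \<bar>real_of_int (zorder f a)\<bar> * (1 / norm (z - a) + \<epsilon> a * (1 / norm (z - q a)))))"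
      by (rule ln_one_plus_sum_le[OF fin]) (auto simp: \<epsilon>_def)
    also have "\<dots> \<le> (\<Sum>a\<in>?Z. \<bar>real_of_int (zorder f a)\<bar> * (ln (1 + 1 / norm (z - a)) + \<epsilon> a * ln (1 + 1 / norm (z - q a))))"
    proof (intro sum_mono)
      fix a
      have "ln (1 + \<bar>real_of_int (zorder f a)\<bar> * (1 / norm (z - a) + \<epsilon> a * (1 / norm (z - q a))))
        \<le> \<bar>real_of_int (zorder f a)\<bar> * (ln (1 + 1 / norm (z - a)) + ln (1 + \<epsilon> a * (1 / norm (z - q a))))"
        by (rule ln_one_plus_zorder) (auto simp: \<epsilon>_def)
      also have "ln (1 + \<epsilon> a * (1 / norm (z - q a))) = \<epsilon> a * ln (1 + 1 / norm (z - q a))" by (simp add: \<epsilon>_def)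
      finally show "ln (1 + \<bar>real_of_int (zorder f a)\<bar> * (1 / norm (z - a) + \<epsilon> a * (1 / norm (z - q a))))
        \<le> \<bar>real_of_int (zorder f a)\<bar> * (ln (1 + 1 / norm (z - a)) + \<epsilon> a * ln (1 + 1 / norm (z - q a)))" .
    qed
    finally show ?thesis using z by simp
  qed
  have "continuous_on (sphere 0 r) (\<lambda>z. deriv f z / f z)"
    using reg by (intro continuous_at_imp_continuous_on ballI analytic_at_imp_isCont analytic_intros)
       (auto simp: regular_at_def intro: analytic_deriv)
  then have cv: "continuous_on (sphere 0 r) (\<lambda>z. log_plus (norm (deriv f z / f z)))"
    by (intro continuous_log_plus continuous_on_norm)
  show ?thesis
    unfolding nev_m_eq[of r]
    using m_le_of_pointwise[OF f r g(2) zero_less_one cv pw ra q] by (simp add: \<epsilon>_def)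
qed

text \<open>The same scheme for \<open>ln |f(z + c)| - ln |f z|\<close>. The gap exceeds
  \<open>2 |c|\<close>, so \<open>z + c\<close> stays in the disc, and every linear factor changes
  its logarithm by at most \<open>ln (1 + |c| / distance)\<close>; the kernels therefore have width
  \<open>|c|\<close>.\<close>

theorem log_difference_estimate:
  assumes f: "nonzero_mero f" and r: "0 < r" "2 * norm c < R - r" and g: "circle_regular f r" "circle_regular (\<lambda>z. f (z + c)) r" "circle_regular f R"
    and c: "c \<noteq> 0"
  shows "nev_m r (\<lambda>z. f (z + c) / f z) \<le>
    4 * norm c / (R - r) * (nev_m R f + nev_m R (\<lambda>z. inverse (f z)))
      + 2 * (norm c / r * (1 + ln (1 + r / norm c))) * total_order f R"
proof -
  have rR: "r < R" using r by (smt (verit) norm_ge_zero)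
  have R: "R > 0" using r rR by simp
  from blaschke_factorization[OF f R g(3)]
  obtain h R' where h: "R < R'" "h holomorphic_on ball 0 R'"
    "\<And>z. norm z \<le> R \<Longrightarrow> regular_at f z \<Longrightarrow> f z = exp (h z) * (\<Prod>a\<in>zeros_poles_in f R. blaschke_factor R a z powi zorder f a)"
    by metis
  let ?Z = "zeros_poles_in f R"
  have fin: "finite ?Z" by (rule finite_zeros_poles[OF f])
  have reg: "regular_at f z" if "norm z = r" for z using g(1) that by (auto simp: circle_regular_def)
  have regc: "regular_at f (z + c)" if "norm z = r" for z
  proof -
    have "regular_at (\<lambda>z. f (z + c)) z" using g(2) that by (auto simp: circle_regular_def)
    moreover have "((\<lambda>z. f (z + c)) \<circ> (\<lambda>w. w - c)) analytic_on {z + c}" if "(\<lambda>z. f (z + c)) analytic_on {z}"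
      by (rule analytic_on_compose) (use that in \<open>auto intro!: analytic_intros\<close>)
    ultimately show ?thesis by (auto simp: regular_at_def o_def)
  qed
  have ra: "norm a \<noteq> r" if "a \<in> ?Z" for a
    using that reg[of a] regular_at_zorder[of f a] by (auto simp: zeros_poles_in_def)
  have rac: "norm (a - c) \<noteq> r" if "a \<in> ?Z" for a
    using that regc[of "a - c"] regular_at_zorder[of f a] by (auto simp: zeros_poles_in_def)
  have aR: "norm a < R" if "a \<in> ?Z" for a using zeros_poles_in_less[OF g(3) that] .
  define s where "s = (\<lambda>a. of_real (R^2) / cnj a)"
  \<comment> \<open>The kernel is centred where the denominator of the relevant quotient vanishes:
    at \<open>a\<close> for a zero of \<open>f\<close>, at \<open>a - c\<close> for a pole. The
    reflected points enter with the opposite sign, so in \<open>q\<close> the roles are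
    exchanged.\<close>
  define p where "p = (\<lambda>a. if zorder f a > 0 then a else a - c)"
  define q where "q = (\<lambda>a. if a = 0 then 0 else if zorder f a > 0 then s a - c else s a)"
  define \<epsilon> :: "complex \<Rightarrow> real" where "\<epsilon> = (\<lambda>a. if a = 0 then 0 else 1)"
  have sR: "norm (s a) > R" if "a \<in> ?Z" "a \<noteq> 0" for a
    using that(2) aR[OF that(1)] R by (simp add: s_def norm_divide norm_power pos_less_divide_eq, simp add: power2_eq_square)
  have p: "norm (p a) \<noteq> r" if a: "a \<in> ?Z" for a using ra[OF a] rac[OF a] by (auto simp: p_def)
  \<comment> \<open>Shifted reflected points also stay off the circle:
    \<open>|s a - c| > R - |c| > r\<close>.\<close>
  have q: "norm (q a) \<noteq> r" if a: "a \<in> ?Z" for a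
    using sR[OF a] norm_triangle_ineq2[of "s a" c] r rR norm_ge_zero[of c] unfolding q_def
    by (smt (verit) norm_zero)
  have lnb: "ln (norm y) - ln (norm x) \<le> ln (1 + norm c / norm x)" if "x \<noteq> 0" "y \<noteq> 0" "norm (y - x) = norm c" for x y :: complex
  proof -
    have "norm y \<le> norm x + norm c" using norm_triangle_ineq[of x "y - x"] that by simp
    also have "\<dots> = norm x * (1 + norm c / norm x)" using that by (simp add: field_simps)
    finally have "ln (norm y) \<le> ln (norm x * (1 + norm c / norm x))" using that by (intro ln_mono) auto
    also have "\<dots> = ln (norm x) + ln (1 + norm c / norm x)"
      using that by (intro ln_mult_pos) (auto intro!: add_pos_nonneg)
    finally show ?thesis by simp
  qed
  have pw: "log_plus (norm (f (z + c) / f z)) \<le> 4 * norm c / (R - r) * poisson R (\<lambda>\<zeta>. \<bar>ln (norm (f \<zeta>))\<bar>) z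
       + (\<Sum>a\<in>?Z. \<bar>real_of_int (zorder f a)\<bar> * (ln (1 + norm c / norm (z - p a)) + \<epsilon> a * ln (1 + norm c / norm (z - q a))))"
    (is "_ \<le> ?P + (\<Sum>a\<in>?Z. ?K a)") if z: "norm z = r" for z
  proof -
    have zc: "norm (z + c) < R" using norm_triangle_ineq[of z c] r z norm_ge_zero[of c] by linarith
    have za: "z - a \<noteq> 0" "z + c - a \<noteq> 0" if "a \<in> ?Z" for a
    proof -
      show "z - a \<noteq> 0" using ra[OF that] z by auto
      show "z + c - a \<noteq> 0"
      proof
        assume "z + c - a = 0"
        then have "a - c = z" by (simp add: algebra_simps)
        then show False using rac[OF that] z by simp
      qed
    qed
    have zs: "w - s a \<noteq> 0" if "a \<in> ?Z" "a \<noteq> 0" "norm w < R" for a w using sR[OF that(1,2)] that(3) by auto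
    have lnbl: "ln (norm (blaschke_factor R a w)) = ln R + ln (norm (w - a)) - \<epsilon> a * (ln (norm a) + ln (norm (w - s a))) - (1 - \<epsilon> a) * ln (R^2)"
      if a: "a \<in> ?Z" and w: "norm w < R" "w \<noteq> a" for a w
    proof (cases "a = 0")
      case True
      then show ?thesis using w R by (simp add: blaschke_factor_def \<epsilon>_def norm_divide norm_mult norm_power ln_div ln_mult)
    next
      case False
      then have eq: "of_real (R^2) - cnj a * w = cnj a * (s a - w)" by (simp add: s_def algebra_simps)
      show ?thesis using False w R zs[OF a False w(1)] unfolding blaschke_factor_def eq
        by (simp add: \<epsilon>_def norm_divide norm_mult ln_div ln_mult norm_minus_commute)
    qed
    have "ln (norm (f (z + c) / f z)) = ln (norm (f (z + c))) - ln (norm (f z))"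
      using reg[OF z] regc[OF z] by (simp add: regular_at_def norm_divide ln_div)
    also have "ln (norm (f (z + c))) = Re (h (z + c)) + (\<Sum>a\<in>?Z. zorder f a * ln (norm (blaschke_factor R a (z + c))))"
      by (rule ln_norm_factorization) (use zc h regc[OF z] g R f in auto)
    also have "ln (norm (f z)) = Re (h z) + (\<Sum>a\<in>?Z. zorder f a * ln (norm (blaschke_factor R a z)))"
      by (rule ln_norm_factorization) (use z rR h reg[OF z] g R f in auto)
    finally have "ln (norm (f (z + c) / f z)) = (Re (h (z + c)) - Re (h z)) +
       (\<Sum>a\<in>?Z. zorder f a * (ln (norm (blaschke_factor R a (z + c))) - ln (norm (blaschke_factor R a z))))"
      by (simp add: right_diff_distrib sum_subtractf)
    also have "Re (h (z + c)) - Re (h z) \<le> 4 * norm c / (R - norm z) * poisson R (\<lambda>\<zeta>. \<bar>Re (h \<zeta>)\<bar>) z"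
      using Re_diff_le_poisson[OF h(2,1), of z c] z rR r by simp
    also have "\<dots> = ?P" using poisson_Re_eq_ln[OF g(3) R f h(3)] z by simp
    also have "(\<Sum>a\<in>?Z. zorder f a * (ln (norm (blaschke_factor R a (z + c))) - ln (norm (blaschke_factor R a z)))) \<le> (\<Sum>a\<in>?Z. ?K a)"
    proof (intro sum_mono)
      fix a assume a: "a \<in> ?Z"
      have zR: "norm z < R" using z rR by simp
      have d: "ln (norm (blaschke_factor R a (z + c))) - ln (norm (blaschke_factor R a z)) =
        (ln (norm (z + c - a)) - ln (norm (z - a))) + \<epsilon> a * (ln (norm (z - s a)) - ln (norm (z + c - s a)))"
        using za[OF a] by (subst (1 2) lnbl[OF a]) (use zc zR in \<open>auto simp: algebra_simps\<close>)
      show "zorder f a * (ln (norm (blaschke_factor R a (z + c))) - ln (norm (blaschke_factor R a z))) \<le> ?K a"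
      proof (cases "zorder f a > 0")
        case True
        have 1: "ln (norm (z + c - a)) - ln (norm (z - a)) \<le> ln (1 + norm c / norm (z - p a))"
          using lnb[of "z - a" "z + c - a"] za[OF a] True by (simp add: p_def)
        have 2: "\<epsilon> a * (ln (norm (z - s a)) - ln (norm (z + c - s a))) \<le> \<epsilon> a * ln (1 + norm c / norm (z - q a))"
          using lnb[of "z + c - s a" "z - s a"] zs[OF a _ zc] zs[OF a _ zR] True by (simp add: q_def \<epsilon>_def diff_diff_eq2 add.commute)
        show ?thesis unfolding d using True 1 2 by (simp add: mult_left_mono)
      next
        case False
        have 1: "ln (norm (z - a)) - ln (norm (z + c - a)) \<le> ln (1 + norm c / norm (z - p a))"
          using lnb[of "z + c - a" "z - a"] za[OF a] False by (simp add: p_def diff_diff_eq2 add.commute)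
        have 2: "\<epsilon> a * (ln (norm (z + c - s a)) - ln (norm (z - s a))) \<le> \<epsilon> a * ln (1 + norm c / norm (z - q a))"
          using lnb[of "z - s a" "z + c - s a"] zs[OF a _ zc] zs[OF a _ zR] False by (simp add: q_def \<epsilon>_def)
        have "zorder f a * ((ln (norm (z + c - a)) - ln (norm (z - a))) + \<epsilon> a * (ln (norm (z - s a)) - ln (norm (z + c - s a))))
          = \<bar>real_of_int (zorder f a)\<bar> * ((ln (norm (z - a)) - ln (norm (z + c - a))) + \<epsilon> a * (ln (norm (z + c - s a)) - ln (norm (z - s a))))"
          using False by (simp add: algebra_simps)
        also have "\<dots> \<le> ?K a" by (rule mult_left_mono[OF add_mono[OF 1 2]]) simp
        finally show ?thesis unfolding d .
      qed
    qed
    finally have "ln (norm (f (z + c) / f z)) \<le> ?P + (\<Sum>a\<in>?Z. ?K a)" by simp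
    moreover have "?P \<ge> 0" using r rR R z
      by (intro mult_nonneg_nonneg poisson_nonneg divide_nonneg_nonneg) auto
    moreover have "(\<Sum>a\<in>?Z. ?K a) \<ge> 0"
      by (intro sum_nonneg mult_nonneg_nonneg add_nonneg_nonneg ln_ge_zero) (auto simp: \<epsilon>_def)
    ultimately show ?thesis
      using reg[OF z] regc[OF z] by (subst log_plus_eq) (auto simp: regular_at_def)
  qed
  have "continuous_on (sphere 0 r) (\<lambda>z. f (z + c) / f z)"
    using continuous_circle_regular[OF g(1)] continuous_circle_regular[OF g(2)] reg
    by (intro continuous_on_divide) (auto simp: regular_at_def)
  then have cv: "continuous_on (sphere 0 r) (\<lambda>z. log_plus (norm (f (z + c) / f z)))"
    by (intro continuous_log_plus continuous_on_norm)
  have c0: "norm c > 0" using c by simp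
  show ?thesis
    unfolding nev_m_eq[of r]
    by (rule m_le_of_pointwise[OF f r(1) rR g(3) c0 cv pw p q]) (auto simp: \<epsilon>_def)
qed

subsection \<open>Estimates in terms of the gap between two radii\<close>

lemma ln_le_log_weight:
  assumes "1 \<le> r" "r < R" "norm a \<le> r"
  shows "ln (R / r) \<le> log_weight R a"
proof (cases "a = 0")
  case True
  have "ln r \<ge> 0" using assms by simp
  then show ?thesis using True assms by (simp add: log_weight_def ln_div)
next
  case False
  then have "ln (R / r) \<le> ln (R / norm a)" using assms by (intro ln_mono divide_left_mono) auto
  then show ?thesis using False by (simp add: log_weight_def)
qed

lemma ln_ratio_ge:
  fixes r R :: real
  assumes "0 < r" "r < R"
  shows "(R - r) / R \<le> ln (R / r)"
proof -
  have "ln (r / R) \<le> r / R - 1" by (rule ln_le_minus_one) (use assms in auto)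
  then show ?thesis using assms by (simp add: ln_div diff_divide_distrib)
qed

lemma log_count_ln_le:
  assumes D: "locally_finite_supp D" "\<And>a. D a \<ge> 0" and r: "1 \<le> r" "r < R"
  shows "ln (R / r) * (\<Sum>a\<in>supp_in D r. D a) \<le> log_count D R"
proof -
  have fin: "finite (supp_in D x)" for x using D by (auto simp: locally_finite_supp_def)
  have "ln (R / r) * (\<Sum>a\<in>supp_in D r. D a) = (\<Sum>a\<in>supp_in D r. D a * ln (R / r))"
    unfolding sum_distrib_left by (simp add: mult.commute)
  also have "\<dots> \<le> (\<Sum>a\<in>supp_in D r. D a * log_weight R a)"
    by (intro sum_mono mult_left_mono ln_le_log_weight r D) (auto simp: supp_in_def)
  also have "\<dots> \<le> log_count D R" unfolding log_count_def
    using r fin D by (intro sum_mono2 mult_nonneg_nonneg log_weight_nonneg) (auto simp: supp_in_def)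
  finally show ?thesis .
qed

text \<open>The usual bound of \<open>n(r)\<close> by \<open>N(R)\<close>, with
  \<open>ln (R / r)\<close> replaced by its lower bound \<open>(R - r) / R\<close>, which suits
  close radii. \<open>log_count_ln_le\<close> keeps the logarithm for radii that are far
  apart.\<close>

lemma log_count_sum_le:
  assumes D: "locally_finite_supp D" "\<And>a. D a \<ge> 0" and r: "1 \<le> r" "r < R"
  shows "(\<Sum>a\<in>supp_in D r. D a) \<le> R / (R - r) * log_count D R"
proof -
  have "(R - r) / R * (\<Sum>a\<in>supp_in D r. D a) \<le> ln (R / r) * (\<Sum>a\<in>supp_in D r. D a)"
    using ln_ratio_ge[of r R] r D by (intro mult_right_mono sum_nonneg) auto
  also have "\<dots> \<le> log_count D R" by (rule log_count_ln_le[OF D r])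
  finally show ?thesis using r by (simp add: field_simps)
qed

lemma locally_finite_supp_abs_zorder: "nonzero_mero f \<Longrightarrow> locally_finite_supp (\<lambda>a. \<bar>real_of_int (zorder f a)\<bar>)"
  by (rule locally_finite_supp_subset[OF locally_finite_supp_zorder]) auto

lemma total_order_eq: "total_order f R = (\<Sum>a\<in>supp_in (\<lambda>a. \<bar>real_of_int (zorder f a)\<bar>) R. \<bar>real_of_int (zorder f a)\<bar>)"
  unfolding total_order_def by (intro sum.cong) (auto simp: zeros_poles_in_def supp_in_def)

lemma log_count_abs_zorder:
  assumes "nonzero_mero f" "r > 0"
  shows "log_count (\<lambda>a. \<bar>real_of_int (zorder f a)\<bar>) r = nev_N r f + nev_N r (\<lambda>z. inverse (f z))"
proof -
  have "(\<lambda>a. \<bar>real_of_int (zorder f a)\<bar>) = (\<lambda>a. pole_ord f a + zero_ord f a)"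
    by (auto simp: pole_ord_def zero_ord_def)
  then show ?thesis
    using assms by (simp add: log_count_add locally_finite_supp_pole_ord locally_finite_supp_zero_ord nev_N_eq nonzero_mero_inverse pole_ord_inverse)
qed

lemma total_order_le:
  assumes f: "nonzero_mero f" and r: "1 \<le> R" "R < R'"
  shows "total_order f R \<le> R' / (R' - R) * (nev_N R' f + nev_N R' (\<lambda>z. inverse (f z)))"
  using log_count_sum_le[OF locally_finite_supp_abs_zorder[OF f] _ r] r log_count_abs_zorder[OF f, of R'] by (simp add: total_order_eq)

lemma total_order_ln_le:
  assumes f: "nonzero_mero f" and r: "1 \<le> R" "R < R'"
  shows "ln (R' / R) * total_order f R \<le> nev_N R' f + nev_N R' (\<lambda>z. inverse (f z))"
  using log_count_ln_le[OF locally_finite_supp_abs_zorder[OF f] _ r] r log_count_abs_zorder[OF f, of R'] by (simp add: total_order_eq)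

lemma ex_avoid_countable:
  fixes a b :: real
  assumes "countable B" "a < b"
  obtains x where "a < x" "x < b" "x \<notin> B"
proof -
  have "\<not> {a<..<b} \<subseteq> B"
    using assms uncountable_open_interval countable_subset by blast
  then obtain x where "x \<in> {a<..<b}" "x \<notin> B" by blast
  then show ?thesis using that[of x] by auto
qed

lemma ex_circle_regular:
  assumes "nonzero_mero f" "a < b"
  obtains x where "a < x" "x < b" "circle_regular f x"
  using ex_avoid_countable[OF countable_bad_radii[OF assms(1)] assms(2)] by auto

text \<open>The two intermediate radii come from the gap \<open>g\<close>: one carries the Poisson integral, the
  other one bounds the number of zeros and poles by the characteristic.\<close>
lemma gap_bound:
  assumes f: "nonzero_mero f" and C: "\<And>R. R \<ge> 1 \<Longrightarrow> circle_regular f R \<Longrightarrow> nev_T R f = nev_T R (\<lambda>z. inverse (f z)) + C"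
    and r: "1 \<le> r" and g: "0 < g" "g \<le> r" and R0: "r + g \<le> R0" "circle_regular f R0" and k: "k > 0"
    and M: "\<And>R. r + g / 4 < R \<Longrightarrow> circle_regular f R \<Longrightarrow> M \<le> 4 * k / (R - r) * (nev_m R f + nev_m R (\<lambda>z. inverse (f z)))
       + 2 * (k / r * (1 + ln (1 + r / k))) * total_order f R"
  shows "M \<le> (2 * nev_T R0 f + \<bar>C\<bar>) * (k * 16 * (2 + ln (1 + r / k)) / g)"
proof -
    \<comment> \<open>The choices make both \<open>R - r\<close> and \<open>R' - R\<close> larger
      than \<open>g / 4\<close>.\<close>
    obtain R where R: "r + g / 4 < R" "R < r + g / 2" "circle_regular f R"
      using ex_circle_regular[OF f, of "r + g/4" "r + g/2"] g by auto
    obtain R' where R': "r + 3 * g / 4 < R'" "R' < r + g" "circle_regular f R'"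
      using ex_circle_regular[OF f, of "r + 3 * g/4" "r + g"] g by auto
    have fi: "nonzero_mero (\<lambda>z. inverse (f z))" by (rule nonzero_mero_inverse[OF f])
    let ?T = "2 * nev_T R0 f + \<bar>C\<bar>"
    have T: "nev_T x f + nev_T x (\<lambda>z. inverse (f z)) \<le> ?T" if "r < x" "x < R0" "circle_regular f x" for x
    proof -
      have "nev_T x f \<le> nev_T R0 f" by (rule nev_T_mono[OF f]) (use that r R0 in auto)
      moreover have "nev_T x (\<lambda>z. inverse (f z)) = nev_T x f - C" using C[of x] that r by simp
      ultimately show ?thesis by linarith
    qed
    have m: "nev_m R f + nev_m R (\<lambda>z. inverse (f z)) \<le> ?T"
    proof -
      have "nev_N R f \<ge> 0" "nev_N R (\<lambda>z. inverse (f z)) \<ge> 0"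
        using R r g f fi by (auto simp: nev_N_eq pole_ord_def intro!: log_count_nonneg)
      then show ?thesis using T[of R] R R0 r g by (simp add: nev_T_def)
    qed
    have N: "nev_N R' f + nev_N R' (\<lambda>z. inverse (f z)) \<le> ?T"
    proof -
      have "nev_m R' f \<ge> 0" "nev_m R' (\<lambda>z. inverse (f z)) \<ge> 0"
        using R' r g by (auto intro!: nev_m_nonneg)
      then show ?thesis using T[of R'] R' R0 r g by (simp add: nev_T_def)
    qed
    have T0: "?T \<ge> 0" using nev_T_nonneg[OF f, of R0] R0 r g by simp
    \<comment> \<open>Since \<open>R' < r + g <= 2 r\<close>, there are at most
      \<open>8 r / g\<close> times \<open>?T\<close> zeros and poles; the factor \<open>r\<close> is
      cancelled by the \<open>1 / r\<close> of the kernel means.\<close>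
    have "total_order f R \<le> R' / (R' - R) * (nev_N R' f + nev_N R' (\<lambda>z. inverse (f z)))"
      by (rule total_order_le[OF f]) (use R R' r g in auto)
    also have "\<dots> \<le> (2 * r) / (g / 4) * ?T"
    proof (rule mult_mono)
      show "R' / (R' - R) \<le> 2 * r / (g / 4)" using R R' r g by (intro frac_le) auto
      show "0 \<le> nev_N R' f + nev_N R' (\<lambda>z. inverse (f z))"
        using R' r g f fi by (auto simp: nev_N_eq pole_ord_def intro!: log_count_nonneg add_nonneg_nonneg)
    qed (use N r g in auto)
    finally have n: "total_order f R \<le> 8 * r / g * ?T" by simp
    have L0: "1 + ln (1 + r / k) \<ge> 0" using r k by (intro add_nonneg_nonneg ln_ge_zero) auto
    have "M \<le> 4 * k / (R - r) * (nev_m R f + nev_m R (\<lambda>z. inverse (f z)))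
       + 2 * (k / r * (1 + ln (1 + r / k))) * total_order f R"
      by (rule M[OF R(1,3)])
    also have "\<dots> \<le> 4 * k / (g / 4) * ?T + 2 * (k / r * (1 + ln (1 + r / k))) * (8 * r / g * ?T)"
    proof (rule add_mono[OF mult_mono mult_left_mono])
      show "4 * k / (R - r) \<le> 4 * k / (g / 4)" using R g k by (intro divide_left_mono mult_pos_pos) auto
      show "0 \<le> nev_m R f + nev_m R (\<lambda>z. inverse (f z))" using R r g by (intro add_nonneg_nonneg nev_m_nonneg) auto
      show "0 \<le> 2 * (k / r * (1 + ln (1 + r / k)))" using L0 k r by (intro mult_nonneg_nonneg) auto
    qed (use m n k g in auto)
    \<comment> \<open>\<open>16 k / g\<close> from the Poisson term plus
      \<open>16 k (1 + ln (1 + r / k)) / g\<close> from the kernels.\<close>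
    also have "\<dots> = ?T * (k * 16 * (2 + ln (1 + r / k)) / g)"
      using r g by (simp add: field_simps)
    finally show ?thesis .
qed

corollary log_derivative_gap:
  assumes f: "nonzero_mero f"
  obtains C where "C \<ge> 0" "\<And>r g R0. \<lbrakk>1 \<le> r; 0 < g; g \<le> r; r + g \<le> R0; circle_regular f r; circle_regular f R0\<rbrakk> \<Longrightarrow>
     nev_m r (\<lambda>z. deriv f z / f z) \<le> (2 * nev_T R0 f + C) * (16 * (2 + ln (1 + r)) / g)"
proof -
  obtain C where C: "\<And>R. R \<ge> 1 \<Longrightarrow> circle_regular f R \<Longrightarrow> nev_T R f = nev_T R (\<lambda>z. inverse (f z)) + C"
    using first_main_theorem[OF f] by metis
  show thesis
  proof (rule that[OF abs_ge_zero[of C]])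
    fix r g R0 :: real
    assume a: "1 \<le> r" "0 < g" "g \<le> r" "r + g \<le> R0" "circle_regular f r" "circle_regular f R0"
    have "nev_m r (\<lambda>z. deriv f z / f z) \<le> (2 * nev_T R0 f + \<bar>C\<bar>) * (1 * 16 * (2 + ln (1 + r / 1)) / g)"
    proof (rule gap_bound[OF f C])
      fix R assume R: "r + g / 4 < R" "circle_regular f R"
      show "nev_m r (\<lambda>z. deriv f z / f z) \<le> 4 * 1 / (R - r) * (nev_m R f + nev_m R (\<lambda>z. inverse (f z)))
       + 2 * (1 / r * (1 + ln (1 + r / 1))) * total_order f R"
        using log_derivative_estimate[OF f, of r R] a R by simp
    qed (use a in auto)
    then show "nev_m r (\<lambda>z. deriv f z / f z) \<le> (2 * nev_T R0 f + \<bar>C\<bar>) * (16 * (2 + ln (1 + r)) / g)" by simp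
  qed
qed

corollary log_difference_gap:
  assumes f: "nonzero_mero f" and c: "c \<noteq> 0"
  obtains C where "C \<ge> 0" "\<And>r g R0. \<lbrakk>1 \<le> r; 8 * norm c \<le> g; g \<le> r; r + g \<le> R0; circle_regular f r; circle_regular (\<lambda>z. f (z + c)) r; circle_regular f R0\<rbrakk> \<Longrightarrow>
     nev_m r (\<lambda>z. f (z + c) / f z) \<le> (2 * nev_T R0 f + C) * (norm c * 16 * (2 + ln (1 + r / norm c)) / g)"
proof -
  obtain C where C: "\<And>R. R \<ge> 1 \<Longrightarrow> circle_regular f R \<Longrightarrow> nev_T R f = nev_T R (\<lambda>z. inverse (f z)) + C"
    using first_main_theorem[OF f] by metis
  show thesis
  proof (rule that[OF abs_ge_zero[of C]])
    fix r g R0 :: real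
    assume a: "1 \<le> r" "8 * norm c \<le> g" "g \<le> r" "r + g \<le> R0" "circle_regular f r" "circle_regular (\<lambda>z. f (z + c)) r" "circle_regular f R0"
    have c0: "norm c > 0" using c by simp
    then have g0: "g > 0" using a(2) by linarith
    show "nev_m r (\<lambda>z. f (z + c) / f z) \<le> (2 * nev_T R0 f + \<bar>C\<bar>) * (norm c * 16 * (2 + ln (1 + r / norm c)) / g)"
    proof (rule gap_bound[OF f C])
      fix R assume R: "r + g / 4 < R" "circle_regular f R"
      show "nev_m r (\<lambda>z. f (z + c) / f z) \<le> 4 * norm c / (R - r) * (nev_m R f + nev_m R (\<lambda>z. inverse (f z)))
       + 2 * (norm c / r * (1 + ln (1 + r / norm c))) * total_order f R"
        \<comment> \<open>\<open>R - r > g / 4 >= 2 |c|\<close>; this is the origin of the condition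
          \<open>8 * norm c \<le> g\<close>.\<close>
        by (rule log_difference_estimate[OF f]) (use a R c in auto)
    qed (use a c0 g0 in auto)
  qed
qed

text \<open>Concavity of \<open>ln\<close>: \<open>(r + k) / (x + k)\<close> is the convex
  combination of \<open>r / x\<close> and 1 with weights \<open>x / (x + k)\<close> and
  \<open>k / (x + k)\<close>. The distortion factor \<open>1 + k / x\<close> is close to 1 for
  points far out.\<close>

lemma ln_shift_le:
  fixes x r k :: real
  assumes "0 < x" "x \<le> r" "0 \<le> k"
  shows "ln (r / x) \<le> (1 + k / x) * ln ((r + k) / (x + k))"
proof -
  define t where "t = k / (x + k)"
  have xk: "x + k > 0" using assms by simp
  then have t: "0 \<le> t" "t \<le> 1" "1 - t = x / (x + k)"
    using assms by (simp_all add: t_def divide_le_eq_1 eq_divide_eq diff_divide_distrib, simp add: field_simps)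
  have "(1 - t) * ln (r / x) + t * ln 1 \<le> ln ((1 - t) *\<^sub>R (r / x) + t *\<^sub>R 1)"
    by (rule concave_onD[OF ln_concave]) (use t assms in auto)
  also have "(1 - t) *\<^sub>R (r / x) + t *\<^sub>R 1 = (r + k) / (x + k)"
    unfolding t(3) using assms by (simp add: t_def add_divide_distrib)
  finally have "x / (x + k) * ln (r / x) \<le> ln ((r + k) / (x + k))" using t by simp
  then have "(x + k) / x * (x / (x + k) * ln (r / x)) \<le> (x + k) / x * ln ((r + k) / (x + k))"
    using assms by (intro mult_left_mono) auto
  moreover have "(x + k) / x * (x / (x + k)) = 1" "(x + k) / x = 1 + k / x"
    using assms xk by (simp, simp add: add_divide_distrib)
  ultimately show ?thesis by (metis mult.assoc mult_1)
qed

lemma log_weight_add_le: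
  assumes "1 \<le> r" "0 \<le> k"
  shows "log_weight (r + k) b \<le> log_weight r b + k / r"
proof -
  have l: "ln ((r + k) / r) \<le> k / r"
    using ln_add_one_self_le_self[of "k / r"] assms by (simp add: add_divide_distrib)
  show ?thesis
  proof (cases "b = 0")
    case True
    then show ?thesis using l assms by (simp add: log_weight_def ln_div)
  next
    case False
    have "ln ((r + k) / norm b) = ln (r / norm b) + ln ((r + k) / r)"
      using False assms by (simp add: ln_div)
    moreover have "k / r \<ge> 0" using assms by simp
    ultimately show ?thesis using False l by (auto simp: log_weight_def max_def)
  qed
qed

lemma locally_finite_supp_shift: "locally_finite_supp D \<Longrightarrow> locally_finite_supp (\<lambda>a. D (a + c))"
proof -
  assume D: "locally_finite_supp D"
  have "finite (supp_in (\<lambda>a. D (a + c)) r)" for r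
  proof (rule finite_surj[where f = "\<lambda>b. b - c"])
    show "finite (supp_in D (r + norm c))" using D by (simp add: locally_finite_supp_def)
    show "supp_in (\<lambda>a. D (a + c)) r \<subseteq> (\<lambda>b. b - c) ` supp_in D (r + norm c)"
    proof
      fix a assume a: "a \<in> supp_in (\<lambda>a. D (a + c)) r"
      then have "a + c \<in> supp_in D (r + norm c)"
        using norm_triangle_ineq[of a c] by (auto simp: supp_in_def)
      then show "a \<in> (\<lambda>b. b - c) ` supp_in D (r + norm c)" by (rule rev_image_eqI) simp
    qed
  qed
  then show ?thesis by (simp add: locally_finite_supp_def)
qed

text \<open>Far from the origin the weight of \<open>a\<close> is at most \<open>1 + \<eta>\<close>
  times that of \<open>a + c\<close> on the disc of radius \<open>r + |c|\<close>; points near the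
  origin contribute \<open>O(ln r)\<close>. Passing from \<open>r + |c|\<close> back to
  \<open>r\<close> costs \<open>|c| / r\<close> for each point, and the number of points is bounded
  through \<open>N(r + g)\<close>.\<close>

theorem log_count_shift_le:
  assumes D: "locally_finite_supp D" "\<And>a. D a \<ge> 0" and eta: "\<eta> > 0"
  obtains M where "\<And>r g. \<lbrakk>1 \<le> r; g \<le> r; 2 * norm c \<le> g; 0 < g\<rbrakk> \<Longrightarrow>
    log_count (\<lambda>a. D (a + c)) r \<le> (1 + \<eta>) * (log_count D r + 4 * norm c / g * log_count D (r + g)) + M * (1 + ln r)"
proof -
  let ?Dc = "\<lambda>a. D (a + c)" and ?k = "norm c"
  \<comment> \<open>Beyond modulus \<open>A\<close> one has \<open>|c| / |a| <= \<eta>\<close>, and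
    \<open>a + c\<close> is not 0.\<close>
  define A where "A = ?k + ?k / \<eta> + 1"
  have A: "A > ?k" "?k / A \<le> \<eta>" "A > 0"
  proof -
    have e: "?k / \<eta> \<ge> 0" using eta by simp
    then show "A > ?k" "A > 0" using norm_ge_zero[of c] by (simp_all add: A_def add_nonneg_pos)
    have "?k / \<eta> \<le> A" using norm_ge_zero[of c] by (simp add: A_def)
    then have "?k \<le> \<eta> * A" using eta by (simp add: field_simps)
    then show "?k / A \<le> \<eta>" using \<open>A > 0\<close> by (simp add: field_simps)
  qed
  have lDc: "locally_finite_supp ?Dc" by (rule locally_finite_supp_shift[OF D(1)])
  let ?S = "supp_in ?Dc A"
  have finS: "finite ?S" using lDc by (simp add: locally_finite_supp_def)
  define M where "M = (\<Sum>a\<in>?S. ?Dc a * (1 + \<bar>ln (norm a)\<bar>))"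
  show thesis
  proof (rule that[of M])
    fix r g :: real assume r: "1 \<le> r" and g: "g \<le> r" "2 * norm c \<le> g" "0 < g"
    let ?X = "supp_in ?Dc r"
    have finX: "finite ?X" using lDc by (simp add: locally_finite_supp_def)
    have lr: "ln r \<ge> 0" using r by simp
    have w2: "log_weight r a \<le> (1 + \<eta>) * log_weight (r + ?k) (a + c)" if a: "norm a > A" "norm a \<le> r" for a
    proof -
      have a0: "norm a > 0" using a A by linarith
      have "norm a - ?k \<le> norm (a + c)" using norm_triangle_ineq2[of a "-c"] by simp
      then have b0: "norm (a + c) > 0" using a A by linarith
      have b1: "norm (a + c) \<le> norm a + ?k" by (rule norm_triangle_ineq)
      have "ln (r / norm a) \<le> (1 + ?k / norm a) * ln ((r + ?k) / (norm a + ?k))"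
        by (rule ln_shift_le) (use a a0 in auto)
      also have "\<dots> \<le> (1 + \<eta>) * ln ((r + ?k) / (norm a + ?k))"
      proof (intro mult_right_mono add_left_mono)
        have "?k / norm a \<le> ?k / A" using a A a0 by (intro divide_left_mono mult_pos_pos) auto
        then show "?k / norm a \<le> \<eta>" using A by linarith
        show "0 \<le> ln ((r + ?k) / (norm a + ?k))" using a a0 by (intro ln_ge_zero) (simp add: add_pos_nonneg)
      qed
      also have "\<dots> \<le> (1 + \<eta>) * ln ((r + ?k) / norm (a + c))"
        using a0 b0 b1 r eta by (intro mult_left_mono ln_mono divide_left_mono mult_pos_pos divide_pos_pos add_pos_nonneg) auto
      also have "\<dots> \<le> (1 + \<eta>) * log_weight (r + ?k) (a + c)"
        using b0 eta by (intro mult_left_mono) (auto simp: log_weight_def)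
      finally have "ln (r / norm a) \<le> (1 + \<eta>) * log_weight (r + ?k) (a + c)" .
      moreover have "0 \<le> (1 + \<eta>) * log_weight (r + ?k) (a + c)"
        using r eta by (intro mult_nonneg_nonneg log_weight_nonneg) (auto simp: add_increasing2)
      ultimately show ?thesis using a0 by (auto simp: log_weight_def)
    qed
    have "log_count ?Dc r = (\<Sum>a\<in>?X \<inter> ?S. ?Dc a * log_weight r a) + (\<Sum>a\<in>?X - ?S. ?Dc a * log_weight r a)"
      unfolding log_count_def using finX by (simp add: sum.Int_Diff)
    also have "(\<Sum>a\<in>?X \<inter> ?S. ?Dc a * log_weight r a) \<le> (\<Sum>a\<in>?S. ?Dc a * log_weight r a)"
      using finS r D by (intro sum_mono2 mult_nonneg_nonneg log_weight_nonneg) auto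
    also have "\<dots> \<le> (\<Sum>a\<in>?S. ?Dc a * ((1 + \<bar>ln (norm a)\<bar>) * (1 + ln r)))"
      by (intro sum_mono mult_left_mono log_weight_le_ln r D)
    also have "\<dots> = M * (1 + ln r)"
      by (simp add: M_def sum_distrib_right mult.assoc)
    also have "(\<Sum>a\<in>?X - ?S. ?Dc a * log_weight r a) \<le> (\<Sum>a\<in>?X - ?S. ?Dc a * ((1 + \<eta>) * log_weight (r + ?k) (a + c)))"
      by (intro sum_mono mult_left_mono w2 D) (auto simp: supp_in_def)
    also have "\<dots> = (1 + \<eta>) * (\<Sum>a\<in>?X - ?S. D (a + c) * log_weight (r + ?k) (a + c))"
      by (simp add: sum_distrib_left mult_ac)
    also have "(\<Sum>a\<in>?X - ?S. D (a + c) * log_weight (r + ?k) (a + c)) = (\<Sum>b\<in>(\<lambda>a. a + c) ` (?X - ?S). D b * log_weight (r + ?k) b)"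
      by (subst sum.reindex) (auto simp: inj_on_def)
    also have "\<dots> \<le> log_count D (r + ?k)"
    proof -
      have "(\<lambda>a. a + c) ` (?X - ?S) \<subseteq> supp_in D (r + ?k)"
        using norm_triangle_ineq[of _ c] by (fastforce simp: supp_in_def intro: order_trans)
      then show ?thesis unfolding log_count_def using D r
        by (intro sum_mono2 mult_nonneg_nonneg log_weight_nonneg) (auto simp: locally_finite_supp_def add_increasing2)
    qed
    \<comment> \<open>With \<open>2 |c| <= g <= r\<close> the total multiplicity is at most
      \<open>2 r / (g / 2)\<close> times \<open>N(r + g)\<close>, whence the constant 4.\<close>
    also have "log_count D (r + ?k) \<le> log_count D r + 4 * ?k / g * log_count D (r + g)"
    proof -
      let ?Y = "supp_in D (r + ?k)"
      have finY: "finite ?Y" using D by (simp add: locally_finite_supp_def)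
      have "log_count D (r + ?k) \<le> (\<Sum>b\<in>?Y. D b * (log_weight r b + ?k / r))"
        unfolding log_count_def by (intro sum_mono mult_left_mono log_weight_add_le r D) auto
      also have "\<dots> = (\<Sum>b\<in>?Y. D b * log_weight r b) + ?k / r * (\<Sum>b\<in>?Y. D b)"
        by (simp add: algebra_simps sum.distrib sum_distrib_left)
      also have "(\<Sum>b\<in>?Y. D b * log_weight r b) = log_count D r"
        by (rule log_count_superset[symmetric]) (use r finY in \<open>auto simp: supp_in_def intro: add_increasing2\<close>)
      also have "(\<Sum>b\<in>?Y. D b) \<le> (r + g) / (r + g - (r + ?k)) * log_count D (r + g)"
      proof (cases "c = 0")
        case False
        then show ?thesis using r g by (intro log_count_sum_le D) (auto simp: add_increasing2)
      qed (use r g in \<open>intro log_count_sum_le D; auto\<close>)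
      also have "\<dots> \<le> (2 * r) / (g / 2) * log_count D (r + g)"
        using r g D by (intro mult_right_mono frac_le log_count_nonneg) auto
      finally have "log_count D (r + ?k) \<le> log_count D r + ?k / r * ((2 * r) / (g / 2) * log_count D (r + g))"
        using r by (simp add: mult_left_mono divide_right_mono)
      also have "?k / r * ((2 * r) / (g / 2) * log_count D (r + g)) = 4 * ?k / g * log_count D (r + g)"
        using r by simp
      finally show ?thesis .
    qed
    finally show "log_count ?Dc r \<le> (1 + \<eta>) * (log_count D r + 4 * ?k / g * log_count D (r + g)) + M * (1 + ln r)"
      using eta by (simp add: mult_left_mono)
  qed
qed

subsection \<open>Growth of transcendental functions\<close>

lemma poisson_kernel_le:
  assumes "norm z < norm \<zeta>"
  shows "poisson_kernel \<zeta> z \<le> (norm \<zeta> + norm z) / (norm \<zeta> - norm z)"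
proof -
  have "poisson_kernel \<zeta> z \<le> norm ((\<zeta> + z) / (\<zeta> - z))" unfolding poisson_kernel_def by (rule complex_Re_le_cmod)
  also have "\<dots> = norm (\<zeta> + z) / norm (\<zeta> - z)" by (rule norm_divide)
  also have "\<dots> \<le> (norm \<zeta> + norm z) / (norm \<zeta> - norm z)"
    using assms by (intro frac_le norm_triangle_ineq norm_triangle_ineq2) auto
  finally show ?thesis .
qed

text \<open>For \<open>2 |z| <= R\<close> the kernel is at most
  \<open>(R + |z|) / (R - |z|) <= 3\<close>.\<close>

lemma poisson_le_circle_mean:
  assumes "R > 0" "2 * norm z \<le> R" "continuous_on (sphere 0 R) u" "\<And>\<zeta>. norm \<zeta> = R \<Longrightarrow> u \<zeta> \<ge> 0"
  shows "poisson R u z \<le> 3 * circle_mean R u"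
proof -
  have z: "norm z < R" using assms by linarith
  have "poisson R u z \<le> circle_mean R (\<lambda>\<zeta>. 3 * u \<zeta>)"
    unfolding poisson_def
  proof (rule circle_mean_mono)
    fix \<zeta> :: complex assume zeta: "norm \<zeta> = R"
    have "poisson_kernel \<zeta> z \<le> (R + norm z) / (R - norm z)" using poisson_kernel_le[of z \<zeta>] zeta z by simp
    also have "\<dots> \<le> 3" using assms z by (simp add: divide_le_eq)
    finally show "u \<zeta> * poisson_kernel \<zeta> z \<le> 3 * u \<zeta>"
      using assms(4)[OF zeta] by (simp add: mult_left_mono mult.commute)
  qed (use assms z in \<open>auto intro!: continuous_intros continuous_on_poisson_kernel\<close>)
  then show ?thesis by (simp add: circle_mean_cmult)
qed

lemma transcendental_nonzero_mero:
  assumes "transcendental_meromorphic f"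
  shows "nonzero_mero f"
proof (rule nonzero_meroI)
  show "f meromorphic_on UNIV" using assms by (simp add: transcendental_meromorphic_def)
  show "\<not> (\<forall>\<^sub>\<approx>z. f z = 0)"
  proof
    assume "\<forall>\<^sub>\<approx>z. f z = 0"
    then have "\<forall>\<^sub>\<approx>z. f z = poly 0 z / poly 1 z" by simp
    then show False using assms unfolding transcendental_meromorphic_def by (metis one_neq_zero)
  qed
qed

text \<open>At a slow radius \<open>r >= R^2\<close> each zero or pole of modulus at most
  \<open>R\<close> has weight at least \<open>ln (r / R) >= ln r / 2\<close>, so their number is
  bounded independently of \<open>R\<close>.\<close>

lemma finite_zeros_poles_of_slow_growth:
  assumes f: "nonzero_mero f" and K: "K > 0"
    and slow: "\<And>r0. \<exists>r\<ge>r0. circle_regular f r \<and> nev_T r f \<le> K * ln r"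
  shows "finite {a. zorder f a \<noteq> 0}"
proof (rule ccontr)
  obtain C where C: "\<And>R. R \<ge> 1 \<Longrightarrow> circle_regular f R \<Longrightarrow> nev_T R f = nev_T R (\<lambda>z. inverse (f z)) + C"
    using first_main_theorem[OF f] by metis
  have fi: "nonzero_mero (\<lambda>z. inverse (f z))" by (rule nonzero_mero_inverse[OF f])
  define B where "B = 4 * K + 2 * \<bar>C\<bar>"
  have bound: "total_order f R \<le> B" if R: "R \<ge> 1" for R
  proof -
    \<comment> \<open>\<open>r >= exp 1\<close> makes \<open>ln r >= 1\<close>, so the constant
      \<open>|C|\<close> can be absorbed into \<open>ln r\<close>.\<close>
    obtain r where r: "r \<ge> max (R^2) (exp 1)" "circle_regular f r" "nev_T r f \<le> K * ln r" using slow by blast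
    then have r1: "r > 1" using exp_gt_one[of "1::real"] by linarith
    have "exp 1 \<le> r" using r by simp
    then have l1: "ln r \<ge> 1" using r1 by (simp add: ln_ge_iff)
    have "ln (R^2) \<le> ln r" using r R by (intro ln_mono) auto
    then have lR: "2 * ln R \<le> ln r" using R by (simp add: ln_realpow)
    have Rr: "R < r"
    proof (cases "R = 1")
      case False
      then have "R < R^2" using R by (simp add: power2_eq_square)
      then show ?thesis using r by simp
    qed (use r1 in simp)
    have np: "total_order f R \<ge> 0" by (simp add: total_order_def sum_nonneg)
    have "ln r / 2 * total_order f R \<le> ln (r / R) * total_order f R"
      using lR R r1 np by (intro mult_right_mono) (auto simp: ln_div)
    also have "\<dots> \<le> nev_N r f + nev_N r (\<lambda>z. inverse (f z))" by (rule total_order_ln_le[OF f R Rr])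
    also have "\<dots> \<le> nev_T r f + nev_T r (\<lambda>z. inverse (f z))"
      unfolding nev_T_def using r1 nev_m_nonneg[of r f] nev_m_nonneg[of r "\<lambda>z. inverse (f z)"] by simp
    also have "\<dots> \<le> 2 * K * ln r + \<bar>C\<bar> * ln r"
    proof -
      have "\<bar>C\<bar> * 1 \<le> \<bar>C\<bar> * ln r" using l1 by (intro mult_left_mono) auto
      then show ?thesis using C[of r] r r1 by simp
    qed
    finally have "ln r * total_order f R \<le> ln r * B" by (simp add: B_def algebra_simps)
    then show ?thesis using l1 by (simp add: mult_le_cancel_left_pos)
  qed
  assume "infinite {a. zorder f a \<noteq> 0}"
  then obtain S where S: "S \<subseteq> {a. zorder f a \<noteq> 0}" "finite S" "card S = Suc (nat \<lceil>B\<rceil>)"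
    using infinite_arbitrarily_large by blast
  define R where "R = Max (insert 1 (norm ` S))"
  have R: "R \<ge> 1" "\<And>a. a \<in> S \<Longrightarrow> norm a \<le> R" unfolding R_def using S by (auto intro!: Max_ge)
  have "real (card S) = (\<Sum>a\<in>S. 1)" by simp
  also have "\<dots> \<le> (\<Sum>a\<in>S. \<bar>real_of_int (zorder f a)\<bar>)"
    using S by (intro sum_mono) (auto simp flip: of_int_abs)
  also have "\<dots> \<le> total_order f R" unfolding total_order_def
    using finite_zeros_poles[OF f] S R by (intro sum_mono2) (auto simp: zeros_poles_in_def)
  also have "\<dots> \<le> B" by (rule bound[OF R(1)])
  finally show False using S by linarith
qed

text \<open>If the bound failed, then \<open>f = Q exp h\<close> with finitely many factors in
  \<open>Q\<close> by \<open>finite_zeros_poles_of_slow_growth\<close>, and the means of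
  \<open>|Re h|\<close> would be \<open>O(ln R)\<close> for arbitrarily large radii. The derivative
  estimate then gives \<open>h' = 0\<close>, and \<open>f\<close> would be rational.\<close>

theorem transcendental_growth:
  assumes tr: "transcendental_meromorphic f"
  shows "\<exists>r0. \<forall>r\<ge>r0. circle_regular f r \<longrightarrow> K * ln r \<le> nev_T r f"
proof (rule ccontr)
  assume not: "\<not> ?thesis"
  define K' where "K' = max 1 K"
  have f: "nonzero_mero f" by (rule transcendental_nonzero_mero[OF tr])
  have slow: "\<exists>r\<ge>r0. circle_regular f r \<and> nev_T r f \<le> K' * ln r" for r0
  proof -
    obtain r where r: "r \<ge> max r0 1" "circle_regular f r" "nev_T r f < K * ln r" using not by (meson not_le)
    have "K * ln r \<le> K' * ln r" using r by (intro mult_right_mono) (auto simp: K'_def)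
    then show ?thesis using r by (intro exI[of _ r]) auto
  qed
  have K': "K' > 0" by (simp add: K'_def)
  define Z where "Z = {a. zorder f a \<noteq> 0}"
  have finZ: "finite Z" unfolding Z_def by (rule finite_zeros_poles_of_slow_growth[OF f K' slow])
  define Q where "Q = (\<lambda>z. \<Prod>a\<in>Z. (z - a) powi zorder f a)"
  have nl: "nonzero_mero (\<lambda>z. z - a)" for a :: complex
  proof (rule nonzero_meroI)
    show "\<not> (\<forall>\<^sub>\<approx>z. z - a = 0)"
    proof
      assume "\<forall>\<^sub>\<approx>z. z - a = 0"
      then have "eventually (\<lambda>z. z - a = 0) (at a)"
        using eventually_cosparse_imp_eventually_at by blast
      moreover have "eventually (\<lambda>z. z \<noteq> a) (at a)" by (rule eventually_neq_at_within)
      ultimately have "eventually (\<lambda>z. False) (at a)" by eventually_elim auto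
      then show False by simp
    qed
  qed (auto intro!: meromorphic_intros)
  have zl: "zorder (\<lambda>z. z - a) b = (if b = a then 1 else 0)" for a b :: complex
  proof (cases "b = a")
    case True
    have "zorder (\<lambda>z. z - a) a = 1" by (rule zorder_eqI[of UNIV a "\<lambda>_. 1"]) auto
    then show ?thesis using True by simp
  qed (auto intro!: zorder_eq_0I analytic_intros)
  have nQ: "nonzero_mero Q" unfolding Q_def by (intro nonzero_mero_prod nonzero_mero_powi nl)
  have zQ: "zorder Q b = zorder f b" for b
  proof -
    have "zorder Q b = (\<Sum>a\<in>Z. zorder f a * (if b = a then 1 else 0))"
      unfolding Q_def by (subst nonzero_mero_zorder_prod) (auto intro!: nonzero_mero_powi nl sum.cong simp: nonzero_mero_zorder_powi nl zl)
    also have "\<dots> = (\<Sum>a\<in>Z. if b = a then zorder f a else 0)" by (intro sum.cong) auto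
    also have "\<dots> = zorder f b" using finZ by (auto simp: Z_def)
    finally show ?thesis .
  qed
  define F where "F = (\<lambda>z. f z / Q z)"
  have nF: "nonzero_mero F" unfolding F_def by (intro nonzero_mero_divide f nQ)
  have "zorder F b = 0" for b unfolding F_def by (simp add: nonzero_mero_zorder_divide f nQ zQ)
  then obtain h where h: "h holomorphic_on UNIV" "\<And>z. F analytic_on {z} \<Longrightarrow> F z = exp (h z)"
    using zorder_free_exp[OF nF, of UNIV] by auto
  have fz: "f z = exp (h z) * Q z \<and> z \<notin> Z" if z: "regular_at f z" for z
  proof -
    have zZ: "z \<notin> Z" using regular_at_zorder[OF z] by (auto simp: Z_def)
    have Qz: "Q z \<noteq> 0" "Q analytic_on {z}" unfolding Q_def using finZ zZ by (auto intro!: analytic_intros)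
    then have "F analytic_on {z}" unfolding F_def using z by (auto simp: regular_at_def intro!: analytic_intros)
    from h(2)[OF this] show ?thesis using Qz zZ by (simp add: F_def field_simps)
  qed
  obtain C where C: "\<And>R. R \<ge> 1 \<Longrightarrow> circle_regular f R \<Longrightarrow> nev_T R f = nev_T R (\<lambda>z. inverse (f z)) + C"
    using first_main_theorem[OF f] by metis
  have fi: "nonzero_mero (\<lambda>z. inverse (f z))" by (rule nonzero_mero_inverse[OF f])
  define A where "A = (\<Sum>a\<in>Z. \<bar>real_of_int (zorder f a)\<bar>)"
  have A0: "A \<ge> 0" by (simp add: A_def sum_nonneg)
  \<comment> \<open>For \<open>R >= 2 \<rho>\<close> and \<open>|z| = R\<close> all distances to
    points of \<open>Z\<close> lie between 1 and \<open>2 R\<close>, so their logarithms lie between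
    0 and \<open>ln (2 R)\<close>.\<close>
  define \<rho> where "\<rho> = Max (insert 1 (norm ` Z))"
  have rho: "\<rho> \<ge> 1" "\<And>a. a \<in> Z \<Longrightarrow> norm a \<le> \<rho>" unfolding \<rho>_def using finZ by (auto intro!: Max_ge)
  have mean: "circle_mean R (\<lambda>z. \<bar>Re (h z)\<bar>) \<le> 2 * K' * ln R + \<bar>C\<bar> + A * ln (2 * R)"
    if R: "R \<ge> 2 * \<rho>" "circle_regular f R" "nev_T R f \<le> K' * ln R" for R
  proof -
    have R1: "R \<ge> 1" "R > 0" using R rho by auto
    have ch: "continuous_on (sphere 0 R) h"
      by (intro holomorphic_on_imp_continuous_on holomorphic_on_subset[OF h(1)]) auto
    have "circle_mean R (\<lambda>z. \<bar>Re (h z)\<bar>) \<le> circle_mean R (\<lambda>z. \<bar>ln (norm (f z))\<bar> + A * ln (2 * R))"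
    proof (rule circle_mean_mono)
      fix z :: complex assume z: "norm z = R"
      have reg: "regular_at f z" using R(2) z by (auto simp: circle_regular_def)
      have za: "z - a \<noteq> 0" if "a \<in> Z" for a using fz[OF reg] that by auto
      have "ln (norm (f z)) = ln (exp (Re (h z)) * (\<Prod>a\<in>Z. norm (z - a) powi zorder f a))"
        using fz[OF reg] by (simp add: norm_mult Q_def prod_norm[symmetric] norm_power_int)
      also have "\<dots> = Re (h z) + ln (\<Prod>a\<in>Z. norm (z - a) powi zorder f a)"
        using za by (subst ln_mult_pos) (auto intro!: prod_pos zero_less_power_int)
      also have "ln (\<Prod>a\<in>Z. norm (z - a) powi zorder f a) = (\<Sum>a\<in>Z. ln (norm (z - a) powi zorder f a))"
        using za finZ by (intro ln_prod) (auto intro!: zero_less_power_int)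
      also have "\<dots> = (\<Sum>a\<in>Z. real_of_int (zorder f a) * ln (norm (z - a)))"
        using za by (intro sum.cong refl ln_power_int) auto
      finally have e: "Re (h z) = ln (norm (f z)) - (\<Sum>a\<in>Z. real_of_int (zorder f a) * ln (norm (z - a)))" by simp
      have "\<bar>\<Sum>a\<in>Z. real_of_int (zorder f a) * ln (norm (z - a))\<bar> \<le> (\<Sum>a\<in>Z. \<bar>real_of_int (zorder f a)\<bar> * ln (2 * R))"
      proof (rule order_trans[OF sum_abs sum_mono])
        fix a assume a: "a \<in> Z"
        have "norm (z - a) \<le> 2 * R" using norm_triangle_ineq4[of z a] z rho(2)[OF a] R rho(1) by linarith
        moreover have "norm (z - a) \<ge> 1" using norm_triangle_ineq2[of z a] z rho(2)[OF a] R rho(1) by linarith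
        ultimately have "0 \<le> ln (norm (z - a))" "ln (norm (z - a)) \<le> ln (2 * R)" by (auto intro!: ln_mono simp del: zero_less_norm_iff)
        then show "\<bar>real_of_int (zorder f a) * ln (norm (z - a))\<bar> \<le> \<bar>real_of_int (zorder f a)\<bar> * ln (2 * R)"
          by (simp add: abs_mult mult_left_mono)
      qed
      also have "\<dots> = A * ln (2 * R)" by (simp add: A_def sum_distrib_right)
      finally show "\<bar>Re (h z)\<bar> \<le> \<bar>ln (norm (f z))\<bar> + A * ln (2 * R)" using e by linarith
    qed (use R1 R in \<open>auto intro!: continuous_intros ch continuous_ln_circle_regular\<close>)
    also have "\<dots> = circle_mean R (\<lambda>z. \<bar>ln (norm (f z))\<bar>) + A * ln (2 * R)"
      using R1 R by (subst circle_mean_add) (auto intro!: continuous_on_rabs continuous_ln_circle_regular)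
    also have "circle_mean R (\<lambda>z. \<bar>ln (norm (f z))\<bar>) = nev_m R f + nev_m R (\<lambda>z. inverse (f z))"
      by (rule circle_mean_abs_ln_eq_m) (use R R1 in auto)
    also have "\<dots> \<le> nev_T R f + nev_T R (\<lambda>z. inverse (f z))"
      unfolding nev_T_def using nev_N_nonneg[OF f R1(1)] nev_N_nonneg[OF fi R1(1)] by simp
    also have "\<dots> \<le> 2 * K' * ln R + \<bar>C\<bar>" using C[OF R1(1) R(2)] R(3) by simp
    finally show ?thesis by simp
  qed
  have d0: "deriv h z = 0" for z
  proof (rule ccontr)
    assume nz: "deriv h z \<noteq> 0"
    \<comment> \<open>The coefficient 12 below is the 4 of \<open>norm_deriv_le_poisson\<close>
      times the 3 of \<open>poisson_le_circle_mean\<close>.\<close>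
    have "((\<lambda>R. ln R / (R - norm z)) \<longlongrightarrow> 0) at_top" "((\<lambda>R. 1 / (R - norm z)) \<longlongrightarrow> 0) at_top"
      by real_asymp+
    then have "((\<lambda>R. 12 * (2 * K' + A) * (ln R / (R - norm z)) + 12 * (\<bar>C\<bar> + A * ln 2) * (1 / (R - norm z)))
        \<longlongrightarrow> 12 * (2 * K' + A) * 0 + 12 * (\<bar>C\<bar> + A * ln 2) * 0) at_top"
      by (intro tendsto_intros)
    then have "eventually (\<lambda>R. 12 * (2 * K' + A) * (ln R / (R - norm z)) + 12 * (\<bar>C\<bar> + A * ln 2) * (1 / (R - norm z)) < norm (deriv h z)) at_top"
      by (rule order_tendstoD(2)) (use nz in simp)
    then obtain R0 where R0: "\<And>R. R \<ge> R0 \<Longrightarrow> 12 * (2 * K' + A) * (ln R / (R - norm z)) + 12 * (\<bar>C\<bar> + A * ln 2) * (1 / (R - norm z)) < norm (deriv h z)"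
      by (auto simp: eventually_at_top_linorder)
    obtain R where R: "R \<ge> max R0 (2 * \<rho> + 2 * norm z)" "circle_regular f R" "nev_T R f \<le> K' * ln R" using slow by blast
    have R1: "R \<ge> R0" "R \<ge> 2 * \<rho>" "2 * norm z \<le> R" "norm z < R" "R > 0"
      using R(1) rho(1) norm_ge_zero[of z] by linarith+
    have ch: "continuous_on (sphere 0 R) h"
      by (intro holomorphic_on_imp_continuous_on holomorphic_on_subset[OF h(1)]) auto
    have "norm (deriv h z) \<le> 4 / (R - norm z) * poisson R (\<lambda>\<zeta>. \<bar>Re (h \<zeta>)\<bar>) z"
      by (rule norm_deriv_le_poisson[of h "R + 1"]) (use R1 in \<open>auto intro: holomorphic_on_subset[OF h(1)]\<close>)
    also have "\<dots> \<le> 4 / (R - norm z) * (3 * circle_mean R (\<lambda>z. \<bar>Re (h z)\<bar>))"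
      using R1 by (intro mult_left_mono poisson_le_circle_mean) (auto intro!: continuous_intros ch)
    also have "\<dots> \<le> 4 / (R - norm z) * (3 * (2 * K' * ln R + \<bar>C\<bar> + A * ln (2 * R)))"
      using R1 R by (intro mult_left_mono mean) auto
    also have "\<dots> = 12 * (2 * K' + A) * (ln R / (R - norm z)) + 12 * (\<bar>C\<bar> + A * ln 2) * (1 / (R - norm z))"
      using R1 by (simp add: ln_mult divide_simps) (simp add: algebra_simps)
    also have "\<dots> < norm (deriv h z)" by (rule R0) (use R1 in auto)
    finally show False by simp
  qed
  have "\<exists>k. \<forall>z\<in>UNIV. h z = k"
    by (rule has_field_derivative_zero_constant[OF convex_UNIV])
       (use holomorphic_derivI[OF h(1) open_UNIV] d0 in auto)
  then obtain k where k: "\<And>z. h z = k" by auto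
  define p where "p = smult (exp k) (\<Prod>a\<in>{a\<in>Z. zorder f a > 0}. [:-a, 1:] ^ nat (zorder f a))"
  define q where "q = (\<Prod>a\<in>{a\<in>Z. zorder f a < 0}. [:-a, 1:] ^ nat (- zorder f a))"
  have q0: "q \<noteq> 0" unfolding q_def using finZ by auto
  have Qpq: "exp k * Q z = poly p z / poly q z" for z
  proof -
    have "Z = {a\<in>Z. zorder f a > 0} \<union> {a\<in>Z. zorder f a < 0}" by (auto simp: Z_def)
    then have "Q z = (\<Prod>a\<in>{a\<in>Z. zorder f a > 0} \<union> {a\<in>Z. zorder f a < 0}. (z - a) powi zorder f a)"
      unfolding Q_def by simp
    also have "\<dots> = (\<Prod>a\<in>{a\<in>Z. zorder f a > 0}. (z - a) powi zorder f a) * (\<Prod>a\<in>{a\<in>Z. zorder f a < 0}. (z - a) powi zorder f a)"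
      using finZ by (intro prod.union_disjoint) auto
    also have "(\<Prod>a\<in>{a\<in>Z. zorder f a > 0}. (z - a) powi zorder f a) = (\<Prod>a\<in>{a\<in>Z. zorder f a > 0}. (z - a) ^ nat (zorder f a))"
      by (intro prod.cong) (auto simp: power_int_def)
    also have "(\<Prod>a\<in>{a\<in>Z. zorder f a < 0}. (z - a) powi zorder f a) = (\<Prod>a\<in>{a\<in>Z. zorder f a < 0}. inverse ((z - a) ^ nat (- zorder f a)))"
      by (intro prod.cong) (auto simp: power_int_def power_inverse)
    finally show ?thesis by (simp add: p_def q_def poly_prod divide_inverse prod_inversef[symmetric] o_def)
  qed
  have "\<forall>\<^sub>\<approx>z. f z = poly p z / poly q z"
    using regular_at_cosparse[OF f] by eventually_elim (use fz k Qpq in auto)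
  then show False using tr q0 unfolding transcendental_meromorphic_def by blast
qed

subsection \<open>Growth outside a set of finite logarithmic measure\<close>

text \<open>Summation by parts: partial sums of size \<open>k powr \<tau>\<close> with
  \<open>\<tau> < 1\<close> leave the convergent series of \<open>k powr (\<tau> - 2)\<close>. It
  converts a bound on the number of doublings into finite logarithmic measure.\<close>

lemma summable_abel_powr:
  fixes e :: "nat \<Rightarrow> real"
  assumes e: "\<And>k. e k \<ge> 0" and D: "\<And>k. (\<Sum>j<k. e j) \<le> C * real (k + 1) powr \<tau>" and t: "\<tau> < 1"
  shows "summable (\<lambda>k. e k / real (k + 1))"
proof -
  define D where "D = (\<lambda>k. \<Sum>j<k. e j)"
  have C0: "C \<ge> 0" using D[of 0] by simp
  have D0: "D k \<ge> 0" for k unfolding D_def by (intro sum_nonneg e)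
  have abel: "(\<Sum>k<N. e k / real (k + 1)) = D N / real (N + 1) + (\<Sum>k<N. D (Suc k) * (1 / real (k + 1) - 1 / real (k + 2)))" for N
  proof (induction N)
    case (Suc N)
    have "D (Suc N) = D N + e N" by (simp add: D_def)
    then have "e N / real (N + 1) = D (Suc N) / real (N + 1) - D N / real (N + 1)"
      by (simp add: add_divide_distrib)
    also have "\<dots> = D (Suc N) / real (Suc N + 1) - D N / real (N + 1) + D (Suc N) * (1 / real (N + 1) - 1 / real (N + 2))"
      by (simp add: algebra_simps)
    finally show ?case using Suc by simp
  qed (simp add: D_def)
  have sm: "summable (\<lambda>k. C * real (k + 1) powr (\<tau> - 2))"
    using t summable_ignore_initial_segment[of "\<lambda>k. real k powr (\<tau> - 2)" 1]
    by (intro summable_mult) (simp add: summable_real_powr_iff)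
  have trm: "D (Suc k) * (1 / real (k + 1) - 1 / real (k + 2)) \<le> C * real (k + 1) powr (\<tau> - 2)" for k
  proof -
    have "1 / real (k + 1) - 1 / real (k + 2) = 1 / (real (k + 1) * real (k + 2))" by (simp add: field_simps)
    then have "D (Suc k) * (1 / real (k + 1) - 1 / real (k + 2)) = D (Suc k) / real (k + 2) / real (k + 1)" by simp
    also have "\<dots> \<le> C * real (k + 2) powr \<tau> / real (k + 2) / real (k + 1)"
      using D[of "Suc k"] by (intro divide_right_mono) (auto simp: D_def)
    also have "C * real (k + 2) powr \<tau> / real (k + 2) = C * real (k + 2) powr (\<tau> - 1)"
      by (simp add: powr_diff)
    also have "\<dots> / real (k + 1) \<le> C * real (k + 1) powr (\<tau> - 1) / real (k + 1)"
      using t C0 by (intro divide_right_mono mult_left_mono powr_mono2') auto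
    also have "\<dots> = C * real (k + 1) powr (\<tau> - 2)" by (simp add: powr_diff power2_eq_square)
    finally show ?thesis .
  qed
  have bd: "(\<Sum>k<N. e k / real (k + 1)) \<le> C + (\<Sum>k. C * real (k + 1) powr (\<tau> - 2))" for N
  proof -
    have "D N / real (N + 1) \<le> C"
    proof -
      have "real (N + 1) powr \<tau> \<le> real (N + 1) powr 1" using t by (intro powr_mono) auto
      then have "D N \<le> C * real (N + 1)" using D[of N] C0 mult_left_mono[of _ _ C] unfolding D_def
        by (smt (verit) powr_one of_nat_0_le_iff)
      then show ?thesis by (simp add: divide_le_eq)
    qed
    moreover have "(\<Sum>k<N. D (Suc k) * (1 / real (k + 1) - 1 / real (k + 2))) \<le> (\<Sum>k<N. C * real (k + 1) powr (\<tau> - 2))"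
      by (intro sum_mono trm)
    moreover have "\<dots> \<le> (\<Sum>k. C * real (k + 1) powr (\<tau> - 2))"
      using C0 by (intro sum_le_suminf sm) auto
    ultimately show ?thesis unfolding abel by linarith
  qed
  show ?thesis
    by (rule summableI_nonneg_bounded[OF _ bd]) (simp add: e)
qed

text \<open>For sampling points \<open>x powr p\<close> the first bound says that a block has
  relative length at most \<open>3 / x\<close>, which makes bad blocks cheap in logarithmic measure.
  The second bounds its length below by the power \<open>1 - 1/p\<close> of its left end, which is
  the gap finally gained.\<close>

lemma powr_Suc_le:
  fixes x p :: real
  assumes "1 \<le> x" "1 < p" "p < 2"
  shows "(x + 1) powr p - x powr p \<le> 3 / x * x powr p"
    and "x powr (p - 1) \<le> (x + 1) powr p - x powr p"
proof -
  have "(x + 1) powr p = x powr p * (1 + 1 / x) powr p"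
  proof -
    have "x + 1 = x * (1 + 1 / x)" using assms by (simp add: distrib_left)
    then show ?thesis using assms by (metis powr_mult)
  qed
  also have "(1 + 1 / x) powr p \<le> (1 + 1 / x) powr 2" using assms by (intro powr_mono) auto
  also have "\<dots> = 1 + 2 / x + 1 / x * (1 / x)" using assms by (simp add: power2_eq_square algebra_simps)
  also have "1 / x * (1 / x) \<le> 1 / x * 1" using assms by (intro mult_left_mono) auto
  finally have "(x + 1) powr p \<le> x powr p * (1 + 2 / x + 1 / x)" by (simp add: mult_left_mono)
  then show "(x + 1) powr p - x powr p \<le> 3 / x * x powr p" by (simp add: algebra_simps)
  have "x powr p + x powr (p - 1) = (x + 1) * x powr (p - 1)"
    using assms by (simp add: algebra_simps powr_mult_base)
  also have "\<dots> \<le> (x + 1) * (x + 1) powr (p - 1)"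
    using assms by (intro mult_left_mono powr_mono2) auto
  also have "\<dots> = (x + 1) powr p" using assms powr_mult_base[of "x + 1" "p - 1"] by simp
  finally show "x powr (p - 1) \<le> (x + 1) powr p - x powr p" by simp
qed

lemma finite_log_measure_Un:
  assumes "finite_log_measure E" "finite_log_measure F"
  shows "finite_log_measure (E \<union> F)"
proof -
  have m: "E \<in> sets lebesgue" "F \<in> sets lebesgue" using assms by (auto simp: finite_log_measure_def)
  have "(\<integral>\<^sup>+ r. ennreal (1 / r) * indicator ((E \<union> F) \<inter> {1..}) r \<partial>lebesgue)
     \<le> (\<integral>\<^sup>+ r. ennreal (1 / r) * indicator (E \<inter> {1..}) r + ennreal (1 / r) * indicator (F \<inter> {1..}) r \<partial>lebesgue)"
    by (intro nn_integral_mono) (auto simp: indicator_def)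
  also have "\<dots> = (\<integral>\<^sup>+ r. ennreal (1 / r) * indicator (E \<inter> {1..}) r \<partial>lebesgue)
     + (\<integral>\<^sup>+ r. ennreal (1 / r) * indicator (F \<inter> {1..}) r \<partial>lebesgue)"
  proof (intro nn_integral_add)
    have "(\<lambda>r::real. ennreal (1 / r)) \<in> borel_measurable lebesgue"
      by (intro measurable_completion) measurable
    then show "(\<lambda>r. ennreal (1 / r) * indicator (E \<inter> {1..}) r) \<in> borel_measurable lebesgue"
        "(\<lambda>r. ennreal (1 / r) * indicator (F \<inter> {1..}) r) \<in> borel_measurable lebesgue"
      using m by (intro borel_measurable_times_ennreal borel_measurable_indicator sets.Int; simp)+
  qed
  also have "\<dots> < \<infinity>" using assms by (simp add: finite_log_measure_def)
  finally show ?thesis using m by (simp add: finite_log_measure_def)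
qed

lemma finite_log_measure_countable:
  assumes "countable B"
  shows "finite_log_measure B"
proof -
  have n: "B \<in> null_sets lebesgue" "B \<inter> {1..} \<in> null_sets lebesgue"
    using countable_imp_null_set_lborel[OF assms] countable_imp_null_set_lborel[of "B \<inter> {1..}"] assms
    by (auto intro: null_sets_completionI)
  then show ?thesis
    unfolding finite_log_measure_def by (simp add: nn_integral_null_set null_setsD2)
qed

text \<open>A full interval from \<open>r\<close> to \<open>L r\<close> inside \<open>E\<close>
  would have logarithmic measure \<open>ln L\<close>. Together with monotonicity this carries
  estimates known off \<open>E\<close> over to other radii at the price of a dilation.\<close>

lemma finite_log_measure_escape:
  assumes "finite_log_measure E"
  obtains L where "L > 1" "\<And>r. r \<ge> 1 \<Longrightarrow> \<exists>r'. r < r' \<and> r' < L * r \<and> r' \<notin> E"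
proof -
  let ?I = "\<integral>\<^sup>+ r. ennreal (1 / r) * indicator (E \<inter> {1..}) r \<partial>lebesgue"
  have fin: "?I < \<infinity>" using assms by (simp add: finite_log_measure_def)
  define M where "M = enn2real ?I"
  have M: "?I = ennreal M" "M \<ge> 0" using fin by (auto simp: M_def ennreal_enn2real_if)
  show thesis
  \<comment> \<open>The compact interval from \<open>2 r\<close> to \<open>2 r exp (M + 1)\<close>
    lies strictly inside and already has logarithmic measure \<open>M + 1\<close>.\<close>
  proof (rule that[of "3 * exp (M + 1)"])
    show "3 * exp (M + 1) > 1" using exp_gt_one[of "M + 1"] M by linarith
    fix r :: real assume r: "r \<ge> 1"
    show "\<exists>r'. r < r' \<and> r' < 3 * exp (M + 1) * r \<and> r' \<notin> E"
    proof (rule ccontr)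
      assume "\<not> ?thesis"
      then have sub: "r' \<in> E" if "r < r'" "r' < 3 * exp (M + 1) * r" for r' using that by blast
      define b where "b = 2 * r * exp (M + 1)"
      have b: "2 * r \<le> b" using r M by (simp add: b_def)
      have bb: "b < 3 * exp (M + 1) * r" using r by (simp add: b_def)
      have "ennreal (ln b - ln (2 * r)) = (\<integral>\<^sup>+ x. ennreal (1 / x) * indicator {2 * r..b} x \<partial>lborel)"
        using r b by (intro nn_integral_FTC_Icc[symmetric]) (auto intro!: derivative_eq_intros simp: field_simps)
      also have "\<dots> = (\<integral>\<^sup>+ x. ennreal (1 / x) * indicator {2 * r..b} x \<partial>lebesgue)"
        by (rule nn_integral_completion[symmetric])
      also have "\<dots> \<le> ?I"
        using r bb sub by (intro nn_integral_mono) (auto simp: indicator_def)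
      also have "\<dots> = ennreal M" by (rule M)
      finally have "ln b - ln (2 * r) \<le> M" using M by (simp add: ennreal_le_iff)
      moreover have "ln b = ln (2 * r) + (M + 1)" unfolding b_def using r by (subst ln_mult_pos) auto
      ultimately show False by simp
    qed
  qed
qed

text \<open>The sampling points \<open>(k + s) powr p\<close> have gaps of size about \<open>r powr (1 - 1/p)\<close>; a doubling
  of \<open>H\<close> on too many of the corresponding blocks would force hyper order at least \<open>1/p\<close>.\<close>
theorem growth_lemma:
  fixes H :: "real \<Rightarrow> real"
  assumes G: "countable (- G)"
    and mono: "\<And>r R. 1 \<le> r \<Longrightarrow> r < R \<Longrightarrow> r \<in> G \<Longrightarrow> R \<in> G \<Longrightarrow> H r \<le> H R"
    and sig: "0 < \<sigma>" "\<sigma> < 1"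
    and bound: "\<And>r. r \<ge> x0 \<Longrightarrow> r \<in> G \<Longrightarrow> 1 \<le> H r \<and> H r \<le> exp (r powr \<sigma>)"
  obtains E \<delta> x where "finite_log_measure E" "0 < \<delta>" "\<delta> < 1"
    "\<And>r. r \<ge> x \<Longrightarrow> r \<in> G \<Longrightarrow> r \<notin> E \<Longrightarrow> \<exists>R\<in>G. r + r powr \<delta> \<le> R \<and> H R \<le> 2 * H r"
proof -
  \<comment> \<open>\<open>p > 1\<close> makes the gaps grow; \<open>p * \<sigma> < 1\<close> makes
    doublings rare enough for summability.\<close>
  obtain p where p: "1 < p" "p < min 2 (1 / \<sigma>)"
    using dense[of 1 "min 2 (1 / \<sigma>)"] sig by auto
  then have p2: "p < 2" "p * \<sigma> < 1" using sig by (auto simp: field_simps)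
  \<comment> \<open>The shift puts every sampling point at or beyond \<open>max 1 x0\<close>, where
    the hypotheses on \<open>H\<close> are available.\<close>
  define s :: nat where "s = nat \<lceil>max 1 x0\<rceil>"
  have s: "real s \<ge> 1" "real s \<ge> x0" unfolding s_def by linarith+
  define t where "t = (\<lambda>k::nat. real (k + s))"
  define a where "a = (\<lambda>k. t k powr p)"
  have t1: "t k \<ge> 1" "t (Suc k) = t k + 1" for k using s by (auto simp: t_def)
  have ta: "t k \<le> a k" for k
    using powr_mono[of 1 p "t k"] p t1[of k] by (simp add: a_def)
  have a1: "1 \<le> a k" "x0 \<le> a k" for k using ta[of k] t1[of k] s by (auto simp: t_def)
  have amono: "a k < a (Suc k)" for k
    unfolding a_def using t1[of k] p by (intro powr_less_mono2) auto
  have amono': "a j \<le> a k" if "j \<le> k" for j k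
    using that amono by (simp add: lift_Suc_mono_le less_imp_le)
  have "\<exists>y. a k < y \<and> y < a (Suc k) \<and> y \<in> G" for k
    using ex_avoid_countable[OF G amono[of k]] by auto
  then obtain y where y: "\<And>k. a k < y k" "\<And>k. y k < a (Suc k)" "\<And>k. y k \<in> G" by metis
  have Hy: "1 \<le> H (y k)" "H (y k) \<le> exp (y k powr \<sigma>)" for k
    using bound[of "y k"] y[of k] a1[of k] by auto
  have Hmono: "H (y j) \<le> H (y k)" if "j \<le> k" for j k
  proof (cases "j = k")
    case False
    then have "y j < y k" using y(2)[of j] y(1)[of k] amono'[of "Suc j" k] that by linarith
    moreover have "1 \<le> y j" using y(1)[of j] a1(1)[of j] by linarith
    ultimately show ?thesis using y(3) by (intro mono)
  qed simp
  define u where "u = (\<lambda>k. log 2 (H (y k)))"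
  have u0: "u k \<ge> 0" for k using Hy[of k] by (simp add: u_def)
  have umono: "u j \<le> u k" if "j \<le> k" for j k
    using Hmono[OF that] Hy[of j] by (simp add: u_def)
  \<comment> \<open>Doubling is tested over three blocks: for \<open>r\<close> in block
    \<open>k + 1\<close>, \<open>y k\<close> lies to the left of \<open>r\<close>, and
    \<open>y (k + 3)\<close> lies beyond the end of block \<open>k + 2\<close>, hence a full block
    length to the right of \<open>r\<close>.\<close>
  define bad where "bad = {k. H (y (k + 3)) > 2 * H (y k)}"
  define e where "e = (\<lambda>k. u (k + 3) - u k)"
  have e0: "e k \<ge> 0" for k using umono[of k "k + 3"] by (simp add: e_def)
  have e1: "e k \<ge> 1" if "k \<in> bad" for k
  proof -
    have "log 2 (2 * H (y k)) \<le> log 2 (H (y (k + 3)))"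
      using that Hy[of k] by (auto simp: bad_def)
    then show ?thesis using Hy[of k] by (simp add: e_def u_def log_mult)
  qed
  define \<tau> where "\<tau> = p * \<sigma>"
  have tau: "0 < \<tau>" "\<tau> < 1" using p sig p2 by (auto simp: \<tau>_def)
  have ub: "u k \<le> t (Suc k) powr \<tau> / ln 2" for k
  proof -
    have "ln (H (y k)) \<le> y k powr \<sigma>" using Hy[of k] by (metis exp_gt_zero less_le_trans ln_exp ln_mono zero_less_one)
    also have "\<dots> \<le> a (Suc k) powr \<sigma>"
      using y[of k] a1[of k] sig by (intro powr_mono2) auto
    also have "\<dots> = t (Suc k) powr \<tau>" by (simp add: a_def \<tau>_def powr_powr)
    finally show ?thesis by (simp add: u_def log_def divide_right_mono)
  qed
  define C where "C = 3 * (3 + real s) powr \<tau> / ln 2"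
  have D: "(\<Sum>j<k. e j) \<le> C * real (k + 1) powr \<tau>" for k
  proof -
    \<comment> \<open>Telescoping with step 3 leaves the last three terms minus the first
      three.\<close>
    have "(\<Sum>j<k. e j) = u k + u (k + 1) + u (k + 2) - (u 0 + u 1 + u 2)"
      by (induction k) (auto simp: e_def numeral_eq_Suc)
    also have "\<dots> \<le> 3 * u (k + 2)"
      using umono[of k "k+2"] umono[of "k+1" "k+2"] u0[of 0] u0[of 1] u0[of 2] by simp
    also have "\<dots> \<le> 3 * (t (k + 3) powr \<tau> / ln 2)" using ub[of "k + 2"] by (simp add: numeral_eq_Suc)
    also have "t (k + 3) powr \<tau> \<le> ((3 + real s) * real (k + 1)) powr \<tau>"
      using tau t1[of "k+3"] by (intro powr_mono2) (auto simp: t_def algebra_simps)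
    also have "\<dots> = (3 + real s) powr \<tau> * real (k + 1) powr \<tau>" by (rule powr_mult)
    finally show ?thesis by (simp add: C_def divide_right_mono)
  qed
  have sm: "summable (\<lambda>k. e k / real (k + 1))"
    by (rule summable_abel_powr[OF e0 D tau(2)])
  define E where "E = (\<Union>k\<in>bad. {a (k + 1)..<a (k + 2)})"
  have EL: "E \<in> sets lebesgue" unfolding E_def by (intro sets.countable_UN'') auto
  \<comment> \<open>Block \<open>k + 1\<close> has logarithmic measure at most
    \<open>3 / (k + 1)\<close>, and \<open>e k >= 1\<close> on bad indices, so the measure of
    \<open>E\<close> is dominated by the summable series of \<open>3 e k / (k + 1)\<close>.\<close>
  have "(\<integral>\<^sup>+ r. ennreal (1 / r) * indicator (E \<inter> {1..}) r \<partial>lebesgue) \<le>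
    (\<integral>\<^sup>+ r. (\<Sum>k. ennreal (e k / a (k + 1)) * indicator {a (k + 1)..<a (k + 2)} r) \<partial>lebesgue)"
  proof (intro nn_integral_mono)
    fix r :: real
    show "ennreal (1 / r) * indicator (E \<inter> {1..}) r \<le> (\<Sum>k. ennreal (e k / a (k + 1)) * indicator {a (k + 1)..<a (k + 2)} r)"
    proof (cases "r \<in> E")
      case True
      then obtain k where k: "k \<in> bad" "a (k + 1) \<le> r" "r < a (k + 2)" by (auto simp: E_def)
      have ak: "a (k + 1) > 0" using a1[of "k + 1"] by simp
      have "ennreal (1 / r) * indicator (E \<inter> {1..}) r \<le> ennreal (1 / r) * 1"
        by (intro mult_left_mono) (auto simp: indicator_def)
      also have "1 / r \<le> e k / a (k + 1)" using ak k e1[OF k(1)] by (intro frac_le) auto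
      then have "ennreal (1 / r) * 1 \<le> ennreal (e k / a (k + 1)) * indicator {a (k + 1)..<a (k + 2)} r"
        using k by (simp add: ennreal_leI)
      also have "\<dots> \<le> (\<Sum>k. ennreal (e k / a (k + 1)) * indicator {a (k + 1)..<a (k + 2)} r)"
      proof -
        define F where "F = (\<lambda>k. ennreal (e k / a (k + 1)) * indicator {a (k + 1)..<a (k + 2)} r)"
        have "(\<Sum>j\<in>{k}. F j) \<le> suminf F" by (rule sum_le_suminf) auto
        then have "F k \<le> suminf F" by simp
        then show ?thesis unfolding F_def .
      qed
      finally show ?thesis .
    qed auto
  qed
  also have "\<dots> = (\<Sum>k. \<integral>\<^sup>+ r. ennreal (e k / a (k + 1)) * indicator {a (k + 1)..<a (k + 2)} r \<partial>lebesgue)"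
    by (intro nn_integral_suminf borel_measurable_times_ennreal borel_measurable_const borel_measurable_indicator) auto
  also have "\<dots> = (\<Sum>k. ennreal (e k / a (k + 1)) * ennreal (a (k + 2) - a (k + 1)))"
    using amono[of "Suc k" for k] by (subst nn_integral_cmult_indicator) (auto simp: less_imp_le)
  also have "\<dots> \<le> (\<Sum>k. ennreal (3 * (e k / real (k + 1))))"
  proof (rule suminf_le)
    fix k
    have ak: "a (k + 1) > 0" using a1[of "k + 1"] by simp
    have "a (k + 2) - a (k + 1) \<le> 3 / t (k + 1) * a (k + 1)"
      using powr_Suc_le(1)[of "t (k + 1)" p] t1[of "k + 1"] p p2 by (simp add: a_def)
    then have "(a (k + 2) - a (k + 1)) / a (k + 1) \<le> 3 / t (k + 1)" using ak by (simp add: divide_le_eq)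
    also have "\<dots> \<le> 3 / real (k + 1)" by (intro divide_left_mono) (auto simp: t_def intro: add_pos_nonneg)
    finally have "e k * ((a (k + 2) - a (k + 1)) / a (k + 1)) \<le> e k * (3 / real (k + 1))"
      using e0 by (rule mult_left_mono)
    then have "e k / a (k + 1) * (a (k + 2) - a (k + 1)) \<le> 3 * (e k / real (k + 1))" by (simp add: mult_ac)
    then show "ennreal (e k / a (k + 1)) * ennreal (a (k + 2) - a (k + 1)) \<le> ennreal (3 * (e k / real (k + 1)))"
      using e0[of k] ak amono[of "Suc k"] by (simp add: ennreal_leI flip: ennreal_mult)
  qed auto
  also have "\<dots> < \<infinity>"
    using summable_mult[OF sm, of 3] e0 by (subst suminf_ennreal2) auto
  finally have E: "finite_log_measure E" using EL by (simp add: finite_log_measure_def)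
  show thesis
  \<comment> \<open>The exponent makes \<open>a k powr ((p - 1) / p) = t k powr (p - 1)\<close>,
    which is at most the length of block \<open>k\<close>.\<close>
  proof (rule that[OF E, of "(p - 1) / p" "a 1"])
    show "0 < (p - 1) / p" "(p - 1) / p < 1" using p by auto
    fix r assume r: "r \<ge> a 1" "r \<in> G" "r \<notin> E"
    have "\<exists>k. r < a (k + 2)"
    proof -
      obtain n :: nat where "r < real n" using reals_Archimedean2 by blast
      also have "real n \<le> t (n + 2)" by (simp add: t_def)
      also have "\<dots> \<le> a (n + 2)" by (rule ta)
      finally show ?thesis by blast
    qed
    define k where "k = (LEAST k. r < a (k + 2))"
    have k2: "r < a (k + 2)" unfolding k_def by (rule LeastI_ex) fact
    have k1: "a (k + 1) \<le> r"
    proof (cases k)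
      case (Suc j)
      then have "\<not> r < a (j + 2)" using not_less_Least[of j "\<lambda>k. r < a (k + 2)"] by (simp add: k_def)
      then show ?thesis using Suc by simp
    qed (use r in simp)
    have nb: "k \<notin> bad" using r(3) k1 k2 by (auto simp: E_def)
    have "H (y (k + 3)) \<le> 2 * H (y k)" using nb by (simp add: bad_def)
    also have "H (y k) \<le> H r"
      using y(1,2,3)[of k] a1[of k] k1 r by (intro mono) auto
    finally have "H (y (k + 3)) \<le> 2 * H r" by simp
    moreover have "r + r powr ((p - 1) / p) \<le> y (k + 3)"
    proof -
      have r0: "r > 0" using a1[of 1] r by linarith
      have "r powr ((p - 1) / p) \<le> a (k + 2) powr ((p - 1) / p)"
        using k2 r0 p by (intro powr_mono2) auto
      also have "\<dots> = t (k + 2) powr (p - 1)" using p by (simp add: a_def powr_powr)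
      also have "\<dots> \<le> a (k + 3) - a (k + 2)"
        using powr_Suc_le(2)[of "t (k + 2)" p] t1[of "k + 2"] p p2 by (simp add: a_def numeral_eq_Suc)
      finally show ?thesis using k2 y(1)[of "k + 3"] by linarith
    qed
    ultimately show "\<exists>R\<in>G. r + r powr ((p - 1) / p) \<le> R \<and> H R \<le> 2 * H r" using y(3) by blast
  qed
qed

subsection \<open>The characteristic of products and differences\<close>

lemma nev_T_mult_le:
  assumes f: "nonzero_mero f" "nonzero_mero g" and r: "r \<ge> 1" and g: "circle_regular f r" "circle_regular g r"
  shows "nev_T r (\<lambda>z. f z * g z) \<le> nev_T r f + nev_T r g"
proof -
  have r0: "r > 0" "r \<ge> 0" using r by auto
  have "nev_m r (\<lambda>z. f z * g z) \<le> circle_mean r (\<lambda>z. log_plus (norm (f z)) + log_plus (norm (g z)))"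
    unfolding nev_m_eq using r0 g
    by (intro circle_mean_mono continuous_on_add continuous_log_plus_circle_regular circle_regular_mult) (auto simp: norm_mult intro!: log_plus_mult_le)
  also have "\<dots> = nev_m r f + nev_m r g"
    unfolding nev_m_eq by (intro circle_mean_add continuous_log_plus_circle_regular r0 g)
  finally have m: "nev_m r (\<lambda>z. f z * g z) \<le> nev_m r f + nev_m r g" .
  have "log_count (pole_ord (\<lambda>z. f z * g z)) r \<le> log_count (\<lambda>a. pole_ord f a + pole_ord g a) r"
    by (intro log_count_mono r locally_finite_supp_pole_ord locally_finite_supp_add f nonzero_mero_mult) (auto simp: pole_ord_def nonzero_mero_zorder_mult f)
  also have "\<dots> = log_count (pole_ord f) r + log_count (pole_ord g) r"
    by (intro log_count_add r0 locally_finite_supp_pole_ord f)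
  finally show ?thesis using m f r0 by (simp add: nev_T_def nev_N_eq nonzero_mero_mult)
qed

lemma circle_regular_power: "circle_regular f r \<Longrightarrow> circle_regular (\<lambda>z. f z ^ k) r"
  by (auto simp: circle_regular_def regular_at_def intro!: analytic_intros)

lemma circle_regular_prod: "finite A \<Longrightarrow> (\<And>x. x \<in> A \<Longrightarrow> circle_regular (f x) r) \<Longrightarrow> circle_regular (\<lambda>z. \<Prod>x\<in>A. f x z) r"
  by (auto simp: circle_regular_def regular_at_def intro!: analytic_intros)

lemma circle_regular_divide: "circle_regular f r \<Longrightarrow> circle_regular g r \<Longrightarrow> circle_regular (\<lambda>z. f z / g z) r"
  unfolding divide_inverse by (intro circle_regular_mult circle_regular_inverse)

lemma nev_T_one: "r > 0 \<Longrightarrow> nev_T r (\<lambda>_. 1) = 0"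
  by (simp add: nev_T_def nev_m_eq log_plus_def nev_N_eq nonzero_mero_const log_count_def supp_in_def pole_ord_def)

lemma nev_T_power_le:
  assumes "nonzero_mero f" "r \<ge> 1" "circle_regular f r"
  shows "nev_T r (\<lambda>z. f z ^ k) \<le> real k * nev_T r f"
proof (induction k)
  case 0
  then show ?case using assms nev_T_one[of r] by simp
next
  case (Suc k)
  have "nev_T r (\<lambda>z. f z * f z ^ k) \<le> nev_T r f + nev_T r (\<lambda>z. f z ^ k)"
    by (intro nev_T_mult_le assms nonzero_mero_power circle_regular_power)
  then show ?case using Suc by (simp add: algebra_simps)
qed

lemma nev_T_prod_le:
  assumes "finite A" "\<And>x. x \<in> A \<Longrightarrow> nonzero_mero (f x)" "r \<ge> 1" "\<And>x. x \<in> A \<Longrightarrow> circle_regular (f x) r"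
  shows "nev_T r (\<lambda>z. \<Prod>x\<in>A. f x z) \<le> (\<Sum>x\<in>A. nev_T r (f x))"
  using assms(1,2,4)
proof (induction A rule: finite_induct)
  case empty
  then show ?case using nev_T_one[of r] assms(3) by simp
next
  case (insert x A)
  have "nev_T r (\<lambda>z. f x z * (\<Prod>x\<in>A. f x z)) \<le> nev_T r (f x) + nev_T r (\<lambda>z. \<Prod>x\<in>A. f x z)"
    using insert assms(3) by (intro nev_T_mult_le nonzero_mero_prod circle_regular_prod) auto
  then show ?case using insert by fastforce
qed

section \<open>Local orders of a function, of its difference with 1 and of its logarithmic
  derivative\<close>

lemma zorder_diff_one_ge:
  assumes "nonzero_mero f" "nonzero_mero (\<lambda>z. f z - 1)"
  shows "zorder (\<lambda>z. f z - 1) a \<ge> min 0 (zorder f a)"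
proof (rule zorder_diff_ge)
  show "\<exists>\<^sub>F z in at a. f z \<noteq> 1" using nonzero_mero_fr[OF assms(2), of a] by simp
qed (auto intro!: nonzero_mero_mero nonzero_mero_fr assms nonzero_mero_const)

lemma zorder_of_diff_one_ge:
  assumes "nonzero_mero f" "nonzero_mero (\<lambda>z. f z - 1)"
  shows "zorder f a \<ge> min 0 (zorder (\<lambda>z. f z - 1) a)"
proof -
  have "zorder (\<lambda>z. (f z - 1) - (-1)) a \<ge> min 0 (zorder (\<lambda>z. f z - 1) a)"
  proof (rule zorder_diff_ge)
    show "\<exists>\<^sub>F z in at a. f z - 1 \<noteq> -1" using nonzero_mero_fr[OF assms(1), of a] by simp
  qed (auto intro!: nonzero_mero_mero nonzero_mero_fr assms nonzero_mero_const simp del: right_minus_eq)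
  then show ?thesis by simp
qed

lemma zorder_not_both_pos:
  assumes "nonzero_mero f" "nonzero_mero (\<lambda>z. f z - 1)"
  shows "zorder f a \<le> 0 \<or> zorder (\<lambda>z. f z - 1) a \<le> 0"
proof (rule ccontr)
  assume "\<not> ?thesis"
  then have p: "zorder f a \<ge> 1" "zorder (\<lambda>z. f z - 1) a \<ge> 1" by auto
  have "zorder (\<lambda>z. f z - (f z - 1)) a \<ge> 1"
    by (rule zorder_diff_ge) (use p in \<open>auto intro!: nonzero_mero_mero nonzero_mero_fr assms simp del: right_minus_eq\<close>)
  then show False by simp
qed

lemma nev_T_diff_one_le:
  assumes f: "nonzero_mero f" "nonzero_mero (\<lambda>z. f z - 1)" and r: "r \<ge> 1" and g: "circle_regular f r" "circle_regular (\<lambda>z. f z - 1) r"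
  shows "nev_T r (\<lambda>z. f z - 1) \<le> nev_T r f + ln 2"
proof -
  have r0: "r > 0" "r \<ge> 0" using r by auto
  have "log_plus (norm (f z - 1)) \<le> log_plus (norm (f z)) + ln 2" for z
  proof -
    have "norm (f z - 1) \<le> norm (f z) + 1" using norm_triangle_ineq4[of "f z" 1] by simp
    then have "log_plus (norm (f z - 1)) \<le> log_plus (norm (f z) + 1)" by (rule log_plus_mono)
    also have "\<dots> \<le> log_plus (norm (f z)) + log_plus 1 + ln 2" by (rule log_plus_add_le) auto
    finally show ?thesis by (simp add: log_plus_def)
  qed
  then have "nev_m r (\<lambda>z. f z - 1) \<le> circle_mean r (\<lambda>z. log_plus (norm (f z)) + ln 2)"
    unfolding nev_m_eq using r0 g
    by (intro circle_mean_mono continuous_on_add continuous_log_plus_circle_regular continuous_on_const) auto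
  also have "\<dots> = nev_m r f + ln 2"
    unfolding nev_m_eq using r0 g by (simp add: circle_mean_add continuous_log_plus_circle_regular)
  finally have m: "nev_m r (\<lambda>z. f z - 1) \<le> nev_m r f + ln 2" .
  have "log_count (pole_ord (\<lambda>z. f z - 1)) r \<le> log_count (pole_ord f) r"
  proof (intro log_count_mono r locally_finite_supp_pole_ord f)
    show "pole_ord (\<lambda>z. f z - 1) a \<le> pole_ord f a" for a
      using zorder_diff_one_ge[OF f, of a] by (auto simp: pole_ord_def)
  qed
  then show ?thesis using m f r0 by (simp add: nev_T_def nev_N_eq)
qed

text \<open>A meromorphic function with vanishing derivative has no poles, so it extends to an entire
  function with vanishing derivative.\<close>
lemma deriv_zero_imp_const:
  assumes f: "nonzero_mero f" and d: "\<forall>\<^sub>\<approx>z. deriv f z = 0"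
  obtains k where "k \<noteq> 0" "\<forall>\<^sub>\<approx>z. f z = k"
proof -
  have np: "\<not> is_pole f a" for a
  proof
    assume "is_pole f a"
    then have "is_pole (deriv f) a" using is_pole_deriv_iff[of f a] nonzero_mero_mero[OF f] by auto
    then have "eventually (\<lambda>z. deriv f z \<noteq> 0) (at a)" by (rule non_zero_neighbour_pole)
    moreover have "eventually (\<lambda>z. deriv f z = 0) (at a)"
      using d eventually_cosparse_imp_eventually_at by blast
    ultimately have "eventually (\<lambda>z. False) (at a)" by eventually_elim auto
    then show False by simp
  qed
  let ?G = "remove_sings f"
  have G: "?G analytic_on {b}" for b
  proof -
    have m: "f meromorphic_on {b}" using f by (rule nonzero_mero_mero)
    then obtain c where "f \<midarrow>b\<rightarrow> c"
      using np[of b] unfolding meromorphic_at_iff not_essential_def by auto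
    then show ?thesis using remove_sings_analytic_at m unfolding meromorphic_at_iff by blast
  qed
  then have hol: "?G holomorphic_on UNIV"
    by (intro analytic_imp_holomorphic) (subst analytic_on_analytic_at, auto)
  have ev: "\<forall>\<^sub>\<approx>z. deriv ?G z = 0"
    using d meromorphic_on_imp_analytic_cosparse[OF nonzero_mero_mero[OF f, of UNIV]]
    by eventually_elim simp
  have d0: "deriv ?G z = 0" for z
  proof -
    have "deriv ?G holomorphic_on UNIV" using hol by (rule holomorphic_deriv) auto
    then have "isCont (deriv ?G) z" using holomorphic_on_imp_continuous_on continuous_on_interior by force
    then have "(deriv ?G \<longlongrightarrow> deriv ?G z) (at z)" by (simp add: isCont_def)
    moreover have "eventually (\<lambda>z. deriv ?G z = 0) (at z)"
      using ev eventually_cosparse_imp_eventually_at by blast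
    then have "(deriv ?G \<longlongrightarrow> 0) (at z)" by (rule tendsto_eventually)
    ultimately show ?thesis using tendsto_unique at_neq_bot by blast
  qed
  have "\<exists>k. \<forall>z\<in>UNIV. ?G z = k"
    by (rule has_field_derivative_zero_constant[OF convex_UNIV])
       (use holomorphic_derivI[OF hol open_UNIV] d0 in auto)
  then obtain k where k: "\<And>z. ?G z = k" by auto
  have fk: "\<forall>\<^sub>\<approx>z. f z = k"
    using meromorphic_on_imp_analytic_cosparse[OF nonzero_mero_mero[OF f, of UNIV]]
    by eventually_elim (metis k remove_sings_at_analytic)
  moreover have "k \<noteq> 0"
  proof
    assume "k = 0"
    then have "eventually (\<lambda>z. f z = 0) (at 0)"
      using fk eventually_cosparse_imp_eventually_at by blast
    then have "eventually (\<lambda>z::complex. False) (at 0)" using nonzero_mero_ev[OF f, of 0] by eventually_elim auto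
    then show False by simp
  qed
  ultimately show thesis using that by blast
qed

text \<open>The local count behind the second main theorem: the quotient has a simple pole at each
  pole of \<open>f\<close> and at each zero of \<open>f - 1\<close>, whatever the multiplicity,
  while a zero of \<open>f\<close> of order \<open>p\<close> makes it vanish to order
  \<open>p - 1\<close>.\<close>

lemma zorder_log_deriv_diff_one:
  assumes f: "nonzero_mero f" and f1: "nonzero_mero (\<lambda>z. f z - 1)" and d: "nonzero_mero (deriv f)"
  shows "- real_of_int (zorder (\<lambda>z. deriv f z / (f z - 1)) a) \<le>
    pole_ind f a + (if zorder (\<lambda>z. f z - 1) a > 0 then 1 else 0) - max 0 (real_of_int (zorder f a) - 1)"
proof -
  have w: "zorder (\<lambda>z. deriv f z / (f z - 1)) a = zorder (deriv f) a - zorder (\<lambda>z. f z - 1) a"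
    by (rule nonzero_mero_zorder_divide[OF d f1])
  have iso: "isolated_singularity_at g a" "not_essential g a" if "nonzero_mero g" for g
    using nonzero_mero_mero[OF that, of "{a}"] by (auto simp: meromorphic_at_iff)
  have D: "zorder (deriv f) a = zorder f a - 1" if "zorder f a \<noteq> 0"
    by (rule zorder_deriv_minus_1) (use iso[OF f] that nonzero_mero_fr[OF f] in auto)
  have D1: "zorder (deriv f) a = zorder (\<lambda>z. f z - 1) a - 1" if "zorder (\<lambda>z. f z - 1) a \<noteq> 0"
  proof -
    have "eventually (\<lambda>z. f analytic_on {z}) (at a)"
      using meromorphic_on_imp_analytic_cosparse[OF nonzero_mero_mero[OF f, of UNIV]]
        eventually_cosparse_imp_eventually_at by blast
    then have "eventually (\<lambda>z. deriv (\<lambda>z. f z - 1) z = deriv f z) (at a)"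
      by eventually_elim (auto intro!: deriv_diff[THEN trans] analytic_on_imp_differentiable_at)
    then have "zorder (deriv (\<lambda>z. f z - 1)) a = zorder (deriv f) a"
      by (rule zorder_cong) auto
    moreover have "zorder (deriv (\<lambda>z. f z - 1)) a = zorder (\<lambda>z. f z - 1) a - 1"
      by (rule zorder_deriv_minus_1) (use iso[OF f1] that nonzero_mero_fr[OF f1] in auto)
    ultimately show ?thesis by simp
  qed
  note facts = zorder_diff_one_ge[OF f f1, of a] zorder_of_diff_one_ge[OF f f1, of a] zorder_not_both_pos[OF f f1, of a]
  \<comment> \<open>\<open>f\<close> and \<open>f - 1\<close> have the same poles, so these cases
    are exhaustive.\<close>
  consider "zorder f a < 0" | "zorder f a > 0" | "zorder f a = 0" "zorder (\<lambda>z. f z - 1) a > 0"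
    | "zorder f a = 0" "zorder (\<lambda>z. f z - 1) a = 0"
    using facts by linarith
  then show ?thesis
  proof cases
    case 4
    have "\<not> is_pole f a" using 4 is_pole_iff_zorder[OF f] by simp
    then have "\<not> is_pole (deriv f) a" using is_pole_deriv_iff[of f a] nonzero_mero_mero[OF f] by auto
    then have "zorder (deriv f) a \<ge> 0" using is_pole_iff_zorder[OF d, of a] by simp
    then show ?thesis unfolding w using 4 by (simp add: pole_ind_def)
  qed (use facts w D D1 in \<open>auto simp: pole_ind_def max_def\<close>)
qed

subsection \<open>Error terms\<close>

text \<open>The factor of the two gap estimates for the gap \<open>r powr \<delta> / 4\<close> at
  radii up to \<open>2 r\<close>; any positive power of \<open>r\<close> beats the
  logarithm.\<close>

lemma log_kernel_tendsto:
  fixes k \<delta> :: real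
  assumes "k > 0" "0 < \<delta>"
  shows "((\<lambda>r. k * 16 * (2 + ln (1 + 2 * r / k)) / (r powr \<delta> / 4)) \<longlongrightarrow> 0) at_top"
  using assms by real_asymp

lemma powr_filterlim_at_top:
  fixes \<delta> :: real
  assumes "0 < \<delta>"
  shows "filterlim (\<lambda>r. r powr \<delta>) at_top at_top"
  using assms by real_asymp

text \<open>\<open>G\<close> is a set of radii whose circles avoid all exceptional points, and \<open>E\<close> the exceptional
  set of the error terms. By \<open>gap\<close> the characteristics grow by a bounded factor only on
  \<open>[r, r + r powr \<delta>]\<close>, which turns all estimates with two radii into \<open>o(T(r,f))\<close>.\<close>
locale nevanlinna_gap =
  fixes f s :: "complex \<Rightarrow> complex" and E G :: "real set" and \<delta> :: real
  assumes f: "nonzero_mero f" and s: "nonzero_mero s"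
    and E: "finite_log_measure E" and EG: "- G \<subseteq> E" and G: "countable (- G)"
    and Gf: "\<And>r. r \<in> G \<Longrightarrow> circle_regular f r" and Gs: "\<And>r. r \<in> G \<Longrightarrow> circle_regular s r"
    and \<delta>: "0 < \<delta>" "\<delta> < 1"
    and growth: "\<And>K. eventually (\<lambda>r. K * ln r \<le> nev_T r f) (inf at_top (principal (- E)))"
    and gap: "eventually (\<lambda>r. \<exists>R\<in>G. r + r powr \<delta> \<le> R \<and> nev_T R f + nev_T R s \<le> 4 * nev_T r f)
        (inf at_top (principal (- E)))"
    and small_s: "\<And>\<epsilon>. \<epsilon> > 0 \<Longrightarrow> eventually (\<lambda>r. nev_T r s \<le> \<epsilon> * nev_T r f) (inf at_top (principal (- E)))"
begin

abbreviation "\<F> \<equiv> inf at_top (principal (- E))"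

text \<open>Only an upper bound is required. The property is thus inherited by smaller functions,
  and the sign of the final error term is settled by a truncation.\<close>

definition small_err :: "(real \<Rightarrow> real) \<Rightarrow> bool" where
  "small_err u \<longleftrightarrow> (\<forall>\<epsilon>>0. eventually (\<lambda>r. u r \<le> \<epsilon> * nev_T r f) \<F>)"

definition near_radii :: "real \<Rightarrow> real \<Rightarrow> real set" where
  "near_radii \<theta> r = {R \<in> G. r \<le> R \<and> R \<le> r + \<theta> * r powr \<delta>}"

text \<open>Bounds \<open>u\<close> on a window to the right of \<open>r\<close> by the value of
  \<open>T\<close> at \<open>r\<close> itself. A two-radius estimate applied inside a window uses up
  part of it, so the width drops from 1 for \<open>f\<close> and \<open>s\<close> to 1/2 for the
  shifts and \<phi>.\<close>

definition dominated :: "real \<Rightarrow> (real \<Rightarrow> real) \<Rightarrow> bool" where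
  "dominated \<theta> u \<longleftrightarrow> (\<exists>K\<ge>0. eventually (\<lambda>r. \<forall>R\<in>near_radii \<theta> r. u R \<le> K * nev_T r f) \<F>)"

lemma ev_top: "eventually P at_top \<Longrightarrow> eventually P \<F>"
  by (rule filter_leD[OF inf_le1])

lemma ev_G: "eventually (\<lambda>r. r \<in> G) \<F>"
  using EG by (auto simp: eventually_inf_principal intro!: always_eventually)

text \<open>A set of finite logarithmic measure contains no half-line. This is needed where a
  contradiction is drawn from facts that hold only eventually off \<open>E\<close>.\<close>

lemma F_nontrivial: "\<F> \<noteq> bot"
proof
  assume "\<F> = bot"
  then have "eventually (\<lambda>r. False) \<F>" by simp
  then obtain x where x: "\<And>r. r \<ge> x \<Longrightarrow> r \<in> E"
    by (auto simp: eventually_inf_principal eventually_at_top_linorder)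
  obtain L where L: "\<And>r. r \<ge> 1 \<Longrightarrow> \<exists>r'. r < r' \<and> r' < L * r \<and> r' \<notin> E"
    using finite_log_measure_escape[OF E] by metis
  from L[of "max 1 x"] obtain r' where "max 1 x < r'" "r' \<notin> E" by auto
  then show False using x[of r'] by simp
qed

lemma T_ge: "eventually (\<lambda>r. K \<le> nev_T r f) \<F>"
proof -
  have "eventually (\<lambda>r. r \<ge> exp 1) \<F>" by (rule ev_top[OF eventually_ge_at_top])
  with growth[of "\<bar>K\<bar>"] show ?thesis
  proof eventually_elim
    case (elim r)
    have r: "r > 0" using elim(2) exp_gt_zero[of "1::real"] by linarith
    then have "1 \<le> ln r" using elim(2) by (simp add: ln_ge_iff)
    then have "\<bar>K\<bar> * 1 \<le> \<bar>K\<bar> * ln r" by (intro mult_left_mono) auto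
    then show ?case using elim by linarith
  qed
qed

lemma T_nonneg: "eventually (\<lambda>r. 0 \<le> nev_T r f) \<F>"
  by (rule T_ge)

lemma small_err_add: "small_err u \<Longrightarrow> small_err v \<Longrightarrow> small_err (\<lambda>r. u r + v r)"
  unfolding small_err_def
proof (intro allI impI)
  fix \<epsilon> :: real assume a: "\<forall>\<epsilon>>0. \<forall>\<^sub>F r in \<F>. u r \<le> \<epsilon> * nev_T r f" "\<forall>\<epsilon>>0. \<forall>\<^sub>F r in \<F>. v r \<le> \<epsilon> * nev_T r f" "\<epsilon> > 0"
  then have "\<forall>\<^sub>F r in \<F>. u r \<le> \<epsilon> / 2 * nev_T r f" "\<forall>\<^sub>F r in \<F>. v r \<le> \<epsilon> / 2 * nev_T r f"
    using half_gt_zero by blast+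
  then show "\<forall>\<^sub>F r in \<F>. u r + v r \<le> \<epsilon> * nev_T r f" by eventually_elim simp
qed

lemma small_err_mono: "small_err u \<Longrightarrow> eventually (\<lambda>r. v r \<le> u r) \<F> \<Longrightarrow> small_err v"
  unfolding small_err_def by (auto elim: eventually_elim2)

lemma small_err_cmult: "small_err u \<Longrightarrow> k \<ge> 0 \<Longrightarrow> small_err (\<lambda>r. k * u r)"
proof -
  assume u: "small_err u" and k: "k \<ge> 0"
  show ?thesis unfolding small_err_def
  proof (intro allI impI)
    fix \<epsilon> :: real assume e: "\<epsilon> > 0"
    then have "\<epsilon> / (k + 1) > 0" using k by simp
    with u have "\<forall>\<^sub>F r in \<F>. u r \<le> \<epsilon> / (k + 1) * nev_T r f" by (auto simp: small_err_def)
    then show "\<forall>\<^sub>F r in \<F>. k * u r \<le> \<epsilon> * nev_T r f" using T_nonneg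
    proof eventually_elim
      case (elim r)
      have "k * u r \<le> k * (\<epsilon> / (k + 1) * nev_T r f)" using elim k by (intro mult_left_mono) auto
      also have "\<dots> = (k / (k + 1)) * (\<epsilon> * nev_T r f)" by simp
      also have "\<dots> \<le> 1 * (\<epsilon> * nev_T r f)" using k elim e by (intro mult_right_mono) auto
      finally show ?case by simp
    qed
  qed
qed

lemma small_err_sum: "finite A \<Longrightarrow> (\<And>x. x \<in> A \<Longrightarrow> small_err (u x)) \<Longrightarrow> small_err (\<lambda>r. \<Sum>x\<in>A. u x r)"
proof (induction A rule: finite_induct)
  case empty
  show ?case unfolding small_err_def using T_nonneg by (auto elim: eventually_mono)
next
  case (insert x A)
  then show ?case using small_err_add[of "u x" "\<lambda>r. \<Sum>x\<in>A. u x r"] by auto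
qed

lemma small_err_ln: "small_err (\<lambda>r. M * (1 + ln r))"
  unfolding small_err_def
proof (intro allI impI)
  fix \<epsilon> :: real assume e: "\<epsilon> > 0"
  have "eventually (\<lambda>r. r \<ge> exp 1) \<F>" by (rule ev_top[OF eventually_ge_at_top])
  with growth[of "2 * \<bar>M\<bar> / \<epsilon>"] show "\<forall>\<^sub>F r in \<F>. M * (1 + ln r) \<le> \<epsilon> * nev_T r f"
  proof eventually_elim
    case (elim r)
    have r: "r > 0" using elim(2) exp_gt_zero[of "1::real"] by linarith
    then have l: "1 \<le> ln r" using elim(2) by (simp add: ln_ge_iff)
    have "M * (1 + ln r) \<le> \<bar>M\<bar> * (1 + ln r)" using l by (intro mult_right_mono) auto
    also have "\<dots> \<le> \<bar>M\<bar> * (2 * ln r)" using l by (intro mult_left_mono) auto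
    also have "\<dots> = \<epsilon> * (2 * \<bar>M\<bar> / \<epsilon> * ln r)" using e by simp
    also have "\<dots> \<le> \<epsilon> * nev_T r f" using elim e by (intro mult_left_mono) auto
    finally show ?case .
  qed
qed

lemma small_err_const: "small_err (\<lambda>r. M)"
proof (rule small_err_mono[OF small_err_ln[of "\<bar>M\<bar>"]])
  have "eventually (\<lambda>r. r \<ge> 1) \<F>" by (rule ev_top[OF eventually_ge_at_top])
  then show "\<forall>\<^sub>F r in \<F>. M \<le> \<bar>M\<bar> * (1 + ln r)"
  proof eventually_elim
    case (elim r)
    have "\<bar>M\<bar> * 1 \<le> \<bar>M\<bar> * (1 + ln r)" using elim by (intro mult_left_mono) auto
    then show ?case by simp
  qed
qed

lemma small_err_T_s: "small_err (\<lambda>r. nev_T r s)"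
  using small_s by (simp add: small_err_def)

lemma ev_r: "eventually (\<lambda>r. r \<ge> 1 \<and> r \<ge> x \<and> 1 \<le> r powr \<delta> \<and> x \<le> r powr \<delta> \<and> r powr \<delta> \<le> r) \<F>"
proof -
  have 1: "filterlim (\<lambda>r. r powr \<delta>) at_top at_top"
    by (rule powr_filterlim_at_top[OF \<delta>(1)])
  have "eventually (\<lambda>r. r \<ge> 1) \<F>" "eventually (\<lambda>r. r \<ge> x) \<F>" "eventually (\<lambda>r. 1 \<le> r powr \<delta>) \<F>" "eventually (\<lambda>r. x \<le> r powr \<delta>) \<F>"
    using 1 by (auto intro!: ev_top simp: filterlim_at_top eventually_ge_at_top)
  then show ?thesis
  proof eventually_elim
    case (elim r)
    have "r powr \<delta> \<le> r powr 1" using elim \<delta> by (intro powr_mono) auto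
    then show ?case using elim by simp
  qed
qed

lemma dominated_mono: "dominated \<theta> u \<Longrightarrow> \<theta>' \<le> \<theta> \<Longrightarrow> dominated \<theta>' u"
proof -
  assume u: "dominated \<theta> u" and t: "\<theta>' \<le> \<theta>"
  have "near_radii \<theta>' r \<subseteq> near_radii \<theta> r" for r
    using mult_right_mono[OF t, of "r powr \<delta>"] by (auto simp: near_radii_def)
  then show ?thesis using u unfolding dominated_def by (fast elim: eventually_mono)
qed

lemma dominated_le: "dominated \<theta> u \<Longrightarrow> (\<And>R. R \<in> G \<Longrightarrow> R \<ge> 1 \<Longrightarrow> v R \<le> u R) \<Longrightarrow> dominated \<theta> v"
proof -
  assume u: "dominated \<theta> u" and v: "\<And>R. R \<in> G \<Longrightarrow> R \<ge> 1 \<Longrightarrow> v R \<le> u R"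
  then obtain K where K: "K \<ge> 0" "eventually (\<lambda>r. \<forall>R\<in>near_radii \<theta> r. u R \<le> K * nev_T r f) \<F>" by (auto simp: dominated_def)
  have "eventually (\<lambda>r. \<forall>R\<in>near_radii \<theta> r. v R \<le> K * nev_T r f) \<F>"
    using K(2) ev_r[of 1] by eventually_elim (use v in \<open>force simp: near_radii_def\<close>)
  then show ?thesis using K(1) by (auto simp: dominated_def)
qed

lemma dominated_add: "dominated \<theta> u \<Longrightarrow> dominated \<theta> v \<Longrightarrow> dominated \<theta> (\<lambda>r. u r + v r)"
proof -
  assume "dominated \<theta> u" "dominated \<theta> v"
  then obtain K L where K: "K \<ge> 0" "eventually (\<lambda>r. \<forall>R\<in>near_radii \<theta> r. u R \<le> K * nev_T r f) \<F>"
    "L \<ge> 0" "eventually (\<lambda>r. \<forall>R\<in>near_radii \<theta> r. v R \<le> L * nev_T r f) \<F>" by (auto simp: dominated_def)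
  have "eventually (\<lambda>r. \<forall>R\<in>near_radii \<theta> r. u R + v R \<le> (K + L) * nev_T r f) \<F>"
    using K(2,4) by eventually_elim (force simp: distrib_right)
  then show ?thesis using K(1,3) unfolding dominated_def by (intro exI[of _ "K + L"]) auto
qed

lemma dominated_cmult: "dominated \<theta> u \<Longrightarrow> k \<ge> 0 \<Longrightarrow> dominated \<theta> (\<lambda>r. k * u r)"
proof -
  assume "dominated \<theta> u" and k: "k \<ge> 0"
  then obtain K where K: "K \<ge> 0" "eventually (\<lambda>r. \<forall>R\<in>near_radii \<theta> r. u R \<le> K * nev_T r f) \<F>" by (auto simp: dominated_def)
  have "eventually (\<lambda>r. \<forall>R\<in>near_radii \<theta> r. k * u R \<le> (k * K) * nev_T r f) \<F>"
    using K(2) by eventually_elim (use k in \<open>simp add: mult_left_mono mult.assoc\<close>)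
  then show ?thesis using K(1) k unfolding dominated_def by (intro exI[of _ "k * K"]) auto
qed

lemma dominated_const: "dominated \<theta> (\<lambda>r. M)"
  unfolding dominated_def using T_ge[of M] by (intro exI[of _ 1]) (auto elim: eventually_mono)

lemma dominated_sum: "finite A \<Longrightarrow> (\<And>x. x \<in> A \<Longrightarrow> dominated \<theta> (u x)) \<Longrightarrow> dominated \<theta> (\<lambda>r. \<Sum>x\<in>A. u x r)"
proof (induction A rule: finite_induct)
  case empty
  then show ?case using dominated_const[of \<theta> 0] by simp
next
  case (insert x A)
  then show ?case using dominated_add[of \<theta> "u x" "\<lambda>r. \<Sum>x\<in>A. u x r"] by auto
qed

text \<open>\<open>gap\<close> provides one good radius at or beyond the end of the window;
  monotonicity of both characteristics spreads its bound over the window.\<close>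

lemma dominated_f_s: "dominated 1 (\<lambda>r. nev_T r f)" "dominated 1 (\<lambda>r. nev_T r s)"
proof -
  have *: "eventually (\<lambda>r. \<forall>R\<in>near_radii 1 r. nev_T R f \<le> 4 * nev_T r f \<and> nev_T R s \<le> 4 * nev_T r f) \<F>"
    using gap ev_r[of 1]
  proof eventually_elim
    case (elim r)
    then obtain R0 where R0: "R0 \<in> G" "r + r powr \<delta> \<le> R0" "nev_T R0 f + nev_T R0 s \<le> 4 * nev_T r f" by auto
    have "nev_T R f \<le> nev_T R0 f \<and> nev_T R s \<le> nev_T R0 s" if R: "R \<in> near_radii 1 r" for R
    proof (cases "R = R0")
      case False
      then have "R < R0" "1 \<le> R" "R \<in> G" using R R0 elim by (auto simp: near_radii_def)
      then show ?thesis using R0(1) by (intro conjI nev_T_mono f s Gf Gs)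
    qed simp
    note le = this
    have "R0 \<ge> 1" using R0(2) elim(2) by linarith
    then have nn: "nev_T R0 f \<ge> 0" "nev_T R0 s \<ge> 0" by (intro nev_T_nonneg f s; simp)+
    show ?case
    proof
      fix R assume "R \<in> near_radii 1 r"
      from le[OF this] nn R0(3) show "nev_T R f \<le> 4 * nev_T r f \<and> nev_T R s \<le> 4 * nev_T r f" by linarith
    qed
  qed
  have "eventually (\<lambda>r. \<forall>R\<in>near_radii 1 r. nev_T R f \<le> 4 * nev_T r f) \<F>"
    "eventually (\<lambda>r. \<forall>R\<in>near_radii 1 r. nev_T R s \<le> 4 * nev_T r f) \<F>"
    by (rule eventually_mono[OF *], blast)+
  then show "dominated 1 (\<lambda>r. nev_T r f)" "dominated 1 (\<lambda>r. nev_T r s)"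
    unfolding dominated_def by (blast intro: zero_le_numeral)+
qed
lemma ex_regular_radius:
  assumes "a < b" obtains x where "a < x" "x < b" "x \<in> G"
proof -
  obtain x where "a < x" "x < b" "x \<notin> - G" by (rule ex_avoid_countable[OF G assms])
  then show thesis using that[of x] by simp
qed

text \<open>Uniform over a window, because the characteristic of a shift has to be controlled at all
  nearby radii and not just at \<open>r\<close>.\<close>

lemma difference_near_radii:
  assumes c: "c \<noteq> 0" and Gc: "\<And>r. r \<in> G \<Longrightarrow> circle_regular (\<lambda>z. f (z + c)) r" and e: "\<epsilon> > 0"
  shows "eventually (\<lambda>r. \<forall>R\<in>near_radii (1/2) r. nev_m R (\<lambda>z. f (z + c) / f z) \<le> \<epsilon> * nev_T r f) \<F>"
proof -
  obtain C where C: "C \<ge> 0" "\<And>r g R0. \<lbrakk>1 \<le> r; 8 * norm c \<le> g; g \<le> r; r + g \<le> R0; circle_regular f r; circle_regular (\<lambda>z. f (z + c)) r; circle_regular f R0\<rbrakk> \<Longrightarrow>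
     nev_m r (\<lambda>z. f (z + c) / f z) \<le> (2 * nev_T R0 f + C) * (norm c * 16 * (2 + ln (1 + r / norm c)) / g)"
    by (rule log_difference_gap[OF f c]) (rule that; blast)
  obtain K where K: "K \<ge> 0" "eventually (\<lambda>r. \<forall>R\<in>near_radii 1 r. nev_T R f \<le> K * nev_T r f) \<F>"
    using dominated_f_s(1) by (auto simp: dominated_def)
  let ?\<phi> = "\<lambda>r. norm c * 16 * (2 + ln (1 + 2 * r / norm c)) / (r powr \<delta> / 4)"
  have c0: "norm c > 0" using c by simp
  have "eventually (\<lambda>r. ?\<phi> r < \<epsilon> / (2 * K + 1)) at_top"
    using e K(1) by (intro order_tendstoD[OF log_kernel_tendsto[OF c0 \<delta>(1)]]) auto
  then have "eventually (\<lambda>r. ?\<phi> r < \<epsilon> / (2 * K + 1)) \<F>" by (rule ev_top)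
  \<comment> \<open>The threshold \<open>32 |c|\<close> gives
    \<open>8 |c| <= r powr \<delta> / 4\<close>, the gap condition of
    \<open>log_difference_gap\<close>.\<close>
  then show ?thesis using K(2) ev_r[of "32 * norm c"] T_ge[of C] T_nonneg
  proof eventually_elim
    case (elim r)
    let ?g = "r powr \<delta> / 4"
    show ?case
    proof
      fix R assume R: "R \<in> near_radii (1/2) r"
      \<comment> \<open>For \<open>R\<close> in the half window,
        \<open>R + r powr \<delta> / 4 <= R0\<close>, and \<open>R0\<close> is still in the full
        window.\<close>
      obtain R0 where R0: "r + 3/4 * r powr \<delta> < R0" "R0 < r + r powr \<delta>" "R0 \<in> G"
        using ex_regular_radius[of "r + 3/4 * r powr \<delta>" "r + r powr \<delta>"] elim(3) by auto
      have R': "r \<le> R" "R \<le> r + r powr \<delta> / 2" "R \<in> G" using R by (auto simp: near_radii_def)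
      have L0: "2 + ln (1 + R / norm c) \<ge> 0" using R' elim(3) c0 by (intro add_nonneg_nonneg ln_ge_zero) auto
      have "nev_m R (\<lambda>z. f (z + c) / f z) \<le> (2 * nev_T R0 f + C) * (norm c * 16 * (2 + ln (1 + R / norm c)) / ?g)"
        by (rule C(2)) (use R' R0 elim(3) Gf Gc in auto)
      also have "\<dots> \<le> ((2 * K + 1) * nev_T r f) * ?\<phi> r"
      proof (rule mult_mono)
        have "R0 \<in> near_radii 1 r" using R0 elim(3) by (auto simp: near_radii_def)
        then have "nev_T R0 f \<le> K * nev_T r f" using elim(2) by auto
        then show "2 * nev_T R0 f + C \<le> (2 * K + 1) * nev_T r f" using elim(4) by (simp add: algebra_simps)
        have "R \<le> 2 * r" using R' elim(3) by linarith
        then have "ln (1 + R / norm c) \<le> ln (1 + 2 * r / norm c)"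
          using R' elim(3) c0 by (intro ln_mono add_left_mono divide_right_mono add_pos_nonneg) auto
        then show "norm c * 16 * (2 + ln (1 + R / norm c)) / ?g \<le> ?\<phi> r"
          using elim(3) by (intro divide_right_mono mult_left_mono add_left_mono) auto
        show "0 \<le> (2 * K + 1) * nev_T r f" using K(1) elim(5) by simp
        show "0 \<le> norm c * 16 * (2 + ln (1 + R / norm c)) / ?g" using L0 by simp
      qed
      also have "\<dots> \<le> ((2 * K + 1) * nev_T r f) * (\<epsilon> / (2 * K + 1))"
        using elim(1,5) K(1) by (intro mult_left_mono) auto
      also have "\<dots> = \<epsilon> * nev_T r f" using K(1) by simp
      finally show "nev_m R (\<lambda>z. f (z + c) / f z) \<le> \<epsilon> * nev_T r f" .
    qed
  qed
qed

lemma small_err_of_near_radii: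
  assumes "\<And>\<epsilon>. \<epsilon> > 0 \<Longrightarrow> eventually (\<lambda>r. \<forall>R\<in>near_radii (1/2) r. u R \<le> \<epsilon> * nev_T r f) \<F>"
  shows "small_err u"
  unfolding small_err_def
proof (intro allI impI)
  fix \<epsilon> :: real assume "\<epsilon> > 0"
  from assms[OF this] ev_G show "\<forall>\<^sub>F r in \<F>. u r \<le> \<epsilon> * nev_T r f"
    by eventually_elim (auto simp: near_radii_def)
qed

lemma small_err_log_derivative:
  assumes p: "nonzero_mero \<phi>" and Gp: "\<And>r. r \<in> G \<Longrightarrow> circle_regular \<phi> r" and d: "dominated (1/2) (\<lambda>r. nev_T r \<phi>)"
  shows "small_err (\<lambda>r. nev_m r (\<lambda>z. deriv \<phi> z / \<phi> z))"
  unfolding small_err_def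
proof (intro allI impI)
  fix \<epsilon> :: real assume e: "\<epsilon> > 0"
  obtain C where C: "C \<ge> 0" "\<And>r g R0. \<lbrakk>1 \<le> r; 0 < g; g \<le> r; r + g \<le> R0; circle_regular \<phi> r; circle_regular \<phi> R0\<rbrakk> \<Longrightarrow>
     nev_m r (\<lambda>z. deriv \<phi> z / \<phi> z) \<le> (2 * nev_T R0 \<phi> + C) * (16 * (2 + ln (1 + r)) / g)"
    by (rule log_derivative_gap[OF p]) (rule that; blast)
  obtain K where K: "K \<ge> 0" "eventually (\<lambda>r. \<forall>R\<in>near_radii (1/2) r. nev_T R \<phi> \<le> K * nev_T r f) \<F>"
    using d by (auto simp: dominated_def)
  let ?\<phi> = "\<lambda>r. 1 * 16 * (2 + ln (1 + 2 * r / 1)) / (r powr \<delta> / 4)"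
  have "eventually (\<lambda>r. ?\<phi> r < \<epsilon> / (2 * K + 1)) at_top"
    using e K(1) \<delta> by (intro order_tendstoD[OF log_kernel_tendsto]) auto
  then have "eventually (\<lambda>r. ?\<phi> r < \<epsilon> / (2 * K + 1)) \<F>" by (rule ev_top)
  then show "\<forall>\<^sub>F r in \<F>. nev_m r (\<lambda>z. deriv \<phi> z / \<phi> z) \<le> \<epsilon> * nev_T r f"
    using K(2) ev_r[of 1] T_ge[of C] T_nonneg ev_G
  proof eventually_elim
    case (elim r)
    let ?g = "r powr \<delta> / 4"
    obtain R0 where R0: "r + ?g < R0" "R0 < r + r powr \<delta> / 2" "R0 \<in> G"
      using ex_regular_radius[of "r + ?g" "r + r powr \<delta> / 2"] elim(3) by auto
    have "nev_m r (\<lambda>z. deriv \<phi> z / \<phi> z) \<le> (2 * nev_T R0 \<phi> + C) * (16 * (2 + ln (1 + r)) / ?g)"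
      by (rule C(2)) (use R0 elim(3,6) Gp in auto)
    also have "\<dots> \<le> ((2 * K + 1) * nev_T r f) * ?\<phi> r"
    proof (rule mult_mono)
      have "R0 \<in> near_radii (1/2) r" using R0 elim(3) by (auto simp: near_radii_def)
      then have "nev_T R0 \<phi> \<le> K * nev_T r f" using elim(2) by auto
      then show "2 * nev_T R0 \<phi> + C \<le> (2 * K + 1) * nev_T r f" using elim(4) by (simp add: algebra_simps)
      have "ln (1 + r) \<le> ln (1 + 2 * r / 1)" using elim(3) by (intro ln_mono) auto
      then have "16 * (2 + ln (1 + r)) \<le> 1 * 16 * (2 + ln (1 + 2 * r / 1))" by simp
      then show "16 * (2 + ln (1 + r)) / ?g \<le> ?\<phi> r" by (intro divide_right_mono) auto
      show "0 \<le> (2 * K + 1) * nev_T r f" using K(1) elim(5) by simp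
      show "0 \<le> 16 * (2 + ln (1 + r)) / ?g" using elim(3) by (intro divide_nonneg_nonneg mult_nonneg_nonneg add_nonneg_nonneg ln_ge_zero) auto
    qed
    also have "\<dots> \<le> ((2 * K + 1) * nev_T r f) * (\<epsilon> / (2 * K + 1))"
      using elim(1,5) K(1) by (intro mult_left_mono) auto
    also have "\<dots> = \<epsilon> * nev_T r f" using K(1) by simp
    finally show ?case .
  qed
qed

text \<open>\<open>R\<close> need not be a regular radius and may lie to the left of
  \<open>r\<close>. Counting functions increase with the radius, so one may move to a regular
  \<open>R0\<close> that is in the window of \<open>r\<close>, where \<open>N <= T\<close>.\<close>

lemma log_count_le_gap:
  assumes D: "locally_finite_supp D" "\<And>a. D a \<ge> 0" "\<And>a. D a \<le> pole_ord f a" and d: "\<theta> < 1" and K: "\<forall>R\<in>near_radii 1 r. nev_T R f \<le> K * nev_T r f"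
    and r: "1 \<le> r" "0 < r powr \<delta>" and R: "0 < R" "R \<le> r + \<theta> * r powr \<delta>"
  shows "log_count D R \<le> K * nev_T r f"
proof -
  have *: "\<theta> * r powr \<delta> < 1 * r powr \<delta>" by (rule mult_strict_right_mono[OF d r(2)])
  have "R < r + r powr \<delta>" using * R(2) by linarith
  then have "max r R < r + r powr \<delta>" using r(2) by (auto simp del: powr_gt_zero)
  then obtain R0 where R0: "max r R < R0" "R0 < r + r powr \<delta>" "R0 \<in> G" by (rule ex_regular_radius)
  have "log_count D R \<le> (\<Sum>a\<in>supp_in D R. D a * log_weight R0 a)"
    unfolding log_count_def using R R0 by (intro sum_mono mult_left_mono log_weight_mono D) auto
  also have "\<dots> \<le> log_count D R0" unfolding log_count_def using D R0 r
    by (intro sum_mono2 mult_nonneg_nonneg log_weight_nonneg) (auto simp: locally_finite_supp_def supp_in_def)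
  also have "\<dots> \<le> log_count (pole_ord f) R0" using R0 r by (intro log_count_mono D locally_finite_supp_pole_ord f) auto
  also have "\<dots> = nev_N R0 f" using R0 r f by (simp add: nev_N_eq)
  also have "\<dots> \<le> nev_T R0 f" using nev_m_nonneg[of R0 f] R0 r by (simp add: nev_T_def)
  also have "\<dots> \<le> K * nev_T r f" using K R0 r by (auto simp: near_radii_def)
  finally show ?thesis .
qed

text \<open>\<open>T(R, f(z + c))\<close> splits into \<open>m\<close>, controlled by the quotient
  \<open>f(z + c)/f(z)\<close>, and \<open>N\<close>, controlled by translating the poles. Only
  boundedness relative to \<open>T(r, f)\<close> is wanted, so \<open>\<eta> = 1\<close> is good
  enough.\<close>

lemma dominated_shift:
  assumes c: "c \<noteq> 0" and Gc: "\<And>r. r \<in> G \<Longrightarrow> circle_regular (\<lambda>z. f (z + c)) r"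
  shows "dominated (1/2) (\<lambda>r. nev_T r (\<lambda>z. f (z + c)))"
proof -
  let ?fc = "\<lambda>z. f (z + c)"
  have fc: "nonzero_mero ?fc" by (rule nonzero_mero_shift[OF f])
  have pfc: "pole_ord ?fc = (\<lambda>a. pole_ord f (a + c))" by (auto simp: pole_ord_def zorder_shift_add fun_eq_iff)
  obtain K where K: "K \<ge> 0" "eventually (\<lambda>r. \<forall>R\<in>near_radii 1 r. nev_T R f \<le> K * nev_T r f) \<F>"
    using dominated_f_s(1) by (auto simp: dominated_def)
  have p0: "pole_ord f a \<ge> 0" for a by (simp add: pole_ord_def)
  obtain M where M: "\<And>r g. \<lbrakk>1 \<le> r; g \<le> r; 2 * norm c \<le> g; 0 < g\<rbrakk> \<Longrightarrow>
    log_count (\<lambda>a. pole_ord f (a + c)) r \<le> (1 + 1) * (log_count (pole_ord f) r + 4 * norm c / g * log_count (pole_ord f) (r + g)) + M * (1 + ln r)"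
    by (rule log_count_shift_le[OF locally_finite_supp_pole_ord[OF f] p0 zero_less_one]) (rule that; blast)
  have near_radii1: "eventually (\<lambda>r. \<forall>R\<in>near_radii (1/2) r. nev_m R (\<lambda>z. f (z + c) / f z) \<le> 1 * nev_T r f) \<F>"
    by (rule difference_near_radii[OF c Gc zero_less_one])
  have ln1: "eventually (\<lambda>r. \<bar>M\<bar> * (1 + ln r) \<le> 1 * nev_T r f) \<F>" using small_err_ln[of "\<bar>M\<bar>"] unfolding small_err_def by (rule allE[of _ 1]) simp
  have "eventually (\<lambda>r. \<forall>R\<in>near_radii (1/2) r. nev_T R ?fc \<le> (1 + K + 4 * K + 1 + \<bar>M\<bar>) * nev_T r f) \<F>"
    \<comment> \<open>\<open>16 |c| <= r powr \<delta>\<close> makes the factor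
      \<open>4 |c| / (r powr \<delta> / 4)\<close> at most 1.\<close>
    using near_radii1 K(2) ev_r[of "16 * norm c"] T_ge[of 1] ln1
  proof eventually_elim
    case (elim r)
    let ?g = "r powr \<delta> / 4"
    show ?case
    proof
      fix R assume R: "R \<in> near_radii (1/2) r"
      have R': "r \<le> R" "R \<le> r + r powr \<delta> / 2" "R \<in> G" using R by (auto simp: near_radii_def)
      have R1: "R \<ge> 1" "R > 0" using R' elim(3) by auto
      have Tf: "nev_T R f \<le> K * nev_T r f"
        using elim(2,3) R' by (auto simp: near_radii_def)
      have N: "nev_N R ?fc \<le> (4 * K + 1 + \<bar>M\<bar>) * nev_T r f"
      proof -
        have a1: "log_count (pole_ord f) R \<le> K * nev_T r f"
          by (rule log_count_le_gap[OF locally_finite_supp_pole_ord[OF f] p0 _ _ elim(2), of "1/2"]) (use R' R1 elim(3) in auto)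
        have a2: "log_count (pole_ord f) (R + ?g) \<le> K * nev_T r f"
          by (rule log_count_le_gap[OF locally_finite_supp_pole_ord[OF f] p0 _ _ elim(2), of "3/4"]) (use R' R1 elim(3) in auto)
        have a3: "4 * norm c / ?g \<le> 1" using elim(3) by (simp add: divide_le_eq)
        have a4: "0 \<le> log_count (pole_ord f) (R + ?g)" using R1 elim(3) by (intro log_count_nonneg p0) auto
        have "R \<le> 2 * r" using R' elim(3) by linarith
        then have "ln R \<le> ln (2 * r)" using R1 by (intro ln_mono) auto
        then have "ln R \<le> ln 2 + ln r" using elim(3) by (simp add: ln_mult)
        then have a5: "ln R \<le> 1 + ln r" using ln_2_less_1 by linarith
        have "M * (1 + ln R) \<le> \<bar>M\<bar> * (1 + ln R)" using R1 by (intro mult_right_mono) auto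
        also have "\<dots> \<le> \<bar>M\<bar> * (1 + (1 + ln r))" using a5 by (intro mult_left_mono) auto
        also have "\<dots> = \<bar>M\<bar> + \<bar>M\<bar> * (1 + ln r)" by (simp add: algebra_simps)
        also have "\<dots> \<le> \<bar>M\<bar> * nev_T r f + 1 * nev_T r f"
          using elim(4,5) mult_left_mono[of 1 "nev_T r f" "\<bar>M\<bar>"] by simp
        finally have a6: "M * (1 + ln R) \<le> (\<bar>M\<bar> + 1) * nev_T r f" by (simp add: algebra_simps)
        have "4 * norm c / ?g * log_count (pole_ord f) (R + ?g) \<le> 1 * (K * nev_T r f)"
          using a2 a3 a4 by (intro mult_mono) auto
        then have "(1 + 1) * (log_count (pole_ord f) R + 4 * norm c / ?g * log_count (pole_ord f) (R + ?g)) \<le> 4 * (K * nev_T r f)"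
          using a1 by simp
        moreover have "log_count (\<lambda>a. pole_ord f (a + c)) R \<le> (1 + 1) * (log_count (pole_ord f) R + 4 * norm c / ?g * log_count (pole_ord f) (R + ?g)) + M * (1 + ln R)"
          by (rule M) (use R1 R' elim(3) in auto)
        ultimately show ?thesis using a6 fc R1 by (simp add: nev_N_eq pfc algebra_simps)
      qed
      have "nev_m R ?fc \<le> circle_mean R (\<lambda>z. log_plus (norm (f (z + c) / f z)) + log_plus (norm (f z)))"
        unfolding nev_m_eq
      proof (rule circle_mean_mono)
        show "continuous_on (sphere 0 R) (\<lambda>z. log_plus (norm (f (z + c) / f z)) + log_plus (norm (f z)))"
          by (intro continuous_on_add continuous_log_plus_circle_regular circle_regular_divide Gc Gf R')
        show "continuous_on (sphere 0 R) (\<lambda>z. log_plus (norm (f (z + c))))"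
          by (rule continuous_log_plus_circle_regular[OF Gc[OF R'(3)]])
        fix z :: complex assume z: "norm z = R"
        have "norm (f (z + c)) = norm (f (z + c) / f z) * norm (f z)"
          using circle_regular_pos[OF Gf[OF R'(3)] z] by (simp add: norm_divide)
        then show "log_plus (norm (f (z + c))) \<le> log_plus (norm (f (z + c) / f z)) + log_plus (norm (f z))"
          using log_plus_mult_le[of "norm (f (z + c) / f z)" "norm (f z)"] by simp
      qed (use R1 in auto)
      also have "\<dots> = nev_m R (\<lambda>z. f (z + c) / f z) + nev_m R f"
        unfolding nev_m_eq using R1 by (intro circle_mean_add continuous_log_plus_circle_regular circle_regular_divide Gc Gf R') auto
      also have "\<dots> \<le> 1 * nev_T r f + K * nev_T r f"
        using elim(1) R Tf nev_N_nonneg[OF f R1(1)] by (intro add_mono) (auto simp: nev_T_def[of R f])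
      finally have "nev_m R ?fc \<le> nev_T r f + K * nev_T r f" by simp
      then show "nev_T R ?fc \<le> (1 + K + 4 * K + 1 + \<bar>M\<bar>) * nev_T r f"
        using N by (simp add: nev_T_def[of R ?fc] algebra_simps)
    qed
  qed
  then show ?thesis using K(1) unfolding dominated_def by (intro exI[of _ "1 + K + 4 * K + 1 + \<bar>M\<bar>"]) auto
qed

text \<open>Here the leading constant must be 1 up to \<open>o(T)\<close>, since it enters the
  coefficient of \<open>Nbar(r, f)\<close>; so \<eta> is tuned to \<epsilon> after the growth
  constant \<open>K\<close> is known.\<close>

lemma small_err_Nbar_shift: "small_err (\<lambda>r. log_count (\<lambda>a. pole_ind f (a + c)) r - log_count (pole_ind f) r)"
  unfolding small_err_def
proof (intro allI impI)
  fix \<epsilon> :: real assume e: "\<epsilon> > 0"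
  obtain K where K: "K \<ge> 0" "eventually (\<lambda>r. \<forall>R\<in>near_radii 1 r. nev_T R f \<le> K * nev_T r f) \<F>"
    using dominated_f_s(1) by (auto simp: dominated_def)
  have p: "locally_finite_supp (pole_ind f)" "\<And>a. pole_ind f a \<ge> 0" "\<And>a. pole_ind f a \<le> pole_ord f a"
    using locally_finite_supp_pole_ind[OF f] pole_ind_le_pole_ord by (auto simp: pole_ind_def)
  define \<eta> where "\<eta> = min 1 (\<epsilon> / (4 * (K + 1)))"
  have eta: "\<eta> > 0" "\<eta> \<le> 1" "\<eta> * K \<le> \<epsilon> / 4"
  proof -
    show "\<eta> > 0" "\<eta> \<le> 1" using e K by (auto simp: \<eta>_def)
    have "\<eta> * K \<le> \<epsilon> / (4 * (K + 1)) * K" using K by (intro mult_right_mono) (auto simp: \<eta>_def)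
    also have "\<dots> = \<epsilon> / 4 * (K / (K + 1))" by simp
    also have "\<dots> \<le> \<epsilon> / 4 * 1" using e K by (intro mult_left_mono) auto
    finally show "\<eta> * K \<le> \<epsilon> / 4" by simp
  qed
  obtain M where M: "\<And>r g. \<lbrakk>1 \<le> r; g \<le> r; 2 * norm c \<le> g; 0 < g\<rbrakk> \<Longrightarrow>
    log_count (\<lambda>a. pole_ind f (a + c)) r \<le> (1 + \<eta>) * (log_count (pole_ind f) r + 4 * norm c / g * log_count (pole_ind f) (r + g)) + M * (1 + ln r)"
    by (rule log_count_shift_le[OF p(1,2) eta(1)]) (rule that; blast)
  have ln1: "eventually (\<lambda>r. M * (1 + ln r) \<le> \<epsilon> / 4 * nev_T r f) \<F>" 
    using small_err_ln[of M, unfolded small_err_def, rule_format, of "\<epsilon> / 4"] e by linarith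
  show "\<forall>\<^sub>F r in \<F>. log_count (\<lambda>a. pole_ind f (a + c)) r - log_count (pole_ind f) r \<le> \<epsilon> * nev_T r f"
    using K(2) ev_r[of "max (4 * norm c) (64 * norm c * (K + 1) / \<epsilon>)"] T_nonneg ln1 ev_G
  proof eventually_elim
    case (elim r)
    let ?g = "r powr \<delta> / 2"
    have r: "1 \<le> r" "0 < r powr \<delta>" "4 * norm c \<le> r powr \<delta>" "64 * norm c * (K + 1) / \<epsilon> \<le> r powr \<delta>" "r powr \<delta> \<le> r"
      using elim(2) by auto
    have a1: "log_count (pole_ind f) r \<le> K * nev_T r f"
      by (rule log_count_le_gap[OF p _ elim(1), of 0]) (use r in auto)
    have a2: "log_count (pole_ind f) (r + ?g) \<le> K * nev_T r f"
      by (rule log_count_le_gap[OF p _ elim(1), of "1/2"]) (use r in \<open>auto intro: add_pos_nonneg\<close>)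
    have a3: "4 * norm c / ?g * K \<le> \<epsilon> / 4"
    proof -
      have "64 * norm c * (K + 1) \<le> r powr \<delta> * \<epsilon>" using r(4) e by (simp add: divide_le_eq)
      moreover have "32 * norm c * K \<le> 64 * norm c * (K + 1)" using K(1) by (intro mult_mono) auto
      ultimately have "32 * norm c * K \<le> r powr \<delta> * \<epsilon>" by linarith
      then show ?thesis using r(2) by (simp add: field_simps)
    qed
    have "log_count (\<lambda>a. pole_ind f (a + c)) r \<le> (1 + \<eta>) * (log_count (pole_ind f) r + 4 * norm c / ?g * log_count (pole_ind f) (r + ?g)) + M * (1 + ln r)"
      by (rule M) (use r in auto)
    \<comment> \<open>Error budget: one quarter of \<epsilon> from \<eta>, two quarters from the
      enlarged radius, one quarter from \<open>ln r\<close>.\<close>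
    also have "\<dots> \<le> log_count (pole_ind f) r + \<eta> * (K * nev_T r f) + 2 * (4 * norm c / ?g * (K * nev_T r f)) + \<epsilon> / 4 * nev_T r f"
    proof -
      have x: "4 * norm c / ?g * log_count (pole_ind f) (r + ?g) \<le> 4 * norm c / ?g * (K * nev_T r f)"
        using a2 by (intro mult_left_mono) auto
      have y: "0 \<le> 4 * norm c / ?g * (K * nev_T r f)" using K elim(3) by (intro mult_nonneg_nonneg) auto
      have "(1 + \<eta>) * (4 * norm c / ?g * log_count (pole_ind f) (r + ?g)) \<le> (1 + \<eta>) * (4 * norm c / ?g * (K * nev_T r f))"
        by (rule mult_left_mono[OF x]) (use eta in simp)
      also have "\<dots> \<le> 2 * (4 * norm c / ?g * (K * nev_T r f))" using y eta by (intro mult_right_mono) auto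
      finally have "(1 + \<eta>) * (4 * norm c / ?g * log_count (pole_ind f) (r + ?g)) \<le> 2 * (4 * norm c / ?g * (K * nev_T r f))" .
      moreover have "\<eta> * log_count (pole_ind f) r \<le> \<eta> * (K * nev_T r f)" using a1 eta by (intro mult_left_mono) auto
      ultimately show ?thesis using elim(4) by (simp only: distrib_left distrib_right mult_1)
    qed
    also have "\<eta> * (K * nev_T r f) \<le> \<epsilon> / 4 * nev_T r f"
      using mult_right_mono[OF eta(3) elim(3)] by (simp add: mult.assoc)
    also have "4 * norm c / ?g * (K * nev_T r f) \<le> \<epsilon> / 4 * nev_T r f"
      using mult_right_mono[OF a3 elim(3)] by (simp only: mult.assoc)
    finally show ?case by simp
  qed
qed

end

subsection \<open>The main inequality\<close>

lemma log_count_finite_support_le: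
  assumes "finite X" "\<And>a. D a \<ge> 0" "\<And>a. a \<notin> X \<Longrightarrow> D a = 0"
  obtains M where "\<And>r. r \<ge> 1 \<Longrightarrow> log_count D r \<le> M * (1 + ln r)"
proof (rule that)
  fix r :: real assume r: "r \<ge> 1"
  have "log_count D r = (\<Sum>a\<in>X. D a * log_weight r a)"
    by (rule log_count_superset) (use r assms in \<open>auto simp: supp_in_def\<close>)
  also have "\<dots> \<le> (\<Sum>a\<in>X. D a * ((1 + \<bar>ln (norm a)\<bar>) * (1 + ln r)))"
    by (intro sum_mono mult_left_mono log_weight_le_ln r assms)
  also have "\<dots> = (\<Sum>a\<in>X. D a * (1 + \<bar>ln (norm a)\<bar>)) * (1 + ln r)"
    by (simp add: sum_distrib_right mult.assoc)
  finally show "log_count D r \<le> (\<Sum>a\<in>X. D a * (1 + \<bar>ln (norm a)\<bar>)) * (1 + ln r)" .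
qed

lemma nonzero_mero_cong:
  assumes "nonzero_mero g" "\<forall>\<^sub>\<approx>z. h z = g z" "h meromorphic_on UNIV"
  shows "nonzero_mero h"
proof -
  have "\<forall>\<^sub>\<approx>z. g z \<noteq> 0" using assms(1) by (simp add: nonzero_mero_def)
  with assms(2) have "\<forall>\<^sub>\<approx>z. h z \<noteq> 0" by eventually_elim simp
  then show ?thesis using assms(3) by (simp add: nonzero_mero_def)
qed

lemma zorder_cosparse_cong:
  assumes "\<forall>\<^sub>\<approx>z. h z = g z"
  shows "zorder h a = zorder g a"
  by (rule zorder_cong) (use assms eventually_cosparse_imp_eventually_at in blast)+

context nevanlinna_gap
begin

lemma small_err_T_s_inverse: "small_err (\<lambda>r. nev_T r (\<lambda>z. inverse (s z)))"
proof -
  obtain C where C: "\<And>R. R \<ge> 1 \<Longrightarrow> circle_regular s R \<Longrightarrow> nev_T R s = nev_T R (\<lambda>z. inverse (s z)) + C"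
    using first_main_theorem[OF s] by metis
  have "eventually (\<lambda>r. nev_T r (\<lambda>z. inverse (s z)) \<le> nev_T r s + - C) \<F>"
    using ev_G ev_r[of 1] by eventually_elim (use C Gs in fastforce)
  then show ?thesis by (rule small_err_mono[OF small_err_add[OF small_err_T_s small_err_const]])
qed

lemma small_err_N_m:
  assumes "small_err (\<lambda>r. nev_T r g)" "nonzero_mero g"
  shows "small_err (\<lambda>r. nev_N r g)" "small_err (\<lambda>r. nev_m r g)"
proof -
  have "eventually (\<lambda>r. nev_N r g \<le> nev_T r g \<and> nev_m r g \<le> nev_T r g) \<F>"
    using ev_r[of 1]
  proof eventually_elim
    case (elim r)
    then show ?case using nev_m_nonneg[of r g] nev_N_nonneg[OF assms(2), of r] by (simp add: nev_T_def)
  qed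
  then show "small_err (\<lambda>r. nev_N r g)" "small_err (\<lambda>r. nev_m r g)"
    by (auto intro!: small_err_mono[OF assms(1)] elim: eventually_mono)
qed

text \<open>The mean of \<open>ln |w|\<close> enters the bound for \<open>m(r, 1/\<phi>)\<close>
  with a minus sign. Jensen's formula turns it into the orders of \<open>w\<close>, which the local
  count at each point bounds by \<open>Nbar\<close> terms minus the truncated zeros of
  \<phi>.\<close>

theorem main_inequality:
  fixes m n :: nat and c :: "nat \<Rightarrow> complex" and i :: "nat \<Rightarrow> nat" and \<phi> :: "complex \<Rightarrow> complex"
  defines "\<phi> \<equiv> \<lambda>z. f z ^ n * shift_monomial m c i f z / s z"
  assumes n: "n \<ge> 2" and c: "\<And>l. l \<in> {1..m} \<Longrightarrow> c l \<noteq> 0"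
    and fin: "finite {(a, b). is_pole f a \<and> isolated_zero f b \<and> a - b \<in> c ` {1..m}}"
    and Gc: "\<And>l r. l \<in> {1..m} \<Longrightarrow> r \<in> G \<Longrightarrow> circle_regular (\<lambda>z. f (z + c l)) r"
    and G1: "\<And>r. nonzero_mero (\<lambda>z. \<phi> z - 1) \<Longrightarrow> r \<in> G \<Longrightarrow> circle_regular (\<lambda>z. \<phi> z - 1) r"
    and Gw: "\<And>r. nonzero_mero (\<lambda>z. deriv \<phi> z / (\<phi> z - 1)) \<Longrightarrow> r \<in> G \<Longrightarrow> circle_regular (\<lambda>z. deriv \<phi> z / (\<phi> z - 1)) r"
  shows "small_err (\<lambda>r. (real n - 1) * nev_T r f - (real m + 1) * nev_Nbar r f
     - nev_Nbar r (\<lambda>z. 1 / (f z ^ n * shift_monomial m c i f z - s z)))"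
proof -
  let ?I = "{1..m}"
  define d where "d = (\<Sum>l=1..m. i l)"
  define fl where "fl = (\<lambda>l z. f (z + c l))"
  have nfl: "nonzero_mero (fl l)" for l unfolding fl_def by (rule nonzero_mero_shift[OF f])
  have Gfl: "circle_regular (fl l) r" if "l \<in> ?I" "r \<in> G" for l r unfolding fl_def by (rule Gc[OF that])
  have phi: "\<phi> = (\<lambda>z. f z ^ n * (\<Prod>l\<in>?I. fl l z ^ i l) / s z)"
    by (simp add: \<phi>_def shift_monomial_def fl_def)
  have nP: "nonzero_mero (\<lambda>z. \<Prod>l\<in>?I. fl l z ^ i l)" by (intro nonzero_mero_prod nonzero_mero_power nfl)
  have np: "nonzero_mero \<phi>" unfolding phi by (intro nonzero_mero_divide nonzero_mero_mult nonzero_mero_power f s nP)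
  have GP: "circle_regular (\<lambda>z. \<Prod>l\<in>?I. fl l z ^ i l) r" if "r \<in> G" for r by (intro circle_regular_prod circle_regular_power Gfl that) auto
  have Gp: "circle_regular \<phi> r" if "r \<in> G" for r unfolding phi by (intro circle_regular_divide circle_regular_mult circle_regular_power Gf Gs GP that)
  have zphi: "zorder \<phi> a = int n * zorder f a + (\<Sum>l\<in>?I. int (i l) * zorder f (a + c l)) - zorder s a" for a
  proof -
    have "zorder \<phi> a = zorder (\<lambda>z. f z ^ n * (\<Prod>l\<in>?I. fl l z ^ i l)) a - zorder s a"
      unfolding phi by (rule nonzero_mero_zorder_divide[OF nonzero_mero_mult[OF nonzero_mero_power[OF f] nP] s])
    also have "zorder (\<lambda>z. f z ^ n * (\<Prod>l\<in>?I. fl l z ^ i l)) a = zorder (\<lambda>z. f z ^ n) a + zorder (\<lambda>z. \<Prod>l\<in>?I. fl l z ^ i l) a"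
      by (rule nonzero_mero_zorder_mult[OF nonzero_mero_power[OF f] nP])
    also have "zorder (\<lambda>z. \<Prod>l\<in>?I. fl l z ^ i l) a = (\<Sum>l\<in>?I. zorder (\<lambda>z. fl l z ^ i l) a)"
      by (intro nonzero_mero_zorder_prod nonzero_mero_power nfl)
    finally show ?thesis by (simp add: nonzero_mero_zorder_power f nfl) (simp add: fl_def zorder_shift_add)
  qed
  \<comment> \<open>The zeros of \<open>f\<close> at which some shift has a pole. There the shifts
    may lower the order of \<phi>, and \<open>err\<close> pays for the whole contribution.\<close>
  define X where "X = snd ` {(a, b). is_pole f a \<and> isolated_zero f b \<and> a - b \<in> c ` {1..m}}"
  have finX: "finite X" unfolding X_def using fin by simp
  define err where "err = (\<lambda>a. if a \<in> X then (real n - 1) * zero_ord f a else 0)"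
  have err0: "err a \<ge> 0" for a using n by (auto simp: err_def zero_ord_def)
  have errX: "err a = 0" if "a \<notin> X" for a using that by (simp add: err_def)
  have lerr: "locally_finite_supp err" by (rule locally_finite_supp_subset[OF locally_finite_supp_zero_ord[OF f]]) (auto simp: err_def)
  obtain M where M: "\<And>r. r \<ge> 1 \<Longrightarrow> log_count err r \<le> M * (1 + ln r)"
    by (rule log_count_finite_support_le[of X err, OF finX err0 errX], assumption) (rule that; blast)
  have small_err_err: "small_err (\<lambda>r. log_count err r)"
    by (rule small_err_mono[OF small_err_ln[of M]]) (use ev_r[of 1] M in \<open>auto elim: eventually_mono\<close>)
  have zeros: "(real n - 1) * zero_ord f a \<le> max 0 (real_of_int (zorder \<phi> a) - 1) + zero_ord s a + err a" for a
  proof -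
    consider "zorder f a \<le> 0" | "a \<in> X" | "zorder f a > 0" "a \<notin> X" by linarith
    then show ?thesis
    proof cases
      case 1
      then show ?thesis using err0[of a] by (simp add: zero_ord_def)
    next
      case 2
      then show ?thesis by (simp add: err_def zero_ord_def)
    next
      \<comment> \<open>No shift has a pole at this zero of order \<open>p\<close>, so \<phi> has
        order at least \<open>n p\<close> minus the order of \<open>s\<close>, and
        \<open>n p - 1 >= (n - 1) p\<close> because \<open>p >= 1\<close>.\<close>
      case 3
      have "zorder f (a + c l) \<ge> 0" if l: "l \<in> ?I" for l
      proof (rule ccontr)
        assume "\<not> ?thesis"
        then have "is_pole f (a + c l)" "isolated_zero f a"
          using 3 is_pole_iff_zorder[OF f] isolated_zero_iff_zorder[OF f] by auto
        then have "(a + c l, a) \<in> {(a, b). is_pole f a \<and> isolated_zero f b \<and> a - b \<in> c ` {1..m}}"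
          using l by auto
        then show False using 3(2) unfolding X_def by force
      qed
      then have "(\<Sum>l\<in>?I. int (i l) * zorder f (a + c l)) \<ge> 0" by (intro sum_nonneg mult_nonneg_nonneg) auto
      then have "zorder \<phi> a \<ge> int n * zorder f a - zorder s a" using zphi[of a] by simp
      then have "real_of_int (zorder \<phi> a) \<ge> real_of_int (int n * zorder f a - zorder s a)" by linarith
      then have *: "real_of_int (zorder \<phi> a) \<ge> real n * zorder f a - zorder s a" by simp
      have "zero_ord f a = zorder f a" "zero_ord f a \<ge> 1" "real_of_int (zorder s a) \<le> zero_ord s a" using 3 by (auto simp: zero_ord_def)
      moreover from this have "(real n - 1) * zero_ord f a \<le> real n * zero_ord f a - 1" by (simp add: left_diff_distrib)
      ultimately show ?thesis using * err0[of a] by simp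
    qed
  qed
  have si: "nonzero_mero (\<lambda>z. inverse (s z))" and fi: "nonzero_mero (\<lambda>z. inverse (f z))"
    by (intro nonzero_mero_inverse s f)+
  define err1 where "err1 = (\<lambda>r. (\<Sum>l\<in>?I. real (i l) * nev_m r (\<lambda>z. fl l z / f z)) + nev_m r (\<lambda>z. inverse (s z)))"
  have small_err_err1: "small_err err1"
    unfolding err1_def
  proof (intro small_err_add small_err_sum small_err_cmult)
    show "small_err (\<lambda>r. nev_m r (\<lambda>z. fl l z / f z))" if l: "l \<in> ?I" for l
      unfolding fl_def by (intro small_err_of_near_radii difference_near_radii c Gc l)
    show "small_err (\<lambda>r. nev_m r (\<lambda>z. inverse (s z)))" by (rule small_err_N_m(2)[OF small_err_T_s_inverse si])
  qed auto
  \<comment> \<open>Write \<open>f^(-(n + d))\<close> as \<open>1/\<phi>\<close> times the quotients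
    \<open>(f(z + c l)/f(z)) ^ i l\<close> times \<open>1/s\<close>, and take
    \<open>log_plus\<close>.\<close>
  have prox: "(real n + real d) * nev_m r (\<lambda>z. inverse (f z)) \<le> nev_m r (\<lambda>z. inverse (\<phi> z)) + err1 r"
    if r: "r \<in> G" "r \<ge> 1" for r
  proof -
    have r0: "r \<ge> 0" using r by simp
    note cont = continuous_log_plus_circle_regular[OF circle_regular_inverse[OF Gf[OF r(1)]]] continuous_log_plus_circle_regular[OF circle_regular_inverse[OF Gp[OF r(1)]]]
      continuous_log_plus_circle_regular[OF circle_regular_inverse[OF Gs[OF r(1)]]]
    have cfl: "continuous_on (sphere 0 r) (\<lambda>z. real (i l) * log_plus (norm (fl l z / f z)))" if "l \<in> ?I" for l
      by (intro continuous_on_mult continuous_on_const continuous_log_plus_circle_regular circle_regular_divide Gfl Gf that r)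
    have "circle_mean r (\<lambda>z. (real n + real d) * log_plus (norm (inverse (f z))))
      \<le> circle_mean r (\<lambda>z. log_plus (norm (inverse (\<phi> z))) + ((\<Sum>l\<in>?I. real (i l) * log_plus (norm (fl l z / f z))) + log_plus (norm (inverse (s z)))))"
    proof (rule circle_mean_mono[OF r0])
      fix z :: complex assume z: "norm z = r"
      define x where "x = norm (f z)"
      define y where "y = (\<lambda>l. norm (fl l z))"
      define t where "t = norm (s z)"
      have pos: "x > 0" "t > 0" "\<And>l. l \<in> ?I \<Longrightarrow> y l > 0"
        unfolding x_def t_def y_def using circle_regular_pos[OF Gf[OF r(1)] z] circle_regular_pos[OF Gs[OF r(1)] z] circle_regular_pos[OF Gfl[OF _ r(1)] z] by auto
      have nphi: "norm (\<phi> z) = x ^ n * (\<Prod>l\<in>?I. y l ^ i l) / t"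
        unfolding phi x_def y_def t_def by (simp add: norm_mult norm_divide norm_power prod_norm[symmetric])
      have yp: "(\<Prod>l\<in>?I. y l ^ i l) > 0" using pos by (intro prod_pos) auto
      have "(\<Prod>l\<in>?I. (y l / x) ^ i l) = (\<Prod>l\<in>?I. y l ^ i l) / x ^ d"
        by (simp add: power_divide prod_dividef d_def power_sum)
      moreover have "inverse x ^ (n + d) = inverse (x ^ n * P / t) * (P / x ^ d * inverse t)" if "P > 0" for P :: real
        using pos(1,2) that by (simp add: power_add field_simps)
      from this[OF yp] have "inverse x ^ (n + d) = inverse (norm (\<phi> z)) * ((\<Prod>l\<in>?I. y l ^ i l) / x ^ d * inverse t)"
        by (simp only: nphi)
      ultimately have eq: "inverse x ^ (n + d) = inverse (norm (\<phi> z)) * ((\<Prod>l\<in>?I. (y l / x) ^ i l) * inverse t)"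
        by (simp only:)
      have "(real n + real d) * log_plus (inverse x) = log_plus (inverse x ^ (n + d))"
        using pos by (simp add: log_plus_power)
      also have "\<dots> \<le> log_plus (inverse (norm (\<phi> z))) + log_plus ((\<Prod>l\<in>?I. (y l / x) ^ i l) * inverse t)"
        unfolding eq using pos by (intro log_plus_mult_le mult_nonneg_nonneg prod_nonneg) (auto simp: less_imp_le)
      also have "log_plus ((\<Prod>l\<in>?I. (y l / x) ^ i l) * inverse t) \<le> log_plus (\<Prod>l\<in>?I. (y l / x) ^ i l) + log_plus (inverse t)"
        using pos by (intro log_plus_mult_le prod_nonneg) (auto simp: less_imp_le)
      also have "log_plus (\<Prod>l\<in>?I. (y l / x) ^ i l) \<le> (\<Sum>l\<in>?I. log_plus ((y l / x) ^ i l))"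
        using pos by (intro log_plus_prod_le) (auto simp: less_imp_le)
      also have "\<dots> = (\<Sum>l\<in>?I. real (i l) * log_plus (y l / x))"
        using pos by (intro sum.cong refl log_plus_power) (auto simp: less_imp_le)
      finally show "(real n + real d) * log_plus (norm (inverse (f z))) \<le> log_plus (norm (inverse (\<phi> z))) +
         ((\<Sum>l\<in>?I. real (i l) * log_plus (norm (fl l z / f z))) + log_plus (norm (inverse (s z))))"
        by (simp add: x_def y_def t_def norm_inverse norm_divide)
    qed (intro continuous_on_add continuous_on_sum continuous_on_mult continuous_on_const cont cfl; simp)+
    also have "\<dots> = circle_mean r (\<lambda>z. log_plus (norm (inverse (\<phi> z)))) + (circle_mean r (\<lambda>z. \<Sum>l\<in>?I. real (i l) * log_plus (norm (fl l z / f z)))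
        + circle_mean r (\<lambda>z. log_plus (norm (inverse (s z)))))"
      by (subst circle_mean_add[OF r0], intro cont, intro continuous_on_add continuous_on_sum cont cfl, simp,
          subst circle_mean_add[OF r0], intro continuous_on_sum cfl, simp, intro cont, rule refl)
    also have "circle_mean r (\<lambda>z. \<Sum>l\<in>?I. real (i l) * log_plus (norm (fl l z / f z))) = (\<Sum>l\<in>?I. real (i l) * circle_mean r (\<lambda>z. log_plus (norm (fl l z / f z))))"
      by (subst circle_mean_sum[OF r0 _ cfl]) (auto simp: circle_mean_cmult)
    finally show ?thesis unfolding err1_def nev_m_eq circle_mean_cmult by simp
  qed
  obtain Cf where Cf: "\<And>R. R \<ge> 1 \<Longrightarrow> circle_regular f R \<Longrightarrow> nev_T R f = nev_T R (\<lambda>z. inverse (f z)) + Cf"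
    using first_main_theorem[OF f] by metis
  have n1: "real n - 1 \<ge> 1" using n by simp
  \<comment> \<open>Only the weight \<open>n - 1\<close> is kept, to match the weight available for
    \<open>N(r, 1/f)\<close>.\<close>
  have m_le: "(real n - 1) * nev_m r (\<lambda>z. inverse (f z)) \<le> nev_m r (\<lambda>z. inverse (\<phi> z)) + err1 r"
    if r: "r \<in> G" "r \<ge> 1" for r
  proof -
    have "(real n - 1) * nev_m r (\<lambda>z. inverse (f z)) \<le> (real n + real d) * nev_m r (\<lambda>z. inverse (f z))"
      using r by (intro mult_right_mono nev_m_nonneg) auto
    then show ?thesis using prox[OF r] by linarith
  qed
  have small_err_sN: "small_err (\<lambda>r. nev_N r (\<lambda>z. inverse (s z)))" "small_err (\<lambda>r. nev_N r s)"
    by (rule small_err_N_m(1)[OF small_err_T_s_inverse si], rule small_err_N_m(1)[OF small_err_T_s s])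
  \<comment> \<open>A constant \<phi> would have no zeros, and the bounds for both parts of
    \<open>T(r, 1/f)\<close> would force \<open>(n - 1) T <= T / 2\<close>. This secures that
    neither \<open>\<phi> - 1\<close> nor the derivative of \<phi> vanishes identically.\<close>
  have nonconst: "\<not> (\<forall>\<^sub>\<approx>z. \<phi> z = k)" if k: "k \<noteq> 0" for k
  proof
    assume const: "\<forall>\<^sub>\<approx>z. \<phi> z = k"
    have z0: "zorder \<phi> a = 0" for a
      using zorder_cosparse_cong[OF const, of a] k by simp
    have N: "(real n - 1) * nev_N r (\<lambda>z. inverse (f z)) \<le> nev_N r (\<lambda>z. inverse (s z)) + log_count err r"
      if r: "r \<ge> 1" for r
    proof -
      have r0: "r > 0" using r by simp
      have "log_count (\<lambda>a. (real n - 1) * zero_ord f a) r \<le> log_count (\<lambda>a. zero_ord s a + err a) r"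
      proof (intro log_count_mono r locally_finite_supp_cmult locally_finite_supp_add locally_finite_supp_zero_ord f s lerr)
        show "(real n - 1) * zero_ord f a \<le> zero_ord s a + err a" for a using zeros[of a] z0[of a] by simp
      qed
      then show ?thesis
        using r0 by (simp add: log_count_cmult log_count_add locally_finite_supp_zero_ord lerr f s nev_N_eq fi si pole_ord_inverse)
    qed
    have mk: "nev_m r (\<lambda>z. inverse (\<phi> z)) = log_plus (norm (inverse k))" if r: "r \<in> G" "r \<ge> 1" for r
    proof -
      \<comment> \<open>\<phi> agrees with \<open>k\<close> only off a sparse set; on a regular
        circle continuity gives equality.\<close>
      have "\<phi> z = k" if z: "norm z = r" for z
      proof -
        have "isCont \<phi> z" using Gp[OF r(1)] z by (auto simp: circle_regular_def regular_at_def intro: analytic_at_imp_isCont)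
        then have "(\<phi> \<longlongrightarrow> \<phi> z) (at z)" by (simp add: isCont_def)
        moreover have "eventually (\<lambda>z. \<phi> z = k) (at z)" using const eventually_cosparse_imp_eventually_at by blast
        then have "(\<phi> \<longlongrightarrow> k) (at z)" by (rule tendsto_eventually)
        ultimately show ?thesis using tendsto_unique at_neq_bot by blast
      qed
      then have "nev_m r (\<lambda>z. inverse (\<phi> z)) = circle_mean r (\<lambda>z. log_plus (norm (inverse k)))"
        unfolding nev_m_eq using r by (intro circle_mean_cong) auto
      then show ?thesis by simp
    qed
    have "small_err (\<lambda>r. log_plus (norm (inverse k)) + err1 r + (nev_N r (\<lambda>z. inverse (s z)) + log_count err r) + (real n - 1) * Cf)"
      by (intro small_err_add small_err_const small_err_err1 small_err_sN small_err_err)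
    then have "eventually (\<lambda>r. log_plus (norm (inverse k)) + err1 r + (nev_N r (\<lambda>z. inverse (s z)) + log_count err r) + (real n - 1) * Cf \<le> 1 / 2 * nev_T r f) \<F>"
      unfolding small_err_def by (rule allE[of _ "1/2"]) simp
    then have "eventually (\<lambda>r. False) \<F>" using ev_G ev_r[of 1] T_ge[of 1]
    proof eventually_elim
      case (elim r)
      then have r: "r \<in> G" "r \<ge> 1" by auto
      have "(real n - 1) * nev_T r f = (real n - 1) * nev_m r (\<lambda>z. inverse (f z)) + (real n - 1) * nev_N r (\<lambda>z. inverse (f z)) + (real n - 1) * Cf"
        using Cf[OF r(2) Gf[OF r(1)]] by (simp only: nev_T_def[of r "\<lambda>z. inverse (f z)"] distrib_left)
      also have "\<dots> \<le> 1 / 2 * nev_T r f" using m_le[OF r] mk[OF r] N[OF r(2)] elim(1) by linarith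
      finally have "(real n - 1) * nev_T r f \<le> 1 / 2 * nev_T r f" .
      moreover have "1 * nev_T r f \<le> (real n - 1) * nev_T r f" using n1 elim(4) by (intro mult_right_mono) auto
      ultimately show ?case using elim(4) by linarith
    qed
    then show False using F_nontrivial by (simp add: trivial_limit_def)
  qed
  have n\<phi>1: "nonzero_mero (\<lambda>z. \<phi> z - 1)"
  proof (rule nonzero_meroI)
    show "(\<lambda>z. \<phi> z - 1) meromorphic_on UNIV" by (intro meromorphic_intros nonzero_mero_mero np)
    show "\<not> (\<forall>\<^sub>\<approx>z. \<phi> z - 1 = 0)" using nonconst[of 1] by simp
  qed
  have nd: "nonzero_mero (deriv \<phi>)"
  proof (rule nonzero_meroI)
    show "deriv \<phi> meromorphic_on UNIV" by (intro meromorphic_intros nonzero_mero_mero np)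
    show "\<not> (\<forall>\<^sub>\<approx>z. deriv \<phi> z = 0)" using deriv_zero_imp_const[OF np] nonconst by metis
  qed
  define w where "w = (\<lambda>z. deriv \<phi> z / (\<phi> z - 1))"
  have nw: "nonzero_mero w" unfolding w_def by (intro nonzero_mero_divide nd n\<phi>1)
  have Gw': "circle_regular w r" if "r \<in> G" for r unfolding w_def using Gw that nw unfolding w_def by blast
  obtain Cs where Cs: "\<And>R. R \<ge> 1 \<Longrightarrow> circle_regular s R \<Longrightarrow> nev_T R s = nev_T R (\<lambda>z. inverse (s z)) + Cs"
    using first_main_theorem[OF s] by metis
  \<comment> \<open>The logarithmic derivative estimate needs the characteristic of \<phi> in a
    window, so the shifts enter through their own domination.\<close>
  have dphi: "dominated (1/2) (\<lambda>r. nev_T r \<phi>)"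
  proof (rule dominated_le)
    show "dominated (1/2) (\<lambda>r. real n * nev_T r f + (\<Sum>l\<in>?I. real (i l) * nev_T r (fl l)) + (nev_T r s + - Cs))"
      unfolding fl_def
      by (intro dominated_add dominated_cmult dominated_sum dominated_const dominated_shift c Gc dominated_mono[OF dominated_f_s(1)] dominated_mono[OF dominated_f_s(2)]) auto
    fix R assume R: "R \<in> G" "R \<ge> 1"
    have "nev_T R \<phi> \<le> nev_T R (\<lambda>z. f z ^ n * (\<Prod>l\<in>?I. fl l z ^ i l)) + nev_T R (\<lambda>z. inverse (s z))"
      unfolding phi divide_inverse
      by (intro nev_T_mult_le nonzero_mero_mult nonzero_mero_power f nP si R circle_regular_mult circle_regular_power circle_regular_inverse Gf Gs GP)
    also have "nev_T R (\<lambda>z. f z ^ n * (\<Prod>l\<in>?I. fl l z ^ i l)) \<le> nev_T R (\<lambda>z. f z ^ n) + nev_T R (\<lambda>z. \<Prod>l\<in>?I. fl l z ^ i l)"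
      by (intro nev_T_mult_le nonzero_mero_power f nP R circle_regular_power Gf GP)
    also have "nev_T R (\<lambda>z. f z ^ n) \<le> real n * nev_T R f" by (intro nev_T_power_le f R Gf)
    also have "nev_T R (\<lambda>z. \<Prod>l\<in>?I. fl l z ^ i l) \<le> (\<Sum>l\<in>?I. nev_T R (\<lambda>z. fl l z ^ i l))"
      by (intro nev_T_prod_le nonzero_mero_power nfl R circle_regular_power Gfl) auto
    also have "\<dots> \<le> (\<Sum>l\<in>?I. real (i l) * nev_T R (fl l))"
      by (intro sum_mono nev_T_power_le nfl R Gfl)
    finally show "nev_T R \<phi> \<le> real n * nev_T R f + (\<Sum>l\<in>?I. real (i l) * nev_T R (fl l)) + (nev_T R s + - Cs)"
      using Cs[OF R(2) Gs[OF R(1)]] by simp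
  qed
  have dphi1: "dominated (1/2) (\<lambda>r. nev_T r (\<lambda>z. \<phi> z - 1))"
    by (rule dominated_le[OF dominated_add[OF dphi dominated_const[of _ "ln 2"]]]) (intro nev_T_diff_one_le np n\<phi>1 Gp G1; assumption)
  have small_err_phi: "small_err (\<lambda>r. nev_m r (\<lambda>z. deriv \<phi> z / \<phi> z))"
    by (rule small_err_log_derivative[OF np Gp dphi])
  \<comment> \<open>\<open>w\<close> is the logarithmic derivative of
    \<open>\<phi> - 1\<close>.\<close>
  have small_err_w: "small_err (\<lambda>r. nev_m r w)"
  proof (rule small_err_mono[OF small_err_log_derivative[OF n\<phi>1 G1[OF n\<phi>1] dphi1]])
    show "\<forall>\<^sub>F r in \<F>. nev_m r w \<le> nev_m r (\<lambda>z. deriv (\<lambda>z. \<phi> z - 1) z / (\<phi> z - 1))"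
      using ev_G ev_r[of 1]
    proof eventually_elim
      case (elim r)
      have r0: "0 \<le> r" using elim(2) by linarith
      have "deriv (\<lambda>z. \<phi> z - 1) z = deriv \<phi> z" if "norm z = r" for z
        using Gp[OF elim(1)] that by (auto simp: circle_regular_def regular_at_def intro!: deriv_diff[THEN trans] analytic_on_imp_differentiable_at)
      then show ?case unfolding nev_m_eq w_def by (intro eq_refl circle_mean_cong r0) simp
    qed
  qed
  define \<psi> where "\<psi> = (\<lambda>z. f z ^ n * shift_monomial m c i f z - s z)"
  have psi: "\<forall>\<^sub>\<approx>z. \<psi> z = s z * (\<phi> z - 1)"
  proof -
    have "\<forall>\<^sub>\<approx>z. s z \<noteq> 0" using s by (simp add: nonzero_mero_def)
    then show ?thesis by eventually_elim (simp add: \<psi>_def \<phi>_def field_simps)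
  qed
  have mpsi: "\<psi> meromorphic_on UNIV"
    unfolding \<psi>_def shift_monomial_def fl_def[symmetric]
    by (intro meromorphic_intros nonzero_mero_mero f s) (use nfl[unfolded fl_def] nonzero_mero_mero in blast)
  have npsi: "nonzero_mero \<psi>" by (rule nonzero_mero_cong[OF nonzero_mero_mult[OF s n\<phi>1] psi mpsi])
  have zpsi: "zorder \<psi> a = zorder s a + zorder (\<lambda>z. \<phi> z - 1) a" for a
    using zorder_cosparse_cong[OF psi, of a] by (simp add: nonzero_mero_zorder_mult s n\<phi>1)
  have npsii: "nonzero_mero (\<lambda>z. 1 / \<psi> z)" by (intro nonzero_mero_divide nonzero_mero_const npsi) simp
  have zpsii: "zorder (\<lambda>z. 1 / \<psi> z) a = - zorder \<psi> a" for a
    using nonzero_mero_zorder_inverse[OF npsi, of a] by (simp add: inverse_eq_divide)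
  obtain Cw where Cw: "\<And>R. R \<ge> 1 \<Longrightarrow> circle_regular w R \<Longrightarrow>
    circle_mean R (\<lambda>z. ln (norm (w z))) = Cw + log_count (\<lambda>a. real_of_int (zorder w a)) R"
    using jensen[OF nw] by metis
  \<comment> \<open>Zeros of \<open>s\<close> are paid for twice, once for poles of \<phi> that they
    create and once for zeros of \<phi> that they cancel. Poles of \<open>s\<close> are paid for
    once, because they can hide a zero of \<open>\<phi> - 1\<close> in
    \<open>\<psi> = s (\<phi> - 1)\<close>.\<close>
  have pointwise: "- real_of_int (zorder w a) + (real n - 1) * zero_ord f a \<le>
     pole_ind f a + ((\<Sum>l\<in>?I. pole_ind f (a + c l)) + (pole_ind (\<lambda>z. 1 / \<psi> z) a + (2 * zero_ord s a + (pole_ord s a + err a))))" for a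
  proof -
    have 1: "- real_of_int (zorder w a) \<le> pole_ind \<phi> a + (if zorder (\<lambda>z. \<phi> z - 1) a > 0 then 1 else 0) - max 0 (real_of_int (zorder \<phi> a) - 1)"
      unfolding w_def by (rule zorder_log_deriv_diff_one[OF np n\<phi>1 nd])
    have pos: "(\<Sum>l\<in>?I. pole_ind f (a + c l)) \<ge> 0" by (intro sum_nonneg) (auto simp: pole_ind_def)
    have 2: "pole_ind \<phi> a \<le> pole_ind f a + (\<Sum>l\<in>?I. pole_ind f (a + c l)) + zero_ord s a"
    proof (cases "zorder \<phi> a < 0 \<and> \<not> zorder f a < 0 \<and> \<not> zorder s a > 0")
      case True
      have "\<exists>l\<in>?I. zorder f (a + c l) < 0"
      proof (rule ccontr)
        assume "\<not> ?thesis"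
        then have "zorder f (a + c l) \<ge> 0" if "l \<in> ?I" for l using that by (auto simp: not_less)
        then have "(\<Sum>l\<in>?I. int (i l) * zorder f (a + c l)) \<ge> 0" by (intro sum_nonneg mult_nonneg_nonneg) simp_all
        moreover have "int n * zorder f a \<ge> 0" using True by simp
        ultimately show False using True zphi[of a] by linarith
      qed
      then obtain l where l: "l \<in> ?I" "zorder f (a + c l) < 0" by auto
      have "pole_ind f (a + c l) \<le> (\<Sum>l\<in>?I. pole_ind f (a + c l))"
        by (rule member_le_sum) (use l in \<open>auto simp: pole_ind_def\<close>)
      then show ?thesis using l True by (simp add: pole_ind_def zero_ord_def)
    next
      case False
      then show ?thesis using pos by (auto simp: pole_ind_def zero_ord_def)
    qed
    have 3: "(if zorder (\<lambda>z. \<phi> z - 1) a > 0 then 1 else 0) \<le> pole_ind (\<lambda>z. 1 / \<psi> z) a + pole_ord s a"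
      using zpsi[of a] by (auto simp: pole_ind_def pole_ord_def zpsii)
    show ?thesis using 1 2 3 zeros[of a] by linarith
  qed
  have Nineq: "- log_count (\<lambda>a. real_of_int (zorder w a)) r + (real n - 1) * nev_N r (\<lambda>z. inverse (f z)) \<le>
     nev_Nbar r f + (\<Sum>l\<in>?I. log_count (\<lambda>a. pole_ind f (a + c l)) r) + nev_Nbar r (\<lambda>z. 1 / \<psi> z)
     + 2 * nev_N r (\<lambda>z. inverse (s z)) + nev_N r s + log_count err r" if r: "r \<ge> 1" for r
  proof -
    have r0: "r > 0" using r by simp
    have lsh: "locally_finite_supp (\<lambda>a. pole_ind f (a + c l))" for l by (rule locally_finite_supp_shift[OF locally_finite_supp_pole_ind[OF f]])
    note loc = locally_finite_supp_pole_ind[OF f] locally_finite_supp_sum[OF _ lsh] locally_finite_supp_pole_ind[OF npsii] locally_finite_supp_zero_ord[OF s] locally_finite_supp_pole_ord[OF s] lerr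
      locally_finite_supp_zero_ord[OF f] locally_finite_supp_zorder[OF nw] lsh
    have lw: "locally_finite_supp (\<lambda>a. - real_of_int (zorder w a))" using locally_finite_supp_cmult[OF locally_finite_supp_zorder[OF nw], of "-1"] by simp
    have "log_count (\<lambda>a. - real_of_int (zorder w a) + (real n - 1) * zero_ord f a) r \<le>
      log_count (\<lambda>a. pole_ind f a + ((\<Sum>l\<in>?I. pole_ind f (a + c l)) + (pole_ind (\<lambda>z. 1 / \<psi> z) a + (2 * zero_ord s a + (pole_ord s a + err a))))) r"
      by (intro log_count_mono r pointwise locally_finite_supp_add locally_finite_supp_cmult loc lw finite_atLeastAtMost)
    also have "\<dots> = log_count (pole_ind f) r + ((\<Sum>l\<in>?I. log_count (\<lambda>a. pole_ind f (a + c l)) r) + (log_count (pole_ind (\<lambda>z. 1 / \<psi> z)) r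
        + (2 * log_count (zero_ord s) r + (log_count (pole_ord s) r + log_count err r))))"
      using r0 by (simp add: log_count_add log_count_sum log_count_cmult locally_finite_supp_add locally_finite_supp_cmult loc)
    also have "log_count (\<lambda>a. - real_of_int (zorder w a) + (real n - 1) * zero_ord f a) r
      = log_count (\<lambda>a. - real_of_int (zorder w a)) r + (real n - 1) * log_count (zero_ord f) r"
      by (simp only: log_count_add[OF r0 lw locally_finite_supp_cmult[OF locally_finite_supp_zero_ord[OF f]]] log_count_cmult[OF r0 locally_finite_supp_zero_ord[OF f]])
    also have "log_count (\<lambda>a. - real_of_int (zorder w a)) r = - log_count (\<lambda>a. real_of_int (zorder w a)) r"
      using log_count_cmult[OF r0 locally_finite_supp_zorder[OF nw], of "-1"] by simp
    finally show ?thesis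
      using r0 by (simp add: nev_N_eq nev_Nbar_eq f s fi si npsii pole_ord_inverse)
  qed
  have mphi: "nev_m r (\<lambda>z. inverse (\<phi> z)) \<le> 2 * nev_m r w + nev_m r (\<lambda>z. deriv \<phi> z / \<phi> z) + ln 2 - circle_mean r (\<lambda>z. ln (norm (w z)))"
    if r: "r \<in> G" "r \<ge> 1" for r
  proof -
    have r0: "r \<ge> 0" using r by simp
    have cw: "continuous_on (sphere 0 r) (\<lambda>z. log_plus (norm (w z)))" by (rule continuous_log_plus_circle_regular[OF Gw'[OF r(1)]])
    have clw: "continuous_on (sphere 0 r) (\<lambda>z. ln (norm (w z)))" by (rule continuous_ln_circle_regular[OF Gw'[OF r(1)]])
    have reg: "regular_at \<phi> z" "w z \<noteq> 0" "\<phi> z - 1 \<noteq> 0" if "norm z = r" for z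
      using Gp[OF r(1)] Gw'[OF r(1)] G1[OF n\<phi>1 r(1)] that by (auto simp: circle_regular_def regular_at_def)
    have "continuous_on (sphere 0 r) (\<lambda>z. deriv \<phi> z / \<phi> z)"
      using reg by (intro continuous_at_imp_continuous_on ballI analytic_at_imp_isCont analytic_intros)
         (auto simp: regular_at_def intro: analytic_deriv)
    then have cl: "continuous_on (sphere 0 r) (\<lambda>z. log_plus (norm (deriv \<phi> z / \<phi> z)))"
      by (intro continuous_log_plus continuous_on_norm)
    have "nev_m r (\<lambda>z. inverse (\<phi> z)) \<le> circle_mean r (\<lambda>z. (2 * log_plus (norm (w z)) + log_plus (norm (deriv \<phi> z / \<phi> z)) + ln 2) - ln (norm (w z)))"
      unfolding nev_m_eq
    proof (rule circle_mean_mono[OF r0])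
      fix z :: complex assume z: "norm z = r"
      have nz: "\<phi> z \<noteq> 0" "w z \<noteq> 0" "\<phi> z - 1 \<noteq> 0" using reg[OF z] by (auto simp: regular_at_def)
      have "w z - deriv \<phi> z / \<phi> z = w z / \<phi> z"
        using nz unfolding w_def by (simp add: field_simps)
      then have eq: "inverse (\<phi> z) = (w z - deriv \<phi> z / \<phi> z) * inverse (w z)" using nz by (simp add: field_simps)
      have "log_plus (norm (inverse (\<phi> z))) \<le> log_plus (norm (w z - deriv \<phi> z / \<phi> z)) + log_plus (inverse (norm (w z)))"
        unfolding eq norm_mult norm_inverse by (intro log_plus_mult_le) auto
      also have "log_plus (norm (w z - deriv \<phi> z / \<phi> z)) \<le> log_plus (norm (w z) + norm (deriv \<phi> z / \<phi> z))"
        by (intro log_plus_mono norm_triangle_ineq4)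
      also have "\<dots> \<le> log_plus (norm (w z)) + log_plus (norm (deriv \<phi> z / \<phi> z)) + ln 2" by (rule log_plus_add_le) auto
      \<comment> \<open>\<open>ln |w|\<close> is kept exactly, so that Jensen's formula applies to
        its mean; this doubles the \<open>log_plus |w|\<close> term, which is an error term
        anyway.\<close>
      also have "log_plus (inverse (norm (w z))) = log_plus (norm (w z)) - ln (norm (w z))"
        using log_plus_diff_inverse[of "norm (w z)"] nz by simp
      finally show "log_plus (norm (inverse (\<phi> z))) \<le> (2 * log_plus (norm (w z)) + log_plus (norm (deriv \<phi> z / \<phi> z)) + ln 2) - ln (norm (w z))" by simp
    qed (intro continuous_on_add continuous_on_diff continuous_on_mult continuous_on_const cw clw cl
          continuous_log_plus_circle_regular[OF circle_regular_inverse[OF Gp[OF r(1)]]])+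
    also have "\<dots> = 2 * nev_m r w + nev_m r (\<lambda>z. deriv \<phi> z / \<phi> z) + ln 2 - circle_mean r (\<lambda>z. ln (norm (w z)))"
      unfolding nev_m_eq using r0
      by (simp only: circle_mean_diff[OF r0 continuous_on_add[OF continuous_on_add[OF continuous_on_mult[OF continuous_on_const cw] cl] continuous_on_const] clw]
          circle_mean_add[OF r0 continuous_on_add[OF continuous_on_mult[OF continuous_on_const cw] cl] continuous_on_const]
          circle_mean_add[OF r0 continuous_on_mult[OF continuous_on_const cw] cl] circle_mean_cmult circle_mean_const)
    finally show ?thesis .
  qed
  have "small_err (\<lambda>r. 2 * nev_m r w + (nev_m r (\<lambda>z. deriv \<phi> z / \<phi> z) + (err1 r + ((\<Sum>l\<in>?I. log_count (\<lambda>a. pole_ind f (a + c l)) r - log_count (pole_ind f) r)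
     + (2 * nev_N r (\<lambda>z. inverse (s z)) + (nev_N r s + (log_count err r + (ln 2 - Cw + (real n - 1) * Cf))))))))"
    by (intro small_err_add small_err_cmult small_err_sum small_err_w small_err_phi small_err_err1 small_err_Nbar_shift small_err_sN small_err_err small_err_const) auto
  then show ?thesis
  proof (rule small_err_mono)
    show "\<forall>\<^sub>F r in \<F>. (real n - 1) * nev_T r f - (real m + 1) * nev_Nbar r f
      - nev_Nbar r (\<lambda>z. 1 / (f z ^ n * shift_monomial m c i f z - s z)) \<le>
      2 * nev_m r w + (nev_m r (\<lambda>z. deriv \<phi> z / \<phi> z) + (err1 r + ((\<Sum>l\<in>?I. log_count (\<lambda>a. pole_ind f (a + c l)) r - log_count (pole_ind f) r)
     + (2 * nev_N r (\<lambda>z. inverse (s z)) + (nev_N r s + (log_count err r + (ln 2 - Cw + (real n - 1) * Cf)))))))"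
      using ev_G ev_r[of 1]
    proof eventually_elim
      case (elim r)
      then have r: "r \<in> G" "r \<ge> 1" by auto
      have "(real n - 1) * nev_T r f = (real n - 1) * nev_m r (\<lambda>z. inverse (f z)) + (real n - 1) * nev_N r (\<lambda>z. inverse (f z)) + (real n - 1) * Cf"
        using Cf[OF r(2) Gf[OF r(1)]] by (simp only: nev_T_def[of r "\<lambda>z. inverse (f z)"] distrib_left)
      \<comment> \<open>Replacing the count of each shifted pole set by that of \<open>f\<close>
        produces \<open>m\<close> copies of \<open>Nbar(r, f)\<close>, in addition to the one from
        \<open>f\<close> itself.\<close>
      moreover have "(\<Sum>l\<in>?I. log_count (\<lambda>a. pole_ind f (a + c l)) r - log_count (pole_ind f) r) = (\<Sum>l\<in>?I. log_count (\<lambda>a. pole_ind f (a + c l)) r) - real m * nev_Nbar r f"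
        using r by (simp add: sum_subtractf nev_Nbar_eq f)
      moreover have "(real m + 1) * nev_Nbar r f = real m * nev_Nbar r f + nev_Nbar r f" by (simp add: algebra_simps)
      ultimately show ?case
        using m_le[OF r] mphi[OF r] Cw[OF r(2) Gw'[OF r(1)]] Nineq[OF r(2)] unfolding \<psi>_def by linarith
    qed
  qed
qed

end

section \<open>From the hyper order to the growth hypotheses, and conclusion\<close>

lemma nev_Nbar_nonneg:
  assumes "g meromorphic_on UNIV" "r \<ge> 1"
  shows "nev_Nbar r g \<ge> 0"
proof (cases "nonzero_mero g")
  case True
  then show ?thesis using assms by (auto simp: nev_Nbar_eq pole_ind_def intro!: log_count_nonneg)
next
  case False
  then have z: "\<forall>\<^sub>\<approx>z. g z = 0" using nonzero_meroI assms by blast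
  have "\<not> is_pole g a" for a
  proof
    assume "is_pole g a"
    then have "eventually (\<lambda>z. g z \<noteq> 0) (at a)" by (rule non_zero_neighbour_pole)
    moreover have "eventually (\<lambda>z. g z = 0) (at a)"
      using z eventually_cosparse_imp_eventually_at by blast
    ultimately have "eventually (\<lambda>z. False) (at a)" by eventually_elim auto
    then show False by simp
  qed
  then show ?thesis by (simp add: nev_Nbar_def integrated_count_def pole_count_distinct_def poles_in_disc_def)
qed

text \<open>A slightly larger exponent absorbs both the dilation by \<open>L\<close> and the factor
  2.\<close>

lemma powr_eventually_le:
  fixes L \<sigma> \<tau> :: real
  assumes "L > 0" "0 < \<sigma>" "\<sigma> < \<tau>"
  shows "eventually (\<lambda>r. ln 2 + (L * r) powr \<sigma> \<le> r powr \<tau>) at_top"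
  using assms by real_asymp

lemma hyper_order_less_one:
  assumes "hyper_order f < 1"
  obtains \<sigma> where "0 < \<sigma>" "\<sigma> < 1" "eventually (\<lambda>r. nev_T r f \<le> exp (r powr \<sigma>)) at_top"
proof -
  obtain y where y: "hyper_order f < y" "y < 1" using dense[OF assms] by auto
  then have "\<bar>y\<bar> \<noteq> \<infinity>" by auto
  then obtain \<sigma>1 where s1: "y = ereal \<sigma>1" by auto
  then have s1': "\<sigma>1 < 1" using y by simp
  \<comment> \<open>The maximum makes the exponent positive without inspecting the sign of
    \<open>\<sigma>1\<close>.\<close>
  define \<sigma> where "\<sigma> = max \<sigma>1 (1/2)"
  have s: "0 < \<sigma>" "\<sigma> < 1" "\<sigma>1 \<le> \<sigma>" using s1' by (auto simp: \<sigma>_def)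
  have "eventually (\<lambda>r. ereal (log_plus (log_plus (nev_T r f)) / ln r) < y) at_top"
    using y(1) unfolding hyper_order_def by (rule Limsup_lessD)
  then have "eventually (\<lambda>r. nev_T r f \<le> exp (r powr \<sigma>)) at_top"
    using eventually_gt_at_top[of 1]
  proof eventually_elim
    case (elim r)
    have l: "ln r > 0" using elim by simp
    have "log_plus (log_plus (nev_T r f)) < \<sigma>1 * ln r" using elim l s1 by (simp add: divide_less_eq)
    also have "\<dots> \<le> \<sigma> * ln r" using s l by (intro mult_right_mono) auto
    finally have "exp (log_plus (log_plus (nev_T r f))) \<le> exp (\<sigma> * ln r)" by simp
    then have "max 1 (log_plus (nev_T r f)) \<le> r powr \<sigma>" using elim by (simp add: log_plus_def powr_def)
    then have "exp (log_plus (nev_T r f)) \<le> exp (r powr \<sigma>)" by simp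
    then have "max 1 (nev_T r f) \<le> exp (r powr \<sigma>)" by (simp add: log_plus_def)
    then show ?case by simp
  qed
  then show thesis using that s by blast
qed

theorem theorem1p2:
  fixes f s :: "complex \<Rightarrow> complex"
    and m n :: nat
    and c :: "nat \<Rightarrow> complex"
    and i :: "nat \<Rightarrow> nat"
  assumes "transcendental_meromorphic f"
    and "hyper_order f < 1"
    and "m \<ge> 1"
    and "\<And>l. l \<in> {1..m} \<Longrightarrow> i l \<ge> 1"
    and "\<And>l. l \<in> {1..m} \<Longrightarrow> c l \<noteq> 0"
    and "inj_on c {1..m}"
    and "n > (\<Sum>l=1..m. i l)"
    and "finite {(a, b). is_pole f a \<and> isolated_zero f b \<and> a - b \<in> c ` {1..m}}"
    and "small_function f s"
    and "\<not> (\<forall>\<^sub>\<approx>z. s z = 0)"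
  shows "\<exists>S \<in> nev_S f. \<forall>r>0.
    2 * nev_Nbar r (\<lambda>z. 1 / (f z ^ n * shift_monomial m c i f z - s z))
      \<ge> (real n - 1) * nev_T r f - (2 * real m + 1) * nev_Nbar r f + S r"
proof -
  have f: "nonzero_mero f" by (rule transcendental_nonzero_mero[OF assms(1)])
  have s: "nonzero_mero s" using assms(9,10) by (intro nonzero_meroI) (auto simp: small_function_def)
  \<comment> \<open>There is at least one factor and all exponents are at least 1, so the degree is
    at least 1.\<close>
  have n: "n \<ge> 2"
  proof -
    have "i 1 \<le> (\<Sum>l=1..m. i l)" by (rule member_le_sum) (use assms(3) in auto)
    moreover have "i 1 \<ge> 1" using assms(3,4) by auto
    ultimately show ?thesis using assms(7) by linarith
  qed
  define \<phi> where "\<phi> = (\<lambda>z. f z ^ n * shift_monomial m c i f z / s z)"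
  define \<phi>1 where "\<phi>1 = (\<lambda>z. \<phi> z - 1)"
  define w where "w = (\<lambda>z. deriv \<phi> z / (\<phi> z - 1))"
  \<comment> \<open>That \<open>\<phi> - 1\<close> and \<open>w\<close> are not identically zero is
    proved only inside \<open>main_inequality\<close>, so their regularity is imposed
    conditionally.\<close>
  define G where "G = {r. circle_regular f r \<and> circle_regular s r \<and> (\<forall>l\<in>{1..m}. circle_regular (\<lambda>z. f (z + c l)) r) \<and>
     (nonzero_mero \<phi>1 \<longrightarrow> circle_regular \<phi>1 r) \<and> (nonzero_mero w \<longrightarrow> circle_regular w r)}"
  have G: "countable (- G)"
  proof (rule countable_subset)
    show "- G \<subseteq> {r. \<not> circle_regular f r} \<union> {r. \<not> circle_regular s r} \<union> (\<Union>l\<in>{1..m}. {r. \<not> circle_regular (\<lambda>z. f (z + c l)) r}) \<union>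
       {r. nonzero_mero \<phi>1 \<and> \<not> circle_regular \<phi>1 r} \<union> {r. nonzero_mero w \<and> \<not> circle_regular w r}" by (auto simp: G_def)
    have "countable {r. nonzero_mero g \<and> \<not> circle_regular g r}" for g
      using countable_bad_radii[of g] by (cases "nonzero_mero g") auto
    then show "countable ({r. \<not> circle_regular f r} \<union> {r. \<not> circle_regular s r} \<union> (\<Union>l\<in>{1..m}. {r. \<not> circle_regular (\<lambda>z. f (z + c l)) r}) \<union>
       {r. nonzero_mero \<phi>1 \<and> \<not> circle_regular \<phi>1 r} \<union> {r. nonzero_mero w \<and> \<not> circle_regular w r})"
      using countable_bad_radii[OF f] countable_bad_radii[OF s] countable_bad_radii[OF nonzero_mero_shift[OF f]]
      by (intro countable_Un countable_UN) auto
  qed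
  have Gf: "circle_regular f r" and Gs: "circle_regular s r" if "r \<in> G" for r using that by (auto simp: G_def)
  obtain Es where Es: "finite_log_measure Es"
    "(\<lambda>r. nev_T r s) \<in> o[inf at_top (principal (- Es))](\<lambda>r. nev_T r f)"
    using assms(9) unfolding small_function_def nev_S_def by blast
  \<comment> \<open>The sum, so that one and the same radius \<open>R\<close> serves
    \<open>f\<close> and \<open>s\<close>.\<close>
  define H where "H = (\<lambda>r. nev_T r f + nev_T r s)"
  have Hmono: "H r \<le> H R" if "1 \<le> r" "r < R" "r \<in> G" "R \<in> G" for r R
    unfolding H_def by (intro add_mono nev_T_mono f s Gf Gs that)
  have small: "eventually (\<lambda>r. nev_T r s \<le> \<epsilon> * nev_T r f) (inf at_top (principal (- Es)))" if "\<epsilon> > 0" for \<epsilon>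
  proof -
    have "eventually (\<lambda>r. r \<ge> 1) (inf at_top (principal (- Es)))"
      by (rule filter_leD[OF inf_le1 eventually_ge_at_top])
    with landau_o.smallD[OF Es(2) that] show ?thesis
      by eventually_elim (use nev_T_nonneg[OF f] in force)
  qed
  obtain \<sigma> where sig: "0 < \<sigma>" "\<sigma> < 1" and Tf: "eventually (\<lambda>r. nev_T r f \<le> exp (r powr \<sigma>)) at_top"
    using hyper_order_less_one[OF assms(2)] by blast
  define \<tau> where "\<tau> = (\<sigma> + 1) / 2"
  have tau: "0 < \<tau>" "\<tau> < 1" "\<sigma> < \<tau>" using sig by (auto simp: \<tau>_def)
  have E0: "finite_log_measure (Es \<union> - G)"
    by (intro finite_log_measure_Un Es finite_log_measure_countable G)
  have growth: "\<exists>r0. \<forall>r\<ge>r0. circle_regular f r \<longrightarrow> K * ln r \<le> nev_T r f" for K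
    by (rule transcendental_growth[OF assms(1)])
  \<comment> \<open>\<open>T(r, s) <= T(r, f)\<close> is known only off \<open>Es\<close>. From any
    regular \<open>r\<close> one moves to some \<open>r' < L r\<close> outside \<open>Es\<close>,
    uses monotonicity of \<open>T(r, s)\<close>, and absorbs the dilation into the exponent
    \<tau>.\<close>
  obtain x0 where x0: "\<And>r. r \<ge> x0 \<Longrightarrow> r \<in> G \<Longrightarrow> 1 \<le> H r \<and> H r \<le> exp (r powr \<tau>)"
  proof -
    obtain L where L: "L > 1" "\<And>r. r \<ge> 1 \<Longrightarrow> \<exists>r'. r < r' \<and> r' < L * r \<and> r' \<notin> Es \<union> - G"
      using finite_log_measure_escape[OF E0] by metis
    obtain x1 where x1: "\<And>r. r \<ge> x1 \<Longrightarrow> nev_T r f \<le> exp (r powr \<sigma>)"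
      using Tf by (auto simp: eventually_at_top_linorder)
    obtain x2 where x2: "\<And>r. r \<ge> x2 \<Longrightarrow> r \<notin> Es \<Longrightarrow> nev_T r s \<le> nev_T r f"
      using small[of 1] by (auto simp: eventually_inf_principal eventually_at_top_linorder)
    obtain x3 where x3: "\<And>r. r \<ge> x3 \<Longrightarrow> ln 2 + (L * r) powr \<sigma> \<le> r powr \<tau>"
      using powr_eventually_le[of L \<sigma> \<tau>] L sig tau by (auto simp: eventually_at_top_linorder)
    obtain x4 where x4: "\<And>r. r \<ge> x4 \<Longrightarrow> circle_regular f r \<Longrightarrow> 1 * ln r \<le> nev_T r f" using growth[of 1] by blast
    show thesis
    proof (rule that[of "Max {x1, x2, x3, x4, exp 1}"])
      fix r assume "r \<ge> Max {x1, x2, x3, x4, exp 1}" and rG: "r \<in> G"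
      then have r: "r \<ge> x1" "r \<ge> x2" "r \<ge> x3" "r \<ge> x4" "r \<ge> exp 1" "r \<ge> 1"
        using exp_gt_one[of "1::real"] by (simp_all, linarith)
      then have "ln r \<ge> 1" by (simp add: ln_ge_iff)
      then have T1: "nev_T r f \<ge> 1" using x4[OF r(4) Gf[OF rG]] by simp
      obtain r' where r': "r < r'" "r' < L * r" "r' \<notin> Es" "r' \<in> G" using L(2)[OF r(6)] by auto
      have mono: "exp (x powr \<sigma>) \<le> exp ((L * r) powr \<sigma>)" if "0 \<le> x" "x \<le> L * r" for x
        using that sig by (simp add: powr_mono2)
      have "nev_T r s \<le> nev_T r' s" by (rule nev_T_mono[OF s]) (use r r' rG Gs in auto)
      also have "\<dots> \<le> nev_T r' f" by (rule x2) (use r r' in auto)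
      also have "\<dots> \<le> exp (r' powr \<sigma>)" by (rule x1) (use r r' in auto)
      also have "\<dots> \<le> exp ((L * r) powr \<sigma>)" by (rule mono) (use r r' in auto)
      finally have 1: "nev_T r s \<le> exp ((L * r) powr \<sigma>)" .
      have "nev_T r f \<le> exp (r powr \<sigma>)" by (rule x1[OF r(1)])
      also have "\<dots> \<le> exp ((L * r) powr \<sigma>)" by (rule mono) (use r r' L(1) in auto)
      finally have "H r \<le> 2 * exp ((L * r) powr \<sigma>)" using 1 by (simp add: H_def)
      also have "\<dots> = exp (ln 2 + (L * r) powr \<sigma>)" by (simp add: exp_add)
      also have "\<dots> \<le> exp (r powr \<tau>)" using x3[OF r(3)] by simp
      finally show "1 \<le> H r \<and> H r \<le> exp (r powr \<tau>)"
        using T1 nev_T_nonneg[OF s r(6)] by (simp add: H_def)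
    qed
  qed
  have "\<exists>E1 \<delta> x. finite_log_measure E1 \<and> 0 < \<delta> \<and> \<delta> < 1 \<and>
    (\<forall>r\<ge>x. r \<in> G \<longrightarrow> r \<notin> E1 \<longrightarrow> (\<exists>R\<in>G. r + r powr \<delta> \<le> R \<and> H R \<le> 2 * H r))"
  proof (rule growth_lemma[of G H \<tau> x0])
    fix E1 \<delta> x
    assume "finite_log_measure E1" "0 < \<delta>" "\<delta> < 1"
      "\<And>r. x \<le> r \<Longrightarrow> r \<in> G \<Longrightarrow> r \<notin> E1 \<Longrightarrow> \<exists>R\<in>G. r + r powr \<delta> \<le> R \<and> H R \<le> 2 * H r"
    then show ?thesis by (intro exI[of _ E1] exI[of _ \<delta>] exI[of _ x] conjI allI impI)
  qed (fact G tau Hmono x0)+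
  then obtain E1 \<delta> x where E1: "finite_log_measure E1" "0 < \<delta>" "\<delta> < 1"
    "\<And>r. r \<ge> x \<Longrightarrow> r \<in> G \<Longrightarrow> r \<notin> E1 \<Longrightarrow> \<exists>R\<in>G. r + r powr \<delta> \<le> R \<and> H R \<le> 2 * H r"
    by auto
  define E where "E = E1 \<union> (Es \<union> - G)"
  have E: "finite_log_measure E" unfolding E_def by (intro finite_log_measure_Un E1 E0)
  have small_E: "eventually (\<lambda>r. nev_T r s \<le> \<epsilon> * nev_T r f) (inf at_top (principal (- E)))" if "\<epsilon> > 0" for \<epsilon>
    by (rule filter_leD[OF _ small[OF that]]) (rule inf_mono, auto simp: E_def)
  have top: "eventually P (inf at_top (principal (- E)))" if "eventually P at_top" for P
    by (rule filter_leD[OF inf_le1 that])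
  have evE: "eventually (\<lambda>r. r \<notin> E) (inf at_top (principal (- E)))"
    by (simp add: eventually_inf_principal)
  interpret nevanlinna_gap f s E G \<delta>
  proof
    show "eventually (\<lambda>r. K * ln r \<le> nev_T r f) (inf at_top (principal (- E)))" for K
    proof -
      obtain r0 where r0: "\<And>r. r \<ge> r0 \<Longrightarrow> circle_regular f r \<Longrightarrow> K * ln r \<le> nev_T r f" using growth[of K] by blast
      show ?thesis using top[OF eventually_ge_at_top[of r0]] evE
        by eventually_elim (use r0 Gf in \<open>auto simp: E_def\<close>)
    qed
    \<comment> \<open>The constant 4 is 2 from the growth lemma times 2 from
      \<open>T(r, s) <= T(r, f)\<close>.\<close>
    show "eventually (\<lambda>r. \<exists>R\<in>G. r + r powr \<delta> \<le> R \<and> nev_T R f + nev_T R s \<le> 4 * nev_T r f) (inf at_top (principal (- E)))"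
      using top[OF eventually_ge_at_top[of x]] evE small_E[OF zero_less_one]
    proof eventually_elim
      case (elim r)
      then obtain R where "R \<in> G" "r + r powr \<delta> \<le> R" "H R \<le> 2 * H r" using E1(4)[of r] by (auto simp: E_def)
      then show ?case using elim(3) by (intro bexI[of _ R]) (auto simp: H_def)
    qed
  qed (use f s E G Gf Gs E1 small_E in \<open>auto simp: E_def\<close>)
  let ?\<psi> = "\<lambda>z. 1 / (f z ^ n * shift_monomial m c i f z - s z)"
  have small_err: "small_err (\<lambda>r. (real n - 1) * nev_T r f - (real m + 1) * nev_Nbar r f - nev_Nbar r ?\<psi>)"
  proof (rule main_inequality[OF n assms(5,8)])
    show "circle_regular (\<lambda>z. f (z + c l)) r" if "l \<in> {1..m}" "r \<in> G" for l r using that by (auto simp: G_def)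
  qed (auto simp: G_def \<phi>1_def w_def \<phi>_def)
  \<comment> \<open>Minus the amount by which the inequality without error term fails, or 0 if it
    holds. The inequality with \<open>S\<close> is then true for every \<open>r\<close>, and only
    smallness of \<open>S\<close> off \<open>E\<close> remains to be shown.\<close>
  define S where "S = (\<lambda>r. min 0 (2 * nev_Nbar r ?\<psi> - ((real n - 1) * nev_T r f - (2 * real m + 1) * nev_Nbar r f)))"
  have mpsi: "?\<psi> meromorphic_on UNIV"
    unfolding shift_monomial_def
    by (intro meromorphic_intros nonzero_mero_mero nonzero_mero_shift f s)
  have "S \<in> o[inf at_top (principal (- E))](\<lambda>r. nev_T r f)"
  proof (rule landau_o.smallI)
    fix \<epsilon> :: real assume "\<epsilon> > 0"
    then have "eventually (\<lambda>r. (real n - 1) * nev_T r f - (real m + 1) * nev_Nbar r f - nev_Nbar r ?\<psi> \<le> \<epsilon> * nev_T r f) (inf at_top (principal (- E)))"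
      using small_err by (simp add: small_err_def)
    then show "eventually (\<lambda>r. norm (S r) \<le> \<epsilon> * norm (nev_T r f)) (inf at_top (principal (- E)))"
      using top[OF eventually_ge_at_top[of 1]]
    proof eventually_elim
      case (elim r)
      have T: "nev_T r f \<ge> 0" by (rule nev_T_nonneg[OF f elim(2)])
      \<comment> \<open>Nonnegativity of both counting functions weakens the constants 1 and
        \<open>m + 1\<close> to 2 and \<open>2 m + 1\<close>.\<close>
      have "nev_Nbar r ?\<psi> \<ge> 0" by (rule nev_Nbar_nonneg[OF mpsi elim(2)])
      moreover have "nev_Nbar r f \<ge> 0" using nev_Nbar_nonneg[OF nonzero_mero_mero[OF f] elim(2)] .
      then have "real m * nev_Nbar r f \<ge> 0" by simp
      moreover have "(2 * real m + 1) * nev_Nbar r f = (real m + 1) * nev_Nbar r f + real m * nev_Nbar r f"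
        by (simp add: algebra_simps)
      ultimately have "- S r \<le> \<epsilon> * nev_T r f"
        using elim(1) mult_nonneg_nonneg[of \<epsilon> "nev_T r f"] T \<open>\<epsilon> > 0\<close> by (auto simp: S_def min_def)
      moreover have "S r \<le> 0" by (simp add: S_def)
      ultimately show ?case using T by simp
    qed
  qed
  then have "S \<in> nev_S f" using E by (auto simp: nev_S_def)
  moreover have "\<forall>r>0. 2 * nev_Nbar r ?\<psi> \<ge> (real n - 1) * nev_T r f - (2 * real m + 1) * nev_Nbar r f + S r"
    by (auto simp: S_def min_def)
  ultimately show ?thesis by blast
qed

end
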